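(* Let $A,J,E_c,E_d\in\mathbb{R}^{n\times n}$ and $0<T_{min}\le T_{max}<\infty$. Consider the stochastic impulsive system $$dx(t)=Ax(t)\,dt+E_cx(t)\,dW_1(t),\ t\neq t_k,\qquad x(t_k^+)=Jx(t_k)+E_dx(t_k)\nu_1(k),\ k\in\mathbb{N},\qquad x(0)=x_0 .$$ The following statements are equivalent: (i) There exists $P\in\mathbb{S}^n_{\succ0}$ such that $$\mathbb{E}[J^T\Xi_P(\theta)J+E_d^T\Xi_P(\theta)E_d]-P\prec0$$ holds for all $\theta\in[T_{min},T_{max}]$. (ii) There exist a matrix-valued function $S:[0,T_{max}]\to\mathbb{S}^n$ with $S(0)\succ0$ and a scalar $\varepsilon>0$ such that $$-\dot S(\tau)+A^TS(\tau)+S(\tau)A+E_c^TS(\tau)E_c\preceq0\quad\text{and}\quad J^TS(\theta)J-S(0)+E_d^TS(\theta)E_d+\varepsilon I\preceq0$$ hold for all $\tau\in[0,T_{max}]$ and all $\theta\in[T_{min},T_{max}]$. Moreover, when one of these equivalent statements holds, the system is mean-square asymptotically stable under ranged dwell-time $(T_{min},T_{max})$, that is, for any sequence of impulse times verifying $T_k=t_{k+1}-t_k\in[T_{min},T_{max}]$ for all $k\in\mathbb{N}_0$ (with $t_0=0$).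
   Context: $\mathbb{S}^n$ is the set of real symmetric $n\times n$ matrices and $\mathbb{S}^n_{\succ0}$ the positive definite ones; $\prec,\preceq,\succ,\succeq$ refer to the (semi)definite order. Setting: $x(t)\in\mathbb{R}^n$, $x_0\in\mathbb{R}^n$; trajectories are left-continuous and $x(t^+):=\lim_{s\downarrow t}x(s)$. The impulse instants $\{t_k\}_{k\in\mathbb{N}}$ are deterministic, $t_0=0$ (no jump occurs at $t_0$), $T_k:=t_{k+1}-t_k$ for $k\in\mathbb{N}_0=\{0,1,2,\dots\}$, $\mathbb{N}=\{1,2,\dots\}$. $W_1$ is a standard scalar Wiener process and the stochastic differential equation is in the Itô sense. $\{\nu_1(k)\}_k$ is a sequence of i.i.d. scalar random variables with zero mean and unit variance, $\nu_1(k)$ being independent of $x(t_k)$; the sequence $\{\nu_1(k)\}$ and the process $W_1$ are independent. The system is mean-square asymptotically stable (for a given sequence of impulse times) if $\mathbb{E}[\|x(t)\|_2^2]\to0$ as $t\to\infty$ (for every $x_0\in\mathbb{R}^n$). $\Phi(t)\in\mathbb{R}^{n\times n}$, $t\ge0$, is the random fundamental solution defined by $d\Phi(t)=A\Phi(t)dt+E_c\Phi(t)dW_1(t)$, $\Phi(0)=I$, and for $Z\in\mathbb{S}^n$, $\Xi_Z(s):=\Phi(s)^TZ\Phi(s)$, $s\ge0$. The matrix-valued function $S$ is differentiable (one-sided derivatives at endpoints), with $\dot S=dS/d\tau$. *)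

theory Defs
  imports "HOL-Probability.Probability"
begin

section \<open>Symmetric matrices and the semidefinite order\<close>

definition symmetric_mat :: "real ^ 'n ^ 'n \<Rightarrow> bool" where
  "symmetric_mat X \<longleftrightarrow> transpose X = X"

definition pos_def :: "real ^ 'n ^ 'n \<Rightarrow> bool" where
  "pos_def X \<longleftrightarrow> symmetric_mat X \<and> (\<forall>v. v \<noteq> 0 \<longrightarrow> v \<bullet> (X *v v) > 0)"

definition pos_semidef :: "real ^ 'n ^ 'n \<Rightarrow> bool" where
  "pos_semidef X \<longleftrightarrow> symmetric_mat X \<and> (\<forall>v. v \<bullet> (X *v v) \<ge> 0)"

definition loewner_less :: "real ^ 'n ^ 'n \<Rightarrow> real ^ 'n ^ 'n \<Rightarrow> bool"  (infix \<open>\<prec>\<^sub>S\<close> 50) where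
  "X \<prec>\<^sub>S Y \<longleftrightarrow> pos_def (Y - X)"

definition loewner_le :: "real ^ 'n ^ 'n \<Rightarrow> real ^ 'n ^ 'n \<Rightarrow> bool"  (infix \<open>\<preceq>\<^sub>S\<close> 50) where
  "X \<preceq>\<^sub>S Y \<longleftrightarrow> pos_semidef (Y - X)"


section \<open>Wiener processes and the Ito integral\<close>

definition wiener_process :: "'w measure \<Rightarrow> (real \<Rightarrow> 'w \<Rightarrow> real) \<Rightarrow> bool" where
  "wiener_process M W \<longleftrightarrow>
     (\<forall>t\<ge>0. W t \<in> borel_measurable M) \<and>
     (AE \<omega> in M. W 0 \<omega> = 0) \<and>
     (AE \<omega> in M. continuous_on {0..} (\<lambda>t. W t \<omega>)) \<and>
     (\<forall>s t. 0 \<le> s \<and> s < t \<longrightarrow>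
        distributed M lborel (\<lambda>\<omega>. W t \<omega> - W s \<omega>) (normal_density 0 (sqrt (t - s)))) \<and>
     (\<forall>(n::nat) p. 0 \<le> p 0 \<and> (\<forall>i<n. p i \<le> p (Suc i)) \<longrightarrow>
        prob_space.indep_vars M (\<lambda>_. borel) (\<lambda>i \<omega>. W (p (Suc i)) \<omega> - W (p i) \<omega>) {..<n})"

text \<open>The sigma-algebra generated by a random variable. (The library's \<open>indep_var\<close> only relates
  random variables with values in one and the same type.)\<close>

definition generated_events :: "'w measure \<Rightarrow> ('w \<Rightarrow> 'a) \<Rightarrow> 'a measure \<Rightarrow> 'w set set" where
  "generated_events M X N = sets (vimage_algebra (space M) X N)"

text \<open>A filtration with respect to which \<open>W\<close> is a Wiener process: \<open>W\<close> is adapted and its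
  increments after time \<open>s\<close> are independent of the past \<open>F s\<close>. The filtration may be larger than
  the one generated by \<open>W\<close>; only its values at nonnegative times matter.\<close>

definition wiener_filtration ::
  "'w measure \<Rightarrow> (real \<Rightarrow> 'w \<Rightarrow> real) \<Rightarrow> (real \<Rightarrow> 'w measure) \<Rightarrow> bool" where
  "wiener_filtration M W F \<longleftrightarrow>
     filtration (space M) F \<and> (\<forall>t. subalgebra M (F t)) \<and>
     (\<forall>t\<ge>0. W t \<in> borel_measurable (F t)) \<and>
     (\<forall>s t. 0 \<le> s \<and> s \<le> t \<longrightarrow>
        prob_space.indep_set M (sets (F s)) (generated_events M (\<lambda>\<omega>. W t \<omega> - W s \<omega>) borel))"

definition is_partition :: "real \<Rightarrow> real \<Rightarrow> nat \<Rightarrow> (nat \<Rightarrow> real) \<Rightarrow> bool" where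
  "is_partition a b n p \<longleftrightarrow> p 0 = a \<and> p n = b \<and> (\<forall>i<n. p i \<le> p (Suc i))"

text \<open>\<open>Z\<close> is (a version of) the Ito integral of \<open>H\<close> with respect to \<open>W\<close> over \<open>[a, b]\<close>. It is only
  used for adapted integrands with almost surely continuous paths on \<open>[a, b]\<close>, for which the Ito
  integral is the limit in probability, as the mesh tends to zero, of the sums evaluated at the left
  endpoints. No square integrability of \<open>H\<close> with respect to the probability measure is required.\<close>

definition has_ito_integral ::
  "'w measure \<Rightarrow> (real \<Rightarrow> 'w \<Rightarrow> real) \<Rightarrow> (real \<Rightarrow> 'w \<Rightarrow> 'e::euclidean_space) \<Rightarrow> real \<Rightarrow> real \<Rightarrow>
   ('w \<Rightarrow> 'e) \<Rightarrow> bool" where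
  "has_ito_integral M W H a b Z \<longleftrightarrow>
     Z \<in> borel_measurable M \<and>
     (\<forall>e>0. \<exists>d>0. \<forall>n p. is_partition a b n p \<and> (\<forall>i<n. p (Suc i) - p i < d) \<longrightarrow>
        measure M {\<omega> \<in> space M.
          norm ((\<Sum>i<n. (W (p (Suc i)) \<omega> - W (p i) \<omega>) *\<^sub>R H (p i) \<omega>) - Z \<omega>) > e} < e)"

text \<open>\<open>Y\<close> is a solution of \<open>dY = f(Y) dt + g(Y) dW\<close> on \<open>[a, b]\<close>, started at time \<open>a\<close> from \<open>Y a\<close>.\<close>

definition solves_sde ::
  "'w measure \<Rightarrow> (real \<Rightarrow> 'w \<Rightarrow> real) \<Rightarrow> (real \<Rightarrow> 'w measure) \<Rightarrow> ('e \<Rightarrow> 'e) \<Rightarrow> ('e \<Rightarrow> 'e) \<Rightarrow>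
   real \<Rightarrow> real \<Rightarrow> (real \<Rightarrow> 'w \<Rightarrow> 'e::euclidean_space) \<Rightarrow> bool" where
  "solves_sde M W F f g a b Y \<longleftrightarrow>
     (\<forall>t\<in>{a..b}. Y t \<in> borel_measurable (F t)) \<and>
     (AE \<omega> in M. continuous_on {a..b} (\<lambda>t. Y t \<omega>)) \<and>
     (\<forall>t\<in>{a..b}. \<exists>Z. has_ito_integral M W (\<lambda>s \<omega>. g (Y s \<omega>)) a t Z \<and>
        (AE \<omega> in M. Y t \<omega> = Y a \<omega> + integral {a..t} (\<lambda>s. f (Y s \<omega>)) + Z \<omega>))"


section \<open>The fundamental solution\<close>

definition fundamental_solution ::
  "'w measure \<Rightarrow> (real \<Rightarrow> 'w \<Rightarrow> real) \<Rightarrow> real ^ 'n ^ 'n \<Rightarrow> real ^ 'n ^ 'n \<Rightarrow>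
   (real \<Rightarrow> 'w \<Rightarrow> real ^ 'n ^ 'n) \<Rightarrow> bool" where
  "fundamental_solution M W A Ec \<Phi> \<longleftrightarrow>
     (\<exists>F. wiener_filtration M W F \<and>
        (AE \<omega> in M. \<Phi> 0 \<omega> = mat 1) \<and>
        (\<forall>b\<ge>0. solves_sde M W F (\<lambda>X. A ** X) (\<lambda>X. Ec ** X) 0 b \<Phi>))"

definition Xi ::
  "(real \<Rightarrow> 'w \<Rightarrow> real ^ 'n ^ 'n) \<Rightarrow> real ^ 'n ^ 'n \<Rightarrow> real \<Rightarrow> 'w \<Rightarrow> real ^ 'n ^ 'n" where
  "Xi \<Phi> Z s \<omega> = transpose (\<Phi> s \<omega>) ** Z ** \<Phi> s \<omega>"


section \<open>The stochastic impulsive system\<close>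

text \<open>Only the variables \<open>\<nu> k\<close> with \<open>k \<ge> 1\<close> are used.\<close>

definition jump_noise :: "'w measure \<Rightarrow> (nat \<Rightarrow> 'w \<Rightarrow> real) \<Rightarrow> bool" where
  "jump_noise M \<nu> \<longleftrightarrow>
     prob_space.indep_vars M (\<lambda>_. borel) \<nu> {1..} \<and>
     (\<forall>k\<ge>1. distr M borel (\<nu> k) = distr M borel (\<nu> 1)) \<and>
     (\<forall>k\<ge>1. integrable M (\<lambda>\<omega>. (\<nu> k \<omega>)\<^sup>2) \<and>
        prob_space.expectation M (\<nu> k) = 0 \<and> prob_space.variance M (\<nu> k) = 1)"

definition independent_noises ::
  "'w measure \<Rightarrow> (real \<Rightarrow> 'w \<Rightarrow> real) \<Rightarrow> (nat \<Rightarrow> 'w \<Rightarrow> real) \<Rightarrow> bool" where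
  "independent_noises M W \<nu> \<longleftrightarrow>
     prob_space.indep_set M
       (generated_events M (\<lambda>\<omega>. \<lambda>t\<in>{0..}. W t \<omega>) (Pi\<^sub>M {0..} (\<lambda>_. borel)))
       (generated_events M (\<lambda>\<omega>. \<lambda>k\<in>{1..}. \<nu> k \<omega>) (Pi\<^sub>M {1..} (\<lambda>_. borel)))"

text \<open>The value of the state immediately after the instant \<open>t k\<close>; there is no jump at \<open>t 0\<close>.\<close>

definition post_jump ::
  "real ^ 'n ^ 'n \<Rightarrow> real ^ 'n ^ 'n \<Rightarrow> (nat \<Rightarrow> 'w \<Rightarrow> real) \<Rightarrow> (nat \<Rightarrow> real) \<Rightarrow>
   (real \<Rightarrow> 'w \<Rightarrow> real ^ 'n) \<Rightarrow> nat \<Rightarrow> 'w \<Rightarrow> real ^ 'n" where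
  "post_jump J Ed \<nu> t x k \<omega> =
     (if k = 0 then x (t 0) \<omega> else J *v x (t k) \<omega> + \<nu> k \<omega> *\<^sub>R (Ed *v x (t k) \<omega>))"

text \<open>On \<open>[t k, t (Suc k)]\<close> the state solves the stochastic differential equation, once its value at
  \<open>t k\<close> itself is replaced by the post-jump value. Since solutions have continuous paths on closed
  intervals, this says that \<open>x\<close> is left-continuous with \<open>x(t\<^sub>k\<^sup>+)\<close> equal to the post-jump value.
  The filtration is existentially quantified because it depends on the impulse times: it may be
  generated by \<open>W\<close> up to time \<open>s\<close> and the \<open>\<nu> k\<close> with \<open>t k \<le> s\<close>, so \<open>\<nu> k\<close> is only required to be
  independent of \<open>x (t k)\<close>, not of \<open>F (t k)\<close>.\<close>

definition impulsive_solution ::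
  "'w measure \<Rightarrow> (real \<Rightarrow> 'w \<Rightarrow> real) \<Rightarrow> (nat \<Rightarrow> 'w \<Rightarrow> real) \<Rightarrow>
   real ^ 'n ^ 'n \<Rightarrow> real ^ 'n ^ 'n \<Rightarrow> real ^ 'n ^ 'n \<Rightarrow> real ^ 'n ^ 'n \<Rightarrow>
   (nat \<Rightarrow> real) \<Rightarrow> real ^ 'n \<Rightarrow> (real \<Rightarrow> 'w \<Rightarrow> real ^ 'n) \<Rightarrow> bool" where
  "impulsive_solution M W \<nu> A Ec J Ed t x0 x \<longleftrightarrow>
     (\<exists>F. wiener_filtration M W F \<and>
        (AE \<omega> in M. x 0 \<omega> = x0) \<and>
        (\<forall>k\<ge>1. prob_space.indep_set M (generated_events M (\<nu> k) borel)
                                          (generated_events M (x (t k)) borel)) \<and>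
        (\<forall>k. solves_sde M W F (\<lambda>v. A *v v) (\<lambda>v. Ec *v v) (t k) (t (Suc k))
               (\<lambda>s \<omega>. if s = t k then post_jump J Ed \<nu> t x k \<omega> else x s \<omega>)))"

definition dwell_times_in :: "real \<Rightarrow> real \<Rightarrow> (nat \<Rightarrow> real) \<Rightarrow> bool" where
  "dwell_times_in Tmin Tmax t \<longleftrightarrow> t 0 = 0 \<and> (\<forall>k. t (Suc k) - t k \<in> {Tmin..Tmax})"

text \<open>The second moment is a nonnegative integral, so that it is meaningful (possibly infinite)
  without an a priori integrability assumption.\<close>

definition mean_square_stable ::
  "'w measure \<Rightarrow> (real \<Rightarrow> 'w \<Rightarrow> real) \<Rightarrow> (nat \<Rightarrow> 'w \<Rightarrow> real) \<Rightarrow>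
   real ^ 'n ^ 'n \<Rightarrow> real ^ 'n ^ 'n \<Rightarrow> real ^ 'n ^ 'n \<Rightarrow> real ^ 'n ^ 'n \<Rightarrow>
   (nat \<Rightarrow> real) \<Rightarrow> bool" where
  "mean_square_stable M W \<nu> A Ec J Ed t \<longleftrightarrow>
     (\<forall>x0 x. impulsive_solution M W \<nu> A Ec J Ed t x0 x \<longrightarrow>
        ((\<lambda>s. \<integral>\<^sup>+ \<omega>. ennreal ((norm (x s \<omega>))\<^sup>2) \<partial>M) \<longlongrightarrow> 0) at_top)"


section \<open>The two conditions\<close>

definition moment_condition ::
  "'w measure \<Rightarrow> (real \<Rightarrow> 'w \<Rightarrow> real ^ 'n ^ 'n) \<Rightarrow> real ^ 'n ^ 'n \<Rightarrow> real ^ 'n ^ 'n \<Rightarrow>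
   real \<Rightarrow> real \<Rightarrow> bool" where
  "moment_condition M \<Phi> J Ed Tmin Tmax \<longleftrightarrow>
     (\<exists>P. pos_def P \<and>
        (\<forall>\<theta>\<in>{Tmin..Tmax}.
           prob_space.expectation M
             (\<lambda>\<omega>. transpose J ** Xi \<Phi> P \<theta> \<omega> ** J + transpose Ed ** Xi \<Phi> P \<theta> \<omega> ** Ed) - P \<prec>\<^sub>S 0))"

definition clock_condition ::
  "real ^ 'n ^ 'n \<Rightarrow> real ^ 'n ^ 'n \<Rightarrow> real ^ 'n ^ 'n \<Rightarrow> real ^ 'n ^ 'n \<Rightarrow> real \<Rightarrow> real \<Rightarrow> bool" where
  "clock_condition A Ec J Ed Tmin Tmax \<longleftrightarrow>
     (\<exists>(S :: real \<Rightarrow> real ^ 'n ^ 'n) (\<epsilon>::real).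
        (\<forall>\<tau>\<in>{0..Tmax}. symmetric_mat (S \<tau>)) \<and>
        S differentiable_on {0..Tmax} \<and>
        pos_def (S 0) \<and> \<epsilon> > 0 \<and>
        (\<forall>\<tau>\<in>{0..Tmax}.
           - vector_derivative S (at \<tau> within {0..Tmax})
             + transpose A ** S \<tau> + S \<tau> ** A + transpose Ec ** S \<tau> ** Ec \<preceq>\<^sub>S 0) \<and>
        (\<forall>\<theta>\<in>{Tmin..Tmax}.
           transpose J ** S \<theta> ** J - S 0 + transpose Ed ** S \<theta> ** Ed + \<epsilon> *\<^sub>R mat 1 \<preceq>\<^sub>S 0))"

end

theory Submission
  imports Defs "HOL-Real_Asymp.Real_Asymp"
begin

text \<open>The core is Dynkin's formula for second moments: if \<open>dY = f(Y) dt + g(Y) dW\<close> with \<open>f\<close>, \<open>g\<close> linear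
  and \<open>Y\<close> initially square integrable, then for every bilinear form \<open>\<beta>\<close>
  the derivative of \<open>E \<beta>(Y, Y)\<close> is \<open>E (\<beta>(f Y, Y) + \<beta>(Y, f Y) + \<beta>(g Y, g Y))\<close>. Since the Ito integral is
  only a limit in probability of Riemann sums, everything is done with Euler sums on uniform grids: they converge in
  probability to the increments of \<open>Y\<close>, their second moments are controlled by the discrete Ito isometry, and
  Fatou's lemma transfers the bounds to the limit.

  Pairing the second moment matrix of a solution at time \<open>s\<close> with \<open>S (\<theta> - s)\<close> gives a function with nonpositive
  derivative when \<open>S\<close> satisfies the differential Lyapunov inequality. Applied to the fundamental solution this yields
  \<open>E \<Phi>(\<theta>)\<^sup>T S(0) \<Phi>(\<theta>) \<le> S(\<theta>)\<close>, with equality for the Lyapunov differential equation, which links the two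
  conditions (compactness of the dwell-time interval and of the unit sphere provides \<open>\<epsilon>\<close>). Applied to the state between
  impulses it shows that \<open>E x(t\<^sub>k)\<^sup>T S(0) x(t\<^sub>k)\<close> decreases geometrically.\<close>

section \<open>Square-integrable random vectors\<close>

text \<open>A solution comes only with adaptedness, continuous paths and an integral equation:
  neither finite moments nor a chain rule are given. So an a priori moment bound has to be proved
  first, and Ito's formula is replaced by a one-step expansion with an error of order 3/2 in the
  step length. The expansion only looks forward from the left end of an interval. It still yields
  two-sided derivatives, because the generator of a bilinear form is again a bilinear form and the
  expansion can be applied to it once more.

  The clock of \<open>S\<close> is run backwards, from the dwell time at the start of an interval to
  0 at its end. Intervals of different lengths then all end in the same form \<open>S 0\<close>,
  which is why a single matrix can serve every dwell time.

  At an impulse, \<open>\<nu> k\<close> is known to be independent of \<open>x (t k)\<close> only,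
  not of the filtration, so the jump balance is computed relative to the sigma-algebra generated by
  \<open>x (t k)\<close>.\<close>

definition sq_integrable :: "'w measure \<Rightarrow> ('w \<Rightarrow> 'e::euclidean_space) \<Rightarrow> bool" where
  "sq_integrable M X \<longleftrightarrow> X \<in> borel_measurable M \<and> integrable M (\<lambda>\<omega>. (norm (X \<omega>))\<^sup>2)"

lemma sq_integrable_norm: "sq_integrable M X \<Longrightarrow> integrable M (\<lambda>\<omega>. (norm (X \<omega>))\<^sup>2)"
  by (simp add: sq_integrable_def)

lemma sq_integrable_bound:
  assumes "sq_integrable M X" "Y \<in> borel_measurable M" "AE \<omega> in M. norm (Y \<omega>) \<le> c * norm (X \<omega>)"
  shows "sq_integrable M Y"
  unfolding sq_integrable_def
proof (rule conjI[OF assms(2) Bochner_Integration.integrable_bound])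
  show "integrable M (\<lambda>\<omega>. c\<^sup>2 * (norm (X \<omega>))\<^sup>2)"
    using assms(1) by (simp add: sq_integrable_def)
  show "(\<lambda>\<omega>. (norm (Y \<omega>))\<^sup>2) \<in> borel_measurable M"
    using assms(2) by measurable
  show "AE \<omega> in M. norm ((norm (Y \<omega>))\<^sup>2) \<le> norm (c\<^sup>2 * (norm (X \<omega>))\<^sup>2)"
    using assms(3)
  proof eventually_elim
    case (elim \<omega>)
    from power_mono[OF this, of 2] show ?case by (simp add: power_mult_distrib)
  qed
qed

lemma norm_add_squared_le:
  fixes x y :: "'a::real_inner"
  shows "(norm (x + y))\<^sup>2 \<le> 2 * (norm x)\<^sup>2 + 2 * (norm y)\<^sup>2"
proof -
  have "(norm (x + y))\<^sup>2 + (norm (x - y))\<^sup>2 = 2 * (norm x)\<^sup>2 + 2 * (norm y)\<^sup>2"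
    by (simp add: power2_norm_eq_inner inner_add inner_diff inner_commute algebra_simps)
  then show ?thesis
    by (smt (verit) zero_le_power2)
qed

lemma sq_integrable_add:
  assumes "sq_integrable M X" "sq_integrable M Y"
  shows "sq_integrable M (\<lambda>\<omega>. X \<omega> + Y \<omega>)"
  unfolding sq_integrable_def
proof (rule conjI[OF _ Bochner_Integration.integrable_bound])
  have [measurable]: "X \<in> borel_measurable M" "Y \<in> borel_measurable M"
    using assms by (auto simp: sq_integrable_def)
  show "(\<lambda>\<omega>. X \<omega> + Y \<omega>) \<in> borel_measurable M"
    "(\<lambda>\<omega>. (norm (X \<omega> + Y \<omega>))\<^sup>2) \<in> borel_measurable M"
    by measurable
  show "integrable M (\<lambda>\<omega>. 2 * (norm (X \<omega>))\<^sup>2 + 2 * (norm (Y \<omega>))\<^sup>2)"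
    using assms by (simp add: sq_integrable_def)
  show "AE \<omega> in M. norm ((norm (X \<omega> + Y \<omega>))\<^sup>2) \<le> norm (2 * (norm (X \<omega>))\<^sup>2 + 2 * (norm (Y \<omega>))\<^sup>2)"
    using norm_add_squared_le by (auto intro!: AE_I2 simp: abs_of_nonneg)
qed

lemma sq_integrable_scaleR:
  assumes "sq_integrable M X" shows "sq_integrable M (\<lambda>\<omega>. c *\<^sub>R X \<omega>)"
proof (rule sq_integrable_bound[OF assms, of _ "\<bar>c\<bar>"])
  show "(\<lambda>\<omega>. c *\<^sub>R X \<omega>) \<in> borel_measurable M"
    using assms by (intro borel_measurable_scaleR) (simp_all add: sq_integrable_def)
qed auto

lemma sq_integrable_zero: "sq_integrable M (\<lambda>_. 0)"
  by (simp add: sq_integrable_def)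

lemma sq_integrable_sum:
  assumes "\<And>i. i \<in> I \<Longrightarrow> sq_integrable M (X i)"
  shows "sq_integrable M (\<lambda>\<omega>. \<Sum>i\<in>I. X i \<omega>)"
  using assms
proof (induction I rule: infinite_finite_induct)
  case (insert i I)
  then have "sq_integrable M (\<lambda>\<omega>. X i \<omega> + (\<Sum>i\<in>I. X i \<omega>))"
    by (intro sq_integrable_add) simp_all
  with insert show ?case by simp
qed (simp_all add: sq_integrable_zero)

lemma bounded_linear_borel_measurable:
  assumes "bounded_linear f" "X \<in> borel_measurable M"
  shows "(\<lambda>\<omega>. f (X \<omega>)) \<in> borel_measurable M"
  using assms(2) borel_measurable_continuous_onI[OF linear_continuous_on[OF assms(1)]]
  by (rule measurable_compose)

lemma sq_integrable_linear:
  assumes "bounded_linear f" "sq_integrable M X"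
  shows "sq_integrable M (\<lambda>\<omega>. f (X \<omega>))"
proof -
  obtain K where "\<And>x. norm (f x) \<le> norm x * K"
    using bounded_linear.bounded[OF assms(1)] by blast
  then show ?thesis
    using assms bounded_linear_borel_measurable[OF assms(1)]
    by (intro sq_integrable_bound[OF assms(2), of _ K]) (auto simp: sq_integrable_def mult.commute)
qed

lemma bounded_bilinear_borel_measurable:
  assumes "bounded_bilinear \<beta>" "X \<in> borel_measurable M" "Y \<in> borel_measurable M"
  shows "(\<lambda>\<omega>. \<beta> (X \<omega> :: 'a::euclidean_space) (Y \<omega> :: 'b::euclidean_space)) \<in> borel_measurable M"
  by (rule borel_measurable_continuous_Pair[OF assms(2,3)])
     (intro bounded_bilinear.continuous_on[OF assms(1)] continuous_intros)

text \<open>Young's inequality. The weight \<open>c\<close> is left free so that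
  \<open>c = sqrt (t - s)\<close> can balance two factors whose second moments differ by one order
  in \<open>t - s\<close>; this does the work of the Cauchy-Schwarz inequality for
  expectations.\<close>

lemma mult_le_weighted_squares:
  fixes a b c :: real
  assumes "0 < c"
  shows "a * b \<le> (c * a\<^sup>2 + b\<^sup>2 / c) / 2"
proof -
  have "0 \<le> (c * a - b)\<^sup>2 / c" using assms by simp
  also have "(c * a - b)\<^sup>2 / c = c * a\<^sup>2 + b\<^sup>2 / c - 2 * (a * b)"
    using assms by (simp add: field_simps power2_eq_square)
  finally show ?thesis by simp
qed

lemma bounded_bilinear_weighted_bound:
  assumes "\<And>x y. norm (\<beta> x y) \<le> norm x * norm y * K" "0 \<le> K" "0 < c"
  shows "norm (\<beta> x y) \<le> K / 2 * (c * (norm x)\<^sup>2 + (norm y)\<^sup>2 / c)"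
proof -
  have "norm x * norm y * K \<le> (c * (norm x)\<^sup>2 + (norm y)\<^sup>2 / c) / 2 * K"
    by (intro mult_right_mono mult_le_weighted_squares assms)
  also have "\<dots> = K / 2 * (c * (norm x)\<^sup>2 + (norm y)\<^sup>2 / c)" by simp
  finally show ?thesis using assms(1)[of x y] by linarith
qed

lemma integrable_bilinear:
  fixes \<beta> :: "'a::euclidean_space \<Rightarrow> 'b::euclidean_space \<Rightarrow> 'c::euclidean_space"
  assumes \<beta>: "bounded_bilinear \<beta>" and XY: "sq_integrable M X" "sq_integrable M Y"
  shows "integrable M (\<lambda>\<omega>. \<beta> (X \<omega>) (Y \<omega>))"
proof -
  obtain K where K: "0 \<le> K" "\<And>x y. norm (\<beta> x y) \<le> norm x * norm y * K"
    using bounded_bilinear.nonneg_bounded[OF \<beta>] by auto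
  show ?thesis
  proof (rule Bochner_Integration.integrable_bound)
    show "integrable M (\<lambda>\<omega>. K / 2 * (1 * (norm (X \<omega>))\<^sup>2 + (norm (Y \<omega>))\<^sup>2 / 1))"
      using XY by (simp add: sq_integrable_def)
    show "(\<lambda>\<omega>. \<beta> (X \<omega>) (Y \<omega>)) \<in> borel_measurable M"
      using XY by (intro bounded_bilinear_borel_measurable[OF \<beta>]) (auto simp: sq_integrable_def)
    show "AE \<omega> in M. norm (\<beta> (X \<omega>) (Y \<omega>))
        \<le> norm (K / 2 * (1 * (norm (X \<omega>))\<^sup>2 + (norm (Y \<omega>))\<^sup>2 / 1))"
    proof (rule AE_I2)
      fix \<omega>
      show "norm (\<beta> (X \<omega>) (Y \<omega>)) \<le> norm (K / 2 * (1 * (norm (X \<omega>))\<^sup>2 + (norm (Y \<omega>))\<^sup>2 / 1))"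
        unfolding real_norm_def
        by (rule order_trans[OF bounded_bilinear_weighted_bound[OF K(2,1)] abs_ge_self]) simp
    qed
  qed
qed

lemma expectation_bilinear_bound:
  fixes \<beta> :: "'a::euclidean_space \<Rightarrow> 'b::euclidean_space \<Rightarrow> real"
  assumes \<beta>: "bounded_bilinear \<beta>" and XY: "sq_integrable M X" "sq_integrable M Y"
    and K: "\<And>x y. \<bar>\<beta> x y\<bar> \<le> norm x * norm y * K" "0 \<le> K" "0 < c"
  shows "\<bar>\<integral>\<omega>. \<beta> (X \<omega>) (Y \<omega>) \<partial>M\<bar> \<le>
    K / 2 * (c * (\<integral>\<omega>. (norm (X \<omega>))\<^sup>2 \<partial>M) + (\<integral>\<omega>. (norm (Y \<omega>))\<^sup>2 \<partial>M) / c)"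
proof -
  have "\<bar>\<integral>\<omega>. \<beta> (X \<omega>) (Y \<omega>) \<partial>M\<bar> \<le> (\<integral>\<omega>. \<bar>\<beta> (X \<omega>) (Y \<omega>)\<bar> \<partial>M)"
    by (rule integral_abs_bound)
  also have "\<dots> \<le> (\<integral>\<omega>. K / 2 * (c * (norm (X \<omega>))\<^sup>2 + (norm (Y \<omega>))\<^sup>2 / c) \<partial>M)"
    using XY bounded_bilinear_weighted_bound[of \<beta> K c] K
    by (intro integral_mono integrable_abs integrable_bilinear[OF \<beta>]) (auto simp: sq_integrable_def)
  also have "\<dots> = K / 2 * (c * (\<integral>\<omega>. (norm (X \<omega>))\<^sup>2 \<partial>M) + (\<integral>\<omega>. (norm (Y \<omega>))\<^sup>2 \<partial>M) / c)"
    using XY by (simp add: sq_integrable_def)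
  finally show ?thesis .
qed

lemma integrable_inner_sq:
  "sq_integrable M X \<Longrightarrow> sq_integrable M Y \<Longrightarrow> integrable M (\<lambda>\<omega>. X \<omega> \<bullet> Y \<omega>)"
  by (rule integrable_bilinear[OF bounded_bilinear_inner])

text \<open>Meant for drift terms: each carries a factor \<open>(t - s) / n\<close>, so the crude
  factor \<open>n\<close> is harmless. The noise terms, of order \<open>sqrt ((t - s) / n)\<close>,
  need the orthogonality in \<open>ito_isometry\<close> instead.\<close>

lemma expectation_norm_sum_squared_le:
  fixes X :: "nat \<Rightarrow> 'w \<Rightarrow> 'e::euclidean_space"
  assumes "\<And>i. i < n \<Longrightarrow> sq_integrable M (X i)"
  shows "(\<integral>\<omega>. (norm (\<Sum>i<n. X i \<omega>))\<^sup>2 \<partial>M) \<le> n * (\<Sum>i<n. \<integral>\<omega>. (norm (X i \<omega>))\<^sup>2 \<partial>M)"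
proof -
  have pt: "(norm (\<Sum>i<n. X i \<omega>))\<^sup>2 \<le> n * (\<Sum>i<n. (norm (X i \<omega>))\<^sup>2)" for \<omega>
  proof -
    have "(norm (\<Sum>i<n. X i \<omega>))\<^sup>2 \<le> (\<Sum>i<n. norm (X i \<omega>))\<^sup>2"
      by (intro power_mono norm_sum) auto
    also have "\<dots> \<le> (\<Sum>i<n. (norm (X i \<omega>))\<^sup>2) * card {..<n}"
      by (rule sum_squared_le_sum_of_squares)
    finally show ?thesis by (simp add: mult.commute)
  qed
  have "(\<integral>\<omega>. (norm (\<Sum>i<n. X i \<omega>))\<^sup>2 \<partial>M) \<le> (\<integral>\<omega>. n * (\<Sum>i<n. (norm (X i \<omega>))\<^sup>2) \<partial>M)"
    using assms pt
    by (intro integral_mono sq_integrable_norm sq_integrable_sum) (auto simp: sq_integrable_def)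
  also have "\<dots> = n * (\<Sum>i<n. \<integral>\<omega>. (norm (X i \<omega>))\<^sup>2 \<partial>M)"
    using assms by (simp add: sq_integrable_def)
  finally show ?thesis .
qed

lemma expectation_norm_add_squared_le:
  fixes X Y :: "'w \<Rightarrow> 'e::euclidean_space"
  assumes "sq_integrable M X" "sq_integrable M Y"
  shows "(\<integral>\<omega>. (norm (X \<omega> + Y \<omega>))\<^sup>2 \<partial>M)
    \<le> 2 * (\<integral>\<omega>. (norm (X \<omega>))\<^sup>2 \<partial>M) + 2 * (\<integral>\<omega>. (norm (Y \<omega>))\<^sup>2 \<partial>M)"
proof -
  have "(\<integral>\<omega>. (norm (X \<omega> + Y \<omega>))\<^sup>2 \<partial>M) \<le> (\<integral>\<omega>. 2 * (norm (X \<omega>))\<^sup>2 + 2 * (norm (Y \<omega>))\<^sup>2 \<partial>M)"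
    using assms norm_add_squared_le
    by (intro integral_mono sq_integrable_norm sq_integrable_add) (auto simp: sq_integrable_def)
  also have "\<dots> = 2 * (\<integral>\<omega>. (norm (X \<omega>))\<^sup>2 \<partial>M) + 2 * (\<integral>\<omega>. (norm (Y \<omega>))\<^sup>2 \<partial>M)"
    using assms by (simp add: sq_integrable_def)
  finally show ?thesis .
qed

lemma expectation_norm_linear_squared_le:
  fixes X :: "'w \<Rightarrow> 'e::euclidean_space" and f :: "'e \<Rightarrow> 'd::euclidean_space"
  assumes "bounded_linear f" "\<And>x. norm (f x) \<le> K * norm x" "sq_integrable M X"
  shows "(\<integral>\<omega>. (norm (f (X \<omega>)))\<^sup>2 \<partial>M) \<le> K\<^sup>2 * (\<integral>\<omega>. (norm (X \<omega>))\<^sup>2 \<partial>M)"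
proof -
  have pt: "(norm (f x))\<^sup>2 \<le> K\<^sup>2 * (norm x)\<^sup>2" for x
    using power_mono[OF assms(2)[of x], of 2] by (simp add: power_mult_distrib)
  have "(\<integral>\<omega>. (norm (f (X \<omega>)))\<^sup>2 \<partial>M) \<le> (\<integral>\<omega>. K\<^sup>2 * (norm (X \<omega>))\<^sup>2 \<partial>M)"
    using assms(3)
    by (intro integral_mono sq_integrable_norm[OF sq_integrable_linear[OF assms(1)]] pt)
       (simp_all add: sq_integrable_def)
  then show ?thesis by simp
qed

section \<open>Convergence in probability\<close>

text \<open>The expected truncated distance metrizes convergence in probability. In this form limits
  are limits of real numbers, and an almost surely convergent subsequence is obtained from
  convergence in \<open>L\<^sup>1\<close>.\<close>

definition tendsto_prob :: "'w measure \<Rightarrow> (nat \<Rightarrow> 'w \<Rightarrow> 'e::euclidean_space) \<Rightarrow> ('w \<Rightarrow> 'e) \<Rightarrow> bool" where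
  "tendsto_prob M X Z \<longleftrightarrow> (\<lambda>n. \<integral>\<omega>. min 1 (norm (X n \<omega> - Z \<omega>)) \<partial>M) \<longlonglongrightarrow> 0"

context prob_space
begin

lemma integrable_min_1_norm:
  assumes "X \<in> borel_measurable M"
  shows "integrable M (\<lambda>\<omega>. min 1 (norm (X \<omega>)))"
  using assms by (intro integrable_const_bound[of _ 1]) auto

text \<open>Serves for operations that do not increase distances: adding the same vector to a
  sequence and its limit, subtracting a common term, or multiplying by an indicator.\<close>

lemma tendsto_prob_dominated:
  assumes "tendsto_prob M X Z"
    and "\<And>n. X n \<in> borel_measurable M" "Z \<in> borel_measurable M"
    and "\<And>n. X' n \<in> borel_measurable M" "Z' \<in> borel_measurable M"
    and "\<And>n. AE \<omega> in M. norm (X' n \<omega> - Z' \<omega>) \<le> norm (X n \<omega> - Z \<omega>)"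
  shows "tendsto_prob M X' Z'"
  unfolding tendsto_prob_def
proof (rule tendsto_sandwich[OF _ _ tendsto_const assms(1)[unfolded tendsto_prob_def]])
  show "\<forall>\<^sub>F n in sequentially. 0 \<le> (\<integral>\<omega>. min 1 (norm (X' n \<omega> - Z' \<omega>)) \<partial>M)"
    by (intro always_eventually allI integral_nonneg_AE) auto
  have "(\<integral>\<omega>. min 1 (norm (X' n \<omega> - Z' \<omega>)) \<partial>M) \<le> (\<integral>\<omega>. min 1 (norm (X n \<omega> - Z \<omega>)) \<partial>M)" for n
  proof (intro integral_mono_AE integrable_min_1_norm borel_measurable_diff assms)
    show "AE \<omega> in M. min 1 (norm (X' n \<omega> - Z' \<omega>)) \<le> min 1 (norm (X n \<omega> - Z \<omega>))"
      using assms(6)[of n] by eventually_elim simp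
  qed
  then show "\<forall>\<^sub>F n in sequentially. (\<integral>\<omega>. min 1 (norm (X' n \<omega> - Z' \<omega>)) \<partial>M)
      \<le> (\<integral>\<omega>. min 1 (norm (X n \<omega> - Z \<omega>)) \<partial>M)"
    by simp
qed

lemma tendsto_prob_add:
  assumes "tendsto_prob M X X'" "tendsto_prob M Y Y'"
    and [measurable]: "\<And>n. X n \<in> borel_measurable M" "X' \<in> borel_measurable M"
      "\<And>n. Y n \<in> borel_measurable M" "Y' \<in> borel_measurable M"
  shows "tendsto_prob M (\<lambda>n \<omega>. X n \<omega> + Y n \<omega>) (\<lambda>\<omega>. X' \<omega> + Y' \<omega>)"
  unfolding tendsto_prob_def
proof (rule tendsto_sandwich[OF _ _ tendsto_const])
  show "\<forall>\<^sub>F n in sequentially. 0 \<le> (\<integral>\<omega>. min 1 (norm (X n \<omega> + Y n \<omega> - (X' \<omega> + Y' \<omega>))) \<partial>M)"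
    by (intro always_eventually allI integral_nonneg_AE) auto
  show "(\<lambda>n. (\<integral>\<omega>. min 1 (norm (X n \<omega> - X' \<omega>)) \<partial>M) + (\<integral>\<omega>. min 1 (norm (Y n \<omega> - Y' \<omega>)) \<partial>M)) \<longlonglongrightarrow> 0"
    using tendsto_add[OF assms(1,2)[unfolded tendsto_prob_def]] by simp
  have "(\<integral>\<omega>. min 1 (norm (X n \<omega> + Y n \<omega> - (X' \<omega> + Y' \<omega>))) \<partial>M)
      \<le> (\<integral>\<omega>. min 1 (norm (X n \<omega> - X' \<omega>)) + min 1 (norm (Y n \<omega> - Y' \<omega>)) \<partial>M)" for n
  proof (intro integral_mono Bochner_Integration.integrable_add integrable_min_1_norm)
    fix \<omega>
    have "norm (X n \<omega> + Y n \<omega> - (X' \<omega> + Y' \<omega>)) \<le> norm (X n \<omega> - X' \<omega>) + norm (Y n \<omega> - Y' \<omega>)"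
      by (rule norm_diff_triangle_ineq)
    then show "min 1 (norm (X n \<omega> + Y n \<omega> - (X' \<omega> + Y' \<omega>)))
        \<le> min 1 (norm (X n \<omega> - X' \<omega>)) + min 1 (norm (Y n \<omega> - Y' \<omega>))"
      by (smt (verit) norm_ge_zero)
  qed measurable
  also have "(\<integral>\<omega>. min 1 (norm (X n \<omega> - X' \<omega>)) + min 1 (norm (Y n \<omega> - Y' \<omega>)) \<partial>M) =
      (\<integral>\<omega>. min 1 (norm (X n \<omega> - X' \<omega>)) \<partial>M) + (\<integral>\<omega>. min 1 (norm (Y n \<omega> - Y' \<omega>)) \<partial>M)" for n
    by (intro Bochner_Integration.integral_add integrable_min_1_norm) measurable
  finally show "\<forall>\<^sub>F n in sequentially. (\<integral>\<omega>. min 1 (norm (X n \<omega> + Y n \<omega> - (X' \<omega> + Y' \<omega>))) \<partial>M)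
      \<le> (\<integral>\<omega>. min 1 (norm (X n \<omega> - X' \<omega>)) \<partial>M) + (\<integral>\<omega>. min 1 (norm (Y n \<omega> - Y' \<omega>)) \<partial>M)"
    by simp
qed

lemma AE_imp_tendsto_prob:
  assumes [measurable]: "\<And>n. X n \<in> borel_measurable M" "Z \<in> borel_measurable M"
    and lim: "AE \<omega> in M. (\<lambda>n. X n \<omega>) \<longlonglongrightarrow> Z \<omega>"
  shows "tendsto_prob M X Z"
proof -
  have "(\<lambda>n. \<integral>\<omega>. min 1 (norm (X n \<omega> - Z \<omega>)) \<partial>M) \<longlonglongrightarrow> (\<integral>\<omega>. 0 \<partial>M)"
  proof (rule integral_dominated_convergence[where w = "\<lambda>_. 1"])
    show "AE \<omega> in M. (\<lambda>n. min 1 (norm (X n \<omega> - Z \<omega>))) \<longlonglongrightarrow> 0"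
      using lim
    proof eventually_elim
      case (elim \<omega>)
      then have "(\<lambda>n. norm (X n \<omega> - Z \<omega>)) \<longlonglongrightarrow> 0"
        by (rule tendsto_norm_zero[OF LIM_zero])
      from tendsto_min[OF tendsto_const[of 1] this] show ?case by simp
    qed
  qed auto
  then show ?thesis by (simp add: tendsto_prob_def)
qed

text \<open>Some subsequence converges almost surely, and since \<open>B\<close> bounds all members,
  Fatou's lemma along that subsequence is enough. Square integrability of \<open>Z\<close> is a
  conclusion, which is how solutions acquire their moments.\<close>

lemma tendsto_prob_Fatou:
  assumes "tendsto_prob M X Z" and Z [measurable]: "Z \<in> borel_measurable M"
    and sq: "\<And>n. sq_integrable M (X n)" and bd: "\<And>n. (\<integral>\<omega>. (norm (X n \<omega>))\<^sup>2 \<partial>M) \<le> B"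
  shows "sq_integrable M Z" "(\<integral>\<omega>. (norm (Z \<omega>))\<^sup>2 \<partial>M) \<le> B"
proof -
  have X [measurable]: "\<And>n. X n \<in> borel_measurable M"
    using sq by (simp add: sq_integrable_def)
  have "\<exists>r. strict_mono r \<and> (AE \<omega> in M. (\<lambda>n. min 1 (norm (X (r n) \<omega> - Z \<omega>))) \<longlonglongrightarrow> 0)"
    using assms(1) unfolding tendsto_prob_def
    by (intro tendsto_L1_AE_subseq integrable_min_1_norm) auto
  then obtain r where r: "AE \<omega> in M. (\<lambda>n. min 1 (norm (X (r n) \<omega> - Z \<omega>))) \<longlonglongrightarrow> 0" by blast
  have lim: "AE \<omega> in M. (\<lambda>n. ennreal ((norm (X (r n) \<omega>))\<^sup>2)) \<longlonglongrightarrow> ennreal ((norm (Z \<omega>))\<^sup>2)"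
    using r
  proof eventually_elim
    case (elim \<omega>)
    have "\<forall>\<^sub>F n in sequentially. min 1 (norm (X (r n) \<omega> - Z \<omega>)) < 1"
      using elim by (rule order_tendstoD) simp
    then have "\<forall>\<^sub>F n in sequentially. min 1 (norm (X (r n) \<omega> - Z \<omega>)) = norm (X (r n) \<omega> - Z \<omega>)"
      by eventually_elim auto
    from Lim_transform_eventually[OF elim this]
    have "(\<lambda>n. X (r n) \<omega>) \<longlonglongrightarrow> Z \<omega>"
      by (rule LIM_zero_cancel[OF tendsto_norm_zero_cancel])
    then show ?case by (intro tendsto_ennrealI tendsto_intros)
  qed
  have 0: "0 \<le> B"
    using bd[of 0] by (rule order_trans[rotated]) simp
  have "(\<integral>\<^sup>+\<omega>. ennreal ((norm (Z \<omega>))\<^sup>2) \<partial>M)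
      = (\<integral>\<^sup>+\<omega>. liminf (\<lambda>n. ennreal ((norm (X (r n) \<omega>))\<^sup>2)) \<partial>M)"
  proof (rule nn_integral_cong_AE)
    show "AE \<omega> in M. ennreal ((norm (Z \<omega>))\<^sup>2) = liminf (\<lambda>n. ennreal ((norm (X (r n) \<omega>))\<^sup>2))"
      using lim by eventually_elim (rule lim_imp_Liminf[symmetric, OF sequentially_bot])
  qed
  also have "\<dots> \<le> liminf (\<lambda>n. \<integral>\<^sup>+\<omega>. ennreal ((norm (X (r n) \<omega>))\<^sup>2) \<partial>M)"
    by (intro nn_integral_liminf) measurable
  also have "\<dots> \<le> liminf (\<lambda>n. ennreal B)"
    using sq bd by (intro Liminf_mono always_eventually allI)
      (simp add: nn_integral_eq_integral sq_integrable_def ennreal_leI)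
  also have "\<dots> = ennreal B" by (simp add: Liminf_const)
  finally have le: "(\<integral>\<^sup>+\<omega>. ennreal ((norm (Z \<omega>))\<^sup>2) \<partial>M) \<le> ennreal B" .
  then have "integrable M (\<lambda>\<omega>. (norm (Z \<omega>))\<^sup>2)"
    by (intro integrableI_nonneg) (auto intro: le_less_trans)
  then show "sq_integrable M Z" "(\<integral>\<omega>. (norm (Z \<omega>))\<^sup>2 \<partial>M) \<le> B"
    using le 0 by (auto simp: sq_integrable_def nn_integral_eq_integral)
qed

text \<open>Weak lower semicontinuity: apply Fatou to \<open>X n + c U\<close> for large \<open>|c|\<close>.\<close>

lemma tendsto_prob_inner_bound:
  assumes conv: "tendsto_prob M X Z" and Z: "Z \<in> borel_measurable M"
    and sq: "\<And>n. sq_integrable M (X n)" and bd: "\<And>n. (\<integral>\<omega>. (norm (X n \<omega>))\<^sup>2 \<partial>M) \<le> B"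
    and U: "sq_integrable M U" and e: "\<And>n. \<bar>\<integral>\<omega>. U \<omega> \<bullet> X n \<omega> \<partial>M\<bar> \<le> e"
  shows "\<bar>\<integral>\<omega>. U \<omega> \<bullet> Z \<omega> \<partial>M\<bar> \<le> e"
proof -
  have [measurable]: "\<And>n. X n \<in> borel_measurable M" "U \<in> borel_measurable M" "Z \<in> borel_measurable M"
    using sq U Z by (auto simp: sq_integrable_def)
  have sqZ: "sq_integrable M Z" by (rule tendsto_prob_Fatou[OF conv Z sq bd])
  have exp: "(\<integral>\<omega>. (norm (Y \<omega> + c *\<^sub>R U \<omega>))\<^sup>2 \<partial>M) =
      (\<integral>\<omega>. (norm (Y \<omega>))\<^sup>2 \<partial>M) + 2 * c * (\<integral>\<omega>. U \<omega> \<bullet> Y \<omega> \<partial>M) + c\<^sup>2 * (\<integral>\<omega>. (norm (U \<omega>))\<^sup>2 \<partial>M)"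
    if "sq_integrable M Y" for Y c
  proof -
    have "(\<integral>\<omega>. (norm (Y \<omega> + c *\<^sub>R U \<omega>))\<^sup>2 \<partial>M) =
        (\<integral>\<omega>. (norm (Y \<omega>))\<^sup>2 + 2 * c * (U \<omega> \<bullet> Y \<omega>) + c\<^sup>2 * (norm (U \<omega>))\<^sup>2 \<partial>M)"
      unfolding power2_norm_eq_inner
      by (intro Bochner_Integration.integral_cong refl)
         (simp add: inner_add inner_commute algebra_simps power2_eq_square)
    then show ?thesis
      using that U integrable_inner_sq[OF U that] by (simp add: sq_integrable_def)
  qed
  \<comment> \<open>The term with \<open>c\<^sup>2\<close> occurs on both sides and cancels, leaving
    an inequality that is affine in \<open>c\<close> on each half line.\<close>
  have key: "2 * c * (\<integral>\<omega>. U \<omega> \<bullet> Z \<omega> \<partial>M) \<le> B + 2 * \<bar>c\<bar> * e" for c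
  proof -
    have "(\<integral>\<omega>. (norm (Z \<omega> + c *\<^sub>R U \<omega>))\<^sup>2 \<partial>M)
      \<le> B + 2 * \<bar>c\<bar> * e + c\<^sup>2 * (\<integral>\<omega>. (norm (U \<omega>))\<^sup>2 \<partial>M)"
    proof (rule tendsto_prob_Fatou)
      show "tendsto_prob M (\<lambda>n \<omega>. X n \<omega> + c *\<^sub>R U \<omega>) (\<lambda>\<omega>. Z \<omega> + c *\<^sub>R U \<omega>)"
        by (rule tendsto_prob_dominated[OF conv]) simp_all
      show "(\<lambda>\<omega>. Z \<omega> + c *\<^sub>R U \<omega>) \<in> borel_measurable M"
        by measurable
      show "sq_integrable M (\<lambda>\<omega>. X n \<omega> + c *\<^sub>R U \<omega>)" for n
        by (rule sq_integrable_add[OF sq sq_integrable_scaleR[OF U]])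
      have "c * (\<integral>\<omega>. U \<omega> \<bullet> X n \<omega> \<partial>M) \<le> \<bar>c\<bar> * e" for n
        using mult_left_mono[OF e[of n], of "\<bar>c\<bar>"] abs_ge_self[of "c * (\<integral>\<omega>. U \<omega> \<bullet> X n \<omega> \<partial>M)"]
        by (simp add: abs_mult)
      then show "(\<integral>\<omega>. (norm (X n \<omega> + c *\<^sub>R U \<omega>))\<^sup>2 \<partial>M)
          \<le> B + 2 * \<bar>c\<bar> * e + c\<^sup>2 * (\<integral>\<omega>. (norm (U \<omega>))\<^sup>2 \<partial>M)" for n
        using bd[of n] unfolding exp[OF sq, of n c] by (simp add: mult.assoc add_mono)
    qed
    moreover have "0 \<le> (\<integral>\<omega>. (norm (Z \<omega>))\<^sup>2 \<partial>M)" by simp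
    ultimately show ?thesis unfolding exp[OF sqZ, of c] by linarith
  qed
  define z where "z = (\<integral>\<omega>. U \<omega> \<bullet> Z \<omega> \<partial>M)"
  \<comment> \<open>Dividing by \<open>2 * c\<close> makes the constant \<open>B\<close> negligible
    for large \<open>c\<close>; the two signs of the coefficient together give the absolute
    value.\<close>
  have pos: "\<bar>z\<bar> - e \<le> B / (2 * c)" if "0 < c" for c
  proof -
    have "2 * c * \<bar>z\<bar> \<le> B + 2 * c * e"
      using key[of c] key[of "-c"] that unfolding z_def[symmetric] by (cases "0 \<le> z") auto
    then show ?thesis using that by (simp add: field_simps)
  qed
  have "\<forall>\<^sub>F c in at_top. \<bar>z\<bar> - e \<le> B / (2 * c)"
    using eventually_gt_at_top[of 0] by eventually_elim (rule pos)
  moreover have "((\<lambda>c. B / (2 * c)) \<longlongrightarrow> 0) at_top"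
    by real_asymp
  ultimately have "\<bar>z\<bar> - e \<le> 0"
    by (intro tendsto_lowerbound[of "\<lambda>c. B / (2 * c)" 0 at_top]) auto
  then show ?thesis by (simp add: z_def)
qed

section \<open>Independent noise\<close>

text \<open>Independence passes to the smaller sigma-algebras generated by \<open>X\<close> and by
  \<open>h (N \<omega>)\<close>, so the product rule for independent real variables applies. The
  function \<open>h\<close> allows both \<open>N\<close> and its square as the factor.\<close>

lemma indep_set_expectation_mult:
  fixes X N :: "'a \<Rightarrow> real"
  assumes G: "subalgebra M G" and ind: "indep_set (sets G) (generated_events M N borel)"
    and X: "X \<in> borel_measurable G" "integrable M X"
    and N: "N \<in> borel_measurable M" and h: "h \<in> borel_measurable borel" "integrable M (\<lambda>\<omega>. h (N \<omega>))"
  shows "integrable M (\<lambda>\<omega>. h (N \<omega>) * X \<omega>)"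
    and "expectation (\<lambda>\<omega>. h (N \<omega>) * X \<omega>) = expectation (\<lambda>\<omega>. h (N \<omega>)) * expectation X"
proof -
  have XM: "X \<in> borel_measurable M" by (rule measurable_from_subalg[OF G X(1)])
  have sp: "space G = space M" using G by (simp add: subalgebra_def)
  have "indep_var borel X borel (\<lambda>\<omega>. h (N \<omega>))"
    unfolding indep_var_eq
  proof (intro conjI)
    show "X \<in> borel_measurable M" "(\<lambda>\<omega>. h (N \<omega>)) \<in> borel_measurable M"
      using XM N h(1) by (auto intro: measurable_compose)
    have 1: "sigma_sets (space M) {X -` A \<inter> space M |A. A \<in> sets borel} \<subseteq> sets G"
      unfolding sp[symmetric] by (intro sets.sigma_sets_subset) (use X(1) in \<open>auto intro: measurable_sets\<close>)
    have "(\<lambda>\<omega>. h (N \<omega>)) -` A \<inter> space M = N -` (h -` A \<inter> space borel) \<inter> space M" for A by auto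
    then have "(\<lambda>\<omega>. h (N \<omega>)) -` A \<inter> space M \<in> sets (vimage_algebra (space M) N borel)"
      if "A \<in> sets borel" for A
      using measurable_sets[OF h(1) that] by (metis in_vimage_algebra)
    then have "{(\<lambda>\<omega>. h (N \<omega>)) -` A \<inter> space M |A. A \<in> sets borel} \<subseteq> sets (vimage_algebra (space M) N borel)"
      by blast
    from sets.sigma_sets_subset[OF this]
    have 2: "sigma_sets (space M) {(\<lambda>\<omega>. h (N \<omega>)) -` A \<inter> space M |A. A \<in> sets borel}
        \<subseteq> generated_events M N borel"
      by (simp add: generated_events_def)
    show "indep_set (sigma_sets (space M) {X -` A \<inter> space M |A. A \<in> sets borel})
       (sigma_sets (space M) {(\<lambda>\<omega>. h (N \<omega>)) -` A \<inter> space M |A. A \<in> sets borel})"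
      using ind unfolding indep_set_def
      by (rule indep_sets_mono_sets) (use 1 2 in \<open>auto split: bool.split\<close>)
  qed
  from indep_var_integrable[OF this X(2) h(2)] indep_var_lebesgue_integral[OF this X(2) h(2)]
  show "integrable M (\<lambda>\<omega>. h (N \<omega>) * X \<omega>)"
    "expectation (\<lambda>\<omega>. h (N \<omega>) * X \<omega>) = expectation (\<lambda>\<omega>. h (N \<omega>)) * expectation X"
    by (simp_all add: mult.commute)
qed

text \<open>The cross terms carry a factor \<open>N\<close> that is independent of \<open>G\<close>
  and has mean zero, so they drop out. This one computation serves the increments of
  \<open>W\<close> and the jumps alike.\<close>

lemma
  fixes X Y :: "'a \<Rightarrow> 'e::euclidean_space" and N :: "'a \<Rightarrow> real"
  assumes G: "subalgebra M G" and ind: "indep_set (sets G) (generated_events M N borel)"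
    and X: "X \<in> borel_measurable G" "sq_integrable M X"
    and Y: "Y \<in> borel_measurable G" "sq_integrable M Y"
    and N: "N \<in> borel_measurable M" "integrable M (\<lambda>\<omega>. (N \<omega>)\<^sup>2)" "expectation N = 0"
  shows sq_integrable_noise: "sq_integrable M (\<lambda>\<omega>. X \<omega> + N \<omega> *\<^sub>R Y \<omega>)"
    and expectation_bilinear_noise: "bounded_bilinear \<beta> \<Longrightarrow>
      expectation (\<lambda>\<omega>. \<beta> (X \<omega> + N \<omega> *\<^sub>R Y \<omega>) (X \<omega> + N \<omega> *\<^sub>R Y \<omega>) :: real) =
      expectation (\<lambda>\<omega>. \<beta> (X \<omega>) (X \<omega>)) + expectation (\<lambda>\<omega>. (N \<omega>)\<^sup>2) * expectation (\<lambda>\<omega>. \<beta> (Y \<omega>) (Y \<omega>))"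
proof -
  have iN: "integrable M N"
    using square_integrable_imp_integrable[OF N(1,2)] .
  have sqNY: "sq_integrable M (\<lambda>\<omega>. N \<omega> *\<^sub>R Y \<omega>)"
    unfolding sq_integrable_def
  proof
    show "(\<lambda>\<omega>. N \<omega> *\<^sub>R Y \<omega>) \<in> borel_measurable M"
      using Y(2) N(1) by (auto simp: sq_integrable_def)
    show "integrable M (\<lambda>\<omega>. (norm (N \<omega> *\<^sub>R Y \<omega>))\<^sup>2)"
      using indep_set_expectation_mult(1)[OF G ind _ _ N(1), of "\<lambda>\<omega>. (norm (Y \<omega>))\<^sup>2" "\<lambda>x. x\<^sup>2"] Y N(2)
      by (simp add: sq_integrable_def power_mult_distrib)
  qed
  then show "sq_integrable M (\<lambda>\<omega>. X \<omega> + N \<omega> *\<^sub>R Y \<omega>)" by (intro sq_integrable_add X)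
  assume \<beta>: "bounded_bilinear \<beta>"
  note [simp] = bounded_bilinear.add_left[OF \<beta>] bounded_bilinear.add_right[OF \<beta>]
    bounded_bilinear.scaleR_left[OF \<beta>] bounded_bilinear.scaleR_right[OF \<beta>]
  have ints: "integrable M (\<lambda>\<omega>. \<beta> (X \<omega>) (X \<omega>))" "integrable M (\<lambda>\<omega>. \<beta> (X \<omega>) (Y \<omega>))"
    "integrable M (\<lambda>\<omega>. \<beta> (Y \<omega>) (X \<omega>))" "integrable M (\<lambda>\<omega>. \<beta> (Y \<omega>) (Y \<omega>))"
    using X Y by (auto intro: integrable_bilinear[OF \<beta>])
  have meas: "(\<lambda>\<omega>. \<beta> (X \<omega>) (Y \<omega>) + \<beta> (Y \<omega>) (X \<omega>)) \<in> borel_measurable G"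
    "(\<lambda>\<omega>. \<beta> (Y \<omega>) (Y \<omega>)) \<in> borel_measurable G"
    using X Y by (intro borel_measurable_add bounded_bilinear_borel_measurable[OF \<beta>]; simp)+
  note c1 = indep_set_expectation_mult[OF G ind meas(1) Bochner_Integration.integrable_add[OF ints(2,3)] N(1),
      of "\<lambda>x. x", simplified, OF iN]
  note c2 = indep_set_expectation_mult[OF G ind meas(2) ints(4) N(1), of "\<lambda>x. x\<^sup>2", simplified, OF N(2)]
  have "expectation (\<lambda>\<omega>. \<beta> (X \<omega> + N \<omega> *\<^sub>R Y \<omega>) (X \<omega> + N \<omega> *\<^sub>R Y \<omega>)) =
    expectation (\<lambda>\<omega>. \<beta> (X \<omega>) (X \<omega>) + (N \<omega> * (\<beta> (X \<omega>) (Y \<omega>) + \<beta> (Y \<omega>) (X \<omega>)) + (N \<omega>)\<^sup>2 * \<beta> (Y \<omega>) (Y \<omega>)))"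
    by (intro Bochner_Integration.integral_cong refl) (simp add: algebra_simps power2_eq_square)
  also have "\<dots> = expectation (\<lambda>\<omega>. \<beta> (X \<omega>) (X \<omega>)) +
      expectation (\<lambda>\<omega>. (N \<omega>)\<^sup>2) * expectation (\<lambda>\<omega>. \<beta> (Y \<omega>) (Y \<omega>))"
    using c1 c2 ints N(3) by simp
  finally show "expectation (\<lambda>\<omega>. \<beta> (X \<omega> + N \<omega> *\<^sub>R Y \<omega>) (X \<omega> + N \<omega> *\<^sub>R Y \<omega>)) =
      expectation (\<lambda>\<omega>. \<beta> (X \<omega>) (X \<omega>)) + expectation (\<lambda>\<omega>. (N \<omega>)\<^sup>2) * expectation (\<lambda>\<omega>. \<beta> (Y \<omega>) (Y \<omega>))" .
qed

end

section \<open>Uniform grids\<close>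

definition grid :: "real \<Rightarrow> real \<Rightarrow> nat \<Rightarrow> nat \<Rightarrow> real" where
  "grid s t n i = s + (t - s) / n * i"

lemma grid_0 [simp]: "grid s t n 0 = s"
  by (simp add: grid_def)

lemma grid_last [simp]: "0 < n \<Longrightarrow> grid s t n n = t"
  by (simp add: grid_def)

lemma grid_step: "grid s t n (Suc i) - grid s t n i = (t - s) / n"
  by (simp add: grid_def distrib_left)

lemma grid_mono: "s \<le> t \<Longrightarrow> i \<le> j \<Longrightarrow> grid s t n i \<le> grid s t n j"
  unfolding grid_def by (intro add_left_mono mult_left_mono) auto

lemma grid_in:
  assumes "s \<le> t" "0 < n" "i \<le> n" shows "grid s t n i \<in> {s..t}"
  using grid_mono[OF assms(1), of 0 i n] grid_mono[OF assms(1,3), of n] assms by simp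

lemma eventually_mesh_less:
  fixes x d :: real
  assumes "0 < d" obtains N where "\<And>m. N \<le> m \<Longrightarrow> x / Suc m < d"
proof -
  have "(\<lambda>m. x / Suc m) \<longlonglongrightarrow> 0" by real_asymp
  from order_tendstoD(2)[OF this assms] that show thesis
    unfolding eventually_sequentially by blast
qed

lemma tendsto_riemann_sum:
  fixes h :: "real \<Rightarrow> 'e::euclidean_space"
  assumes "s \<le> t" and cont: "continuous_on {s..t} h"
  shows "(\<lambda>m. \<Sum>i<Suc m. ((t - s) / Suc m) *\<^sub>R h (grid s t (Suc m) i)) \<longlonglongrightarrow> integral {s..t} h"
proof (rule LIMSEQ_I)
  fix e :: real assume "0 < e"
  \<comment> \<open>The summand 1 keeps the quotient meaningful for \<open>s = t\<close> and makes
    the final estimate strict.\<close>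
  define e' where "e' = e / (t - s + 1)"
  have "0 < e'" using \<open>0 < e\<close> assms(1) by (simp add: e'_def)
  have "uniformly_continuous_on {s..t} h"
    by (intro compact_uniformly_continuous cont) simp
  then obtain d where "0 < d"
    and d: "\<And>x y. x \<in> {s..t} \<Longrightarrow> y \<in> {s..t} \<Longrightarrow> dist y x < d \<Longrightarrow> dist (h y) (h x) < e'"
    using \<open>0 < e'\<close> unfolding uniformly_continuous_on_def by metis
  obtain N where N: "\<And>m. N \<le> m \<Longrightarrow> (t - s) / Suc m < d"
    using eventually_mesh_less[OF \<open>0 < d\<close>, of "t - s"] by blast
  have "norm ((\<Sum>i<Suc m. ((t - s) / Suc m) *\<^sub>R h (grid s t (Suc m) i)) - integral {s..t} h) < e"
    if "N \<le> m" for m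
  proof -
    let ?p = "grid s t (Suc m)" and ?\<delta> = "(t - s) / Suc m"
    have \<delta>: "0 \<le> ?\<delta>" "?\<delta> < d"
      using assms(1) N[OF that] by simp_all
    have "norm ((\<Sum>i<k. ?\<delta> *\<^sub>R h (?p i)) - integral {s..?p k} h) \<le> k * (e' * ?\<delta>)" if "k \<le> Suc m" for k
      using that
    proof (induction k)
      case (Suc k)
      have le: "s \<le> ?p k" "?p k \<le> ?p (Suc k)" "?p (Suc k) \<le> t"
        using grid_in[OF assms(1), of "Suc m"] grid_mono[OF assms(1), of k "Suc k"] Suc.prems by auto
      have int: "h integrable_on {u..v}" "continuous_on {u..v} h" if "s \<le> u" "v \<le> t" for u v
        using that continuous_on_subset[OF cont, of "{u..v}"] by (auto intro: integrable_continuous_real)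
      have "integral {s..?p (Suc k)} h = integral {s..?p k} h + integral {?p k..?p (Suc k)} h"
        using le int by (intro Henstock_Kurzweil_Integration.integral_combine[symmetric]) auto
      moreover have "integral {?p k..?p (Suc k)} (\<lambda>u. h u - h (?p k)) =
          integral {?p k..?p (Suc k)} h - ?\<delta> *\<^sub>R h (?p k)"
      proof -
        have "integral {?p k..?p (Suc k)} (\<lambda>u. h u - h (?p k)) =
            integral {?p k..?p (Suc k)} h - integral {?p k..?p (Suc k)} (\<lambda>u. h (?p k))"
          using le int by (intro Henstock_Kurzweil_Integration.integral_diff) auto
        moreover have "integral {?p k..?p (Suc k)} (\<lambda>u. h (?p k)) = ?\<delta> *\<^sub>R h (?p k)"
          using le(2) grid_step[of s t "Suc m" k] by (simp del: of_nat_Suc)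
        ultimately show ?thesis by (simp only:)
      qed
      ultimately have eq: "(\<Sum>i<Suc k. ?\<delta> *\<^sub>R h (?p i)) - integral {s..?p (Suc k)} h =
        ((\<Sum>i<k. ?\<delta> *\<^sub>R h (?p i)) - integral {s..?p k} h)
          - integral {?p k..?p (Suc k)} (\<lambda>u. h u - h (?p k))"
        by simp
      have bound: "norm (integral {?p k..?p (Suc k)} (\<lambda>u. h u - h (?p k))) \<le> e' * (?p (Suc k) - ?p k)"
      proof (rule integral_bound)
        show "continuous_on {?p k..?p (Suc k)} (\<lambda>u. h u - h (?p k))"
          using le int by (intro continuous_intros) auto
        fix u assume u: "u \<in> {?p k..?p (Suc k)}"
        then have "dist u (?p k) < d"
          using \<delta> grid_step[of s t "Suc m" k] by (auto simp: dist_real_def)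
        then show "norm (h u - h (?p k)) \<le> e'"
          using d[of "?p k" u] le u by (auto simp: dist_norm intro: less_imp_le)
      qed (rule le)
      have "norm ((\<Sum>i<Suc k. ?\<delta> *\<^sub>R h (?p i)) - integral {s..?p (Suc k)} h)
          \<le> k * (e' * ?\<delta>) + e' * ?\<delta>"
        unfolding eq using Suc.prems
        by (intro order_trans[OF norm_triangle_ineq4 add_mono[OF Suc.IH bound[unfolded grid_step]]]) simp
      also have "k * (e' * ?\<delta>) + e' * ?\<delta> = Suc k * (e' * ?\<delta>)"
        unfolding of_nat_Suc[of k] by (simp only: distrib_right mult_1 add.commute)
      finally show ?case .
    qed simp
    from this[of "Suc m"] have "norm ((\<Sum>i<Suc m. ?\<delta> *\<^sub>R h (?p i)) - integral {s..t} h) \<le> Suc m * (e' * ?\<delta>)"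
      by (simp del: sum.lessThan_Suc of_nat_Suc)
    also have "\<dots> = e' * (t - s)" by (simp del: of_nat_Suc)
    also have "\<dots> < e' * (t - s + 1)" using \<open>0 < e'\<close> by simp
    also have "\<dots> = e" using assms(1) by (simp add: e'_def)
    finally show ?thesis .
  qed
  then show "\<exists>N. \<forall>m\<ge>N. norm ((\<Sum>i<Suc m. ((t - s) / Suc m) *\<^sub>R h (grid s t (Suc m) i)) - integral {s..t} h) < e"
    by blast
qed

section \<open>Riemann sums of the Ito integral\<close>

lemma sum_lessThan_add:
  "(\<Sum>i<m + k. c i) = (\<Sum>i<m. c i) + (\<Sum>i<k. c (m + i) :: 'a::comm_monoid_add)" for m k :: nat
  by (induction k) (simp_all add: add.assoc)

context prob_space
begin

text \<open>Translates the form of convergence used in \<open>has_ito_integral\<close> into that of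
  \<open>tendsto_prob\<close>: one \<open>e\<close> comes from outside the exceptional set, the
  other from its probability.\<close>

lemma expectation_min_1_le:
  assumes [measurable]: "X \<in> borel_measurable M" and "prob {\<omega> \<in> space M. norm (X \<omega>) > e} < e"
  shows "expectation (\<lambda>\<omega>. min 1 (norm (X \<omega>))) \<le> 2 * e"
proof -
  have "0 < e" using assms(2) measure_nonneg[of M] by (rule le_less_trans[rotated])
  let ?A = "{\<omega> \<in> space M. norm (X \<omega>) > e}"
  have A [measurable]: "?A \<in> sets M" by measurable
  have int: "integrable M (indicator ?A :: _ \<Rightarrow> real)"
    by (rule integrable_real_indicator[OF A]) (simp add: emeasure_eq_measure)
  have "expectation (\<lambda>\<omega>. min 1 (norm (X \<omega>))) \<le> expectation (\<lambda>\<omega>. e + indicator ?A \<omega>)"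
  proof (intro integral_mono integrable_min_1_norm)
    show "integrable M (\<lambda>\<omega>. e + indicator ?A \<omega> :: real)"
      by (intro Bochner_Integration.integrable_add int) simp
    show "min 1 (norm (X \<omega>)) \<le> e + indicator ?A \<omega>" if "\<omega> \<in> space M" for \<omega>
      using that \<open>0 < e\<close> by (auto simp: indicator_def)
  qed simp
  also have "\<dots> = expectation (\<lambda>\<omega>. e) + expectation (indicator ?A)"
    by (rule Bochner_Integration.integral_add[OF _ int]) simp
  also have "\<dots> = e + prob ?A"
    by (simp add: prob_space Int_absorb2[OF sets.sets_into_space[OF A]])
  finally show ?thesis using assms(2) by simp
qed

text \<open>Integrals are only given from \<open>a\<close> onwards. A fixed fine grid of
  \<open>[a, s]\<close> followed by the uniform grid of \<open>[s, t]\<close> is a partition of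
  \<open>[a, t]\<close>; its sum is close to \<open>Zt\<close> and the part before \<open>s\<close>
  is close to \<open>Zs\<close>, so the part after \<open>s\<close> is close to the
  difference.\<close>

lemma ito_subinterval:
  fixes H :: "real \<Rightarrow> 'a \<Rightarrow> 'e::euclidean_space"
  assumes "has_ito_integral M W H a s Zs" "has_ito_integral M W H a t Zt" "a \<le> s" "s \<le> t"
    and W: "\<And>u. u \<in> {a..t} \<Longrightarrow> W u \<in> borel_measurable M"
    and H: "\<And>u. u \<in> {a..t} \<Longrightarrow> H u \<in> borel_measurable M"
  shows "tendsto_prob M (\<lambda>m \<omega>. \<Sum>i<Suc m. (W (grid s t (Suc m) (Suc i)) \<omega> - W (grid s t (Suc m) i) \<omega>)
    *\<^sub>R H (grid s t (Suc m) i) \<omega>) (\<lambda>\<omega>. Zt \<omega> - Zs \<omega>)"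
  unfolding tendsto_prob_def
proof (rule LIMSEQ_I)
  define I where "I p n \<omega> = (\<Sum>i<n. (W (p (Suc i)) \<omega> - W (p i) \<omega>) *\<^sub>R H (p i) \<omega>)"
    for p :: "nat \<Rightarrow> real" and n \<omega>
  have I_meas: "I p n \<in> borel_measurable M" if "\<And>i. i \<le> n \<Longrightarrow> p i \<in> {a..t}" for p n
    unfolding I_def using that
    by (intro borel_measurable_sum borel_measurable_scaleR borel_measurable_diff W H) auto
  have Z: "Zs \<in> borel_measurable M" "Zt \<in> borel_measurable M"
    using assms(1,2) by (auto simp: has_ito_integral_def)
  fix e :: real assume "0 < e"
  \<comment> \<open>Two sums are compared with their limits, at a cost of \<open>2 * (e / 5)\<close>
    each, and \<open>4 * e / 5\<close> is below \<open>e\<close>.\<close>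
  then have "0 < e / 5" by simp
  obtain d1 where "0 < d1" and d1: "\<And>n p. is_partition a s n p \<Longrightarrow> (\<And>i. i < n \<Longrightarrow> p (Suc i) - p i < d1)
      \<Longrightarrow> prob {\<omega> \<in> space M. norm (I p n \<omega> - Zs \<omega>) > e / 5} < e / 5"
    using assms(1) \<open>0 < e / 5\<close> unfolding has_ito_integral_def I_def by blast
  obtain d2 where "0 < d2" and d2: "\<And>n p. is_partition a t n p \<Longrightarrow> (\<And>i. i < n \<Longrightarrow> p (Suc i) - p i < d2)
      \<Longrightarrow> prob {\<omega> \<in> space M. norm (I p n \<omega> - Zt \<omega>) > e / 5} < e / 5"
    using assms(2) \<open>0 < e / 5\<close> unfolding has_ito_integral_def I_def by blast
  define d where "d = min d1 d2"
  have "0 < d" using \<open>0 < d1\<close> \<open>0 < d2\<close> by (simp add: d_def)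
  \<comment> \<open>One grid on \<open>[a, s]\<close> suffices: only the grid on
    \<open>[s, t]\<close> is refined with \<open>m\<close>.\<close>
  obtain m0 where m0: "(s - a) / Suc m0 < d"
    using eventually_mesh_less[OF \<open>0 < d\<close>, of "s - a"] by blast
  obtain N where N: "\<And>m. N \<le> m \<Longrightarrow> (t - s) / Suc m < d"
    using eventually_mesh_less[OF \<open>0 < d\<close>, of "t - s"] by blast
  let ?q = "grid a s (Suc m0)"
  have "expectation (\<lambda>\<omega>. min 1 (norm (I (grid s t (Suc m)) (Suc m) \<omega> - (Zt \<omega> - Zs \<omega>)))) < e"
    if "N \<le> m" for m
  proof -
    let ?p = "grid s t (Suc m)"
    \<comment> \<open>Both grids contain \<open>s\<close>, the last point of \<open>?q\<close> and
      the first of \<open>?p\<close>, so the two descriptions of \<open>r\<close> agree at index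
      \<open>Suc m0\<close>.\<close>
    define r where "r i = (if i < Suc m0 then ?q i else ?p (i - Suc m0))" for i
    have r1: "r i = ?q i" if "i \<le> Suc m0" for i
      using that by (cases "i = Suc m0") (auto simp: r_def)
    have r2: "r (Suc m0 + i) = ?p i" for i
      by (simp add: r_def)
    have step: "r i \<le> r (Suc i) \<and> r (Suc i) - r i < d" for i
    proof (cases "i < Suc m0")
      case True
      then show ?thesis using r1[of i] r1[of "Suc i"] grid_step[of a s "Suc m0" i] m0
          grid_mono[OF assms(3), of i "Suc i"] by simp
    next
      case False
      then obtain k where k: "i = Suc m0 + k" using le_Suc_ex by (metis not_less)
      then show ?thesis using r2[of k] r2[of "Suc k"] grid_step[of s t "Suc m" k] N[OF that]
          grid_mono[OF assms(4), of k "Suc k"] by simp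
    qed
    have split: "I r (Suc m0 + Suc m) \<omega> = I ?q (Suc m0) \<omega> + I ?p (Suc m) \<omega>" for \<omega>
    proof -
      have "(\<Sum>i<Suc m0. (W (r (Suc i)) \<omega> - W (r i) \<omega>) *\<^sub>R H (r i) \<omega>) = I ?q (Suc m0) \<omega>"
        unfolding I_def by (intro sum.cong refl) (simp add: r1 Suc_leI)
      moreover have "(\<Sum>i<Suc m. (W (r (Suc (Suc m0 + i))) \<omega> - W (r (Suc m0 + i)) \<omega>) *\<^sub>R H (r (Suc m0 + i)) \<omega>)
          = I ?p (Suc m) \<omega>"
        unfolding I_def using r2 by (intro sum.cong refl) (metis add_Suc_right)
      ultimately show ?thesis
        unfolding I_def[of r] sum_lessThan_add by (simp only:)
    qed
    have "is_partition a t (Suc m0 + Suc m) r"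
      unfolding is_partition_def using r1[of 0] r2[of "Suc m"] step by simp
    then have 1: "prob {\<omega> \<in> space M. norm (I r (Suc m0 + Suc m) \<omega> - Zt \<omega>) > e / 5} < e / 5"
      using step by (intro d2) (auto simp: d_def)
    have "is_partition a s (Suc m0) ?q"
      unfolding is_partition_def using grid_mono[OF assms(3)] by simp
    then have 2: "prob {\<omega> \<in> space M. norm (I ?q (Suc m0) \<omega> - Zs \<omega>) > e / 5} < e / 5"
      using m0 by (intro d1) (auto simp: grid_step d_def simp del: of_nat_Suc)
    have r_in: "r i \<in> {a..t}" if "i \<le> Suc m0 + Suc m" for i
    proof (cases "i \<le> Suc m0")
      case True
      then show ?thesis using grid_in[OF assms(3), of "Suc m0" i] assms(4) by (simp add: r1)
    next
      case False
      then obtain k where "i = Suc m0 + k" using le_Suc_ex by (metis nat_le_linear)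
      then show ?thesis using grid_in[OF assms(4), of "Suc m" k] r2[of k] assms(3) that by auto
    qed
    have meas [measurable]: "I r (Suc m0 + Suc m) \<in> borel_measurable M" "I ?q (Suc m0) \<in> borel_measurable M"
        "I ?p (Suc m) \<in> borel_measurable M"
      using r_in grid_in[OF assms(3), of "Suc m0"] grid_in[OF assms(4), of "Suc m"] assms(3,4)
      by (intro I_meas; fastforce)+
    note [measurable] = Z
    have "expectation (\<lambda>\<omega>. min 1 (norm (I ?p (Suc m) \<omega> - (Zt \<omega> - Zs \<omega>))))
      \<le> expectation (\<lambda>\<omega>. min 1 (norm (I r (Suc m0 + Suc m) \<omega> - Zt \<omega>))
          + min 1 (norm (I ?q (Suc m0) \<omega> - Zs \<omega>)))"
    proof (intro integral_mono Bochner_Integration.integrable_add integrable_min_1_norm)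
      fix \<omega>
      have "norm (I ?p (Suc m) \<omega> - (Zt \<omega> - Zs \<omega>)) =
          norm ((I r (Suc m0 + Suc m) \<omega> - Zt \<omega>) - (I ?q (Suc m0) \<omega> - Zs \<omega>))"
        unfolding split by (simp add: algebra_simps)
      also have "\<dots> \<le> norm (I r (Suc m0 + Suc m) \<omega> - Zt \<omega>) + norm (I ?q (Suc m0) \<omega> - Zs \<omega>)"
        by (rule norm_triangle_ineq4)
      finally show "min 1 (norm (I ?p (Suc m) \<omega> - (Zt \<omega> - Zs \<omega>)))
        \<le> min 1 (norm (I r (Suc m0 + Suc m) \<omega> - Zt \<omega>)) + min 1 (norm (I ?q (Suc m0) \<omega> - Zs \<omega>))"
        using norm_ge_zero[of "I r (Suc m0 + Suc m) \<omega> - Zt \<omega>"] norm_ge_zero[of "I ?q (Suc m0) \<omega> - Zs \<omega>"]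
        by linarith
    qed (intro borel_measurable_diff meas Z)+
    also have "\<dots> = expectation (\<lambda>\<omega>. min 1 (norm (I r (Suc m0 + Suc m) \<omega> - Zt \<omega>)))
          + expectation (\<lambda>\<omega>. min 1 (norm (I ?q (Suc m0) \<omega> - Zs \<omega>)))"
      by (intro Bochner_Integration.integral_add integrable_min_1_norm borel_measurable_diff meas Z)
    also have "\<dots> \<le> 2 * (e / 5) + 2 * (e / 5)"
      by (intro add_mono expectation_min_1_le borel_measurable_diff meas Z 1 2)
    also have "\<dots> < e" using \<open>0 < e\<close> by simp
    finally show ?thesis .
  qed
  moreover have "0 \<le> expectation (\<lambda>\<omega>. min 1 (norm (I (grid s t (Suc m)) (Suc m) \<omega> - (Zt \<omega> - Zs \<omega>))))" for m
    by (intro integral_nonneg_AE) auto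
  ultimately show "\<exists>N. \<forall>m\<ge>N. norm (expectation (\<lambda>\<omega>. min 1 (norm ((\<Sum>i<Suc m. (W (grid s t (Suc m) (Suc i)) \<omega>
      - W (grid s t (Suc m) i) \<omega>) *\<^sub>R H (grid s t (Suc m) i) \<omega>) - (Zt \<omega> - Zs \<omega>)))) - 0) < e"
    unfolding I_def by (intro exI[of _ N]) auto
qed

end

section \<open>Stochastic sums with respect to a Wiener process\<close>

locale wiener_noise = prob_space M for M :: "'w measure" +
  fixes W :: "real \<Rightarrow> 'w \<Rightarrow> real" and F :: "real \<Rightarrow> 'w measure"
  assumes W: "wiener_process M W" and F: "wiener_filtration M W F"
begin

lemma subalgebra_F: "subalgebra M (F t)"
  using F by (simp add: wiener_filtration_def)

lemma W_adapted: "0 \<le> t \<Longrightarrow> W t \<in> borel_measurable (F t)"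
  using F by (simp add: wiener_filtration_def)

lemma W_measurable: "0 \<le> t \<Longrightarrow> W t \<in> borel_measurable M"
  by (rule measurable_from_subalg[OF subalgebra_F W_adapted])

lemma F_mono: "s \<le> t \<Longrightarrow> X \<in> borel_measurable (F s) \<Longrightarrow> X \<in> borel_measurable (F t)"
proof (rule measurable_from_subalg[of "F t" "F s"])
  have filt: "filtration (space M) F" using F by (simp add: wiener_filtration_def)
  show "subalgebra (F t) (F s)" if "s \<le> t"
    using filtration.space_F[OF filt] filtration.sets_F_mono[OF filt that] by (simp add: subalgebra_def)
qed

lemma
  assumes "0 \<le> s" "s \<le> t"
  shows increment_indep: "indep_set (sets (F s)) (generated_events M (\<lambda>\<omega>. W t \<omega> - W s \<omega>) borel)"
    and increment_measurable: "(\<lambda>\<omega>. W t \<omega> - W s \<omega>) \<in> borel_measurable M"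
    and increment_sq_integrable: "integrable M (\<lambda>\<omega>. (W t \<omega> - W s \<omega>)\<^sup>2)"
    and increment_expectation: "expectation (\<lambda>\<omega>. W t \<omega> - W s \<omega>) = 0"
    and increment_variance: "expectation (\<lambda>\<omega>. (W t \<omega> - W s \<omega>)\<^sup>2) = t - s"
proof -
  show "indep_set (sets (F s)) (generated_events M (\<lambda>\<omega>. W t \<omega> - W s \<omega>) borel)"
    using F assms by (simp add: wiener_filtration_def)
  show "(\<lambda>\<omega>. W t \<omega> - W s \<omega>) \<in> borel_measurable M"
    using assms by (intro borel_measurable_diff W_measurable) auto
  have "integrable M (\<lambda>\<omega>. (W t \<omega> - W s \<omega>)\<^sup>2) \<and> expectation (\<lambda>\<omega>. W t \<omega> - W s \<omega>) = 0
    \<and> expectation (\<lambda>\<omega>. (W t \<omega> - W s \<omega>)\<^sup>2) = t - s"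
  \<comment> \<open>A Gaussian density is prescribed only for \<open>s < t\<close>; for
    \<open>s = t\<close> the increment vanishes.\<close>
  proof (cases "s = t")
    case False
    then have \<sigma>: "0 < sqrt (t - s)" using assms by simp
    have D: "distributed M lborel (\<lambda>\<omega>. W t \<omega> - W s \<omega>) (normal_density 0 (sqrt (t - s)))"
      using W assms False by (simp add: wiener_process_def)
    have "integrable M (\<lambda>\<omega>. (W t \<omega> - W s \<omega>)\<^sup>2)"
      using distributed_integrable[OF D, of "\<lambda>x. x\<^sup>2"] integrable_normal_moment[OF \<sigma>, of 0 2] by simp
    then show ?thesis
      using normal_distributed_expectation[OF \<sigma> D] normal_distributed_variance[OF \<sigma> D] assms by simp
  qed simp
  then show "integrable M (\<lambda>\<omega>. (W t \<omega> - W s \<omega>)\<^sup>2)" "expectation (\<lambda>\<omega>. W t \<omega> - W s \<omega>) = 0"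
    "expectation (\<lambda>\<omega>. (W t \<omega> - W s \<omega>)\<^sup>2) = t - s" by auto
qed

lemma increment_integrable: "0 \<le> s \<Longrightarrow> s \<le> t \<Longrightarrow> integrable M (\<lambda>\<omega>. W t \<omega> - W s \<omega>)"
  by (rule square_integrable_imp_integrable[OF increment_measurable increment_sq_integrable])

text \<open>Induction over the cells, each new cell being an instance of the noise lemma.
  Measurability of the partial sum with respect to \<open>F (p n)\<close> has to be part of the
  induction, because the next increment is independent of exactly that sigma-algebra.\<close>

lemma ito_isometry:
  fixes G :: "nat \<Rightarrow> 'w \<Rightarrow> 'e::euclidean_space"
  assumes "0 \<le> p 0" "\<And>i. p i \<le> p (Suc i)"
    and "\<And>i. i < n \<Longrightarrow> G i \<in> borel_measurable (F (p i))" "\<And>i. i < n \<Longrightarrow> sq_integrable M (G i)"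
  defines "I \<equiv> \<lambda>n \<omega>. \<Sum>i<n. (W (p (Suc i)) \<omega> - W (p i) \<omega>) *\<^sub>R G i \<omega>"
  shows "sq_integrable M (I n)"
    and "expectation (\<lambda>\<omega>. (norm (I n \<omega>))\<^sup>2)
        = (\<Sum>i<n. (p (Suc i) - p i) * expectation (\<lambda>\<omega>. (norm (G i \<omega>))\<^sup>2))"
proof -
  have p: "0 \<le> p i" for i
    using lift_Suc_mono_le[of p 0 i] assms(1,2) by auto
  have "I n \<in> borel_measurable (F (p n)) \<and> sq_integrable M (I n) \<and> expectation (\<lambda>\<omega>. (norm (I n \<omega>))\<^sup>2)
        = (\<Sum>i<n. (p (Suc i) - p i) * expectation (\<lambda>\<omega>. (norm (G i \<omega>))\<^sup>2))"
    using assms(3,4)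
  proof (induction n)
    case 0
    then show ?case by (simp add: I_def sq_integrable_zero)
  next
    case (Suc n)
    let ?N = "\<lambda>\<omega>. W (p (Suc n)) \<omega> - W (p n) \<omega>"
    have Suc_eq: "I (Suc n) = (\<lambda>\<omega>. I n \<omega> + ?N \<omega> *\<^sub>R G n \<omega>)"
      by (simp add: I_def)
    have IH: "I n \<in> borel_measurable (F (p n))" "sq_integrable M (I n)"
      "expectation (\<lambda>\<omega>. (norm (I n \<omega>))\<^sup>2) = (\<Sum>i<n. (p (Suc i) - p i) * expectation (\<lambda>\<omega>. (norm (G i \<omega>))\<^sup>2))"
      using Suc by auto
    have G: "G n \<in> borel_measurable (F (p n))" "sq_integrable M (G n)"
      using Suc.prems by auto
    note noise = subalgebra_F increment_indep[OF p assms(2)] IH(1,2) G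
      increment_measurable[OF p assms(2)] increment_sq_integrable[OF p assms(2)]
      increment_expectation[OF p assms(2)]
    have "I (Suc n) \<in> borel_measurable (F (p (Suc n)))"
      unfolding Suc_eq
      by (intro borel_measurable_add borel_measurable_scaleR borel_measurable_diff W_adapted p
          F_mono[OF assms(2)[of n]] IH(1) G(1))
    moreover have "sq_integrable M (I (Suc n))"
      unfolding Suc_eq by (rule sq_integrable_noise[OF noise])
    moreover have "expectation (\<lambda>\<omega>. (norm (I (Suc n) \<omega>))\<^sup>2)
      = (\<Sum>i<Suc n. (p (Suc i) - p i) * expectation (\<lambda>\<omega>. (norm (G i \<omega>))\<^sup>2))"
      using expectation_bilinear_noise[OF noise bounded_bilinear_inner] IH(3)
      unfolding Suc_eq power2_norm_eq_inner increment_variance[OF p assms(2)] by simp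
    ultimately show ?case by blast
  qed
  then show "sq_integrable M (I n)" "expectation (\<lambda>\<omega>. (norm (I n \<omega>))\<^sup>2)
        = (\<Sum>i<n. (p (Suc i) - p i) * expectation (\<lambda>\<omega>. (norm (G i \<omega>))\<^sup>2))"
    by auto
qed

text \<open>The martingale property in the form needed below: a stochastic sum after time
  \<open>s\<close> is orthogonal to everything known at time \<open>s\<close>.\<close>

lemma expectation_inner_increment:
  fixes U G :: "'w \<Rightarrow> 'e::euclidean_space"
  assumes "0 \<le> s" "s \<le> t" "U \<in> borel_measurable (F s)" "sq_integrable M U"
    and "G \<in> borel_measurable (F s)" "sq_integrable M G"
  shows "integrable M (\<lambda>\<omega>. U \<omega> \<bullet> ((W t \<omega> - W s \<omega>) *\<^sub>R G \<omega>))"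
    and "expectation (\<lambda>\<omega>. U \<omega> \<bullet> ((W t \<omega> - W s \<omega>) *\<^sub>R G \<omega>)) = 0"
  using indep_set_expectation_mult[OF subalgebra_F increment_indep[OF assms(1,2)]
      borel_measurable_inner[OF assms(3,5)] integrable_inner_sq[OF assms(4,6)]
      increment_measurable[OF assms(1,2)], of "\<lambda>x. x"]
    increment_integrable[OF assms(1,2)] increment_expectation[OF assms(1,2)]
  by simp_all

end

section \<open>Second moments of linear stochastic differential equations\<close>

text \<open>\<open>L\<close> is separate from \<open>b - a\<close> so that all constants depend only
  on a bound for the length. In the stability proof \<open>L = Tmax\<close> then gives one constant
  for every interval between impulses.\<close>

locale linear_sde = wiener_noise +
  fixes f g :: "'e::euclidean_space \<Rightarrow> 'e" and K L a b :: real and Y :: "real \<Rightarrow> 'a \<Rightarrow> 'e"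
  assumes sde: "solves_sde M W F f g a b Y"
    and f: "bounded_linear f" "\<And>x. norm (f x) \<le> K * norm x"
    and g: "bounded_linear g" "\<And>x. norm (g x) \<le> K * norm x"
    and interval: "0 \<le> a" "a \<le> b" "b - a \<le> L"
    and initial: "sq_integrable M (Y a)"
begin

lemma L_nonneg: "0 \<le> L"
  using interval by simp

lemma Y_adapted: "t \<in> {a..b} \<Longrightarrow> Y t \<in> borel_measurable (F t)"
  using sde by (simp add: solves_sde_def)

lemma Y_measurable: "t \<in> {a..b} \<Longrightarrow> Y t \<in> borel_measurable M"
  by (rule measurable_from_subalg[OF subalgebra_F Y_adapted])

lemma Y_continuous: "AE \<omega> in M. continuous_on {a..b} (\<lambda>t. Y t \<omega>)"
  using sde by (simp add: solves_sde_def)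

text \<open>The integrand is a parameter because four choices occur: the solution along the grid,
  its killed version, the value frozen at \<open>s\<close>, and the difference of solution and
  frozen value.\<close>

definition euler :: "real \<Rightarrow> real \<Rightarrow> nat \<Rightarrow> (nat \<Rightarrow> 'a \<Rightarrow> 'e) \<Rightarrow> 'a \<Rightarrow> 'e" where
  "euler s t n H \<omega> = (\<Sum>i<n. ((t - s) / n) *\<^sub>R f (H i \<omega>))
    + (\<Sum>i<n. (W (grid s t n (Suc i)) \<omega> - W (grid s t n i) \<omega>) *\<^sub>R g (H i \<omega>))"

text \<open>In the constant, 2 is the price of separating drift and noise, \<open>L\<close> belongs
  to the drift (from \<open>t - s \<le> L\<close>) and 1 to the noise, by the isometry. Against a
  vector \<open>U\<close> known at time \<open>s\<close> the noise part contributes nothing, so only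
  the drift is left in \<open>euler_inner\<close>.\<close>

lemma
  assumes st: "0 \<le> s" "s \<le> t" "t - s \<le> L" and n: "0 < n"
    and H: "\<And>i. i < n \<Longrightarrow> H i \<in> borel_measurable (F (grid s t n i))" "\<And>i. i < n \<Longrightarrow> sq_integrable M (H i)"
  shows euler_sq_integrable: "sq_integrable M (euler s t n H)"
    and euler_bound: "expectation (\<lambda>\<omega>. (norm (euler s t n H \<omega>))\<^sup>2) \<le>
      2 * K\<^sup>2 * (L + 1) * ((t - s) / n * (\<Sum>i<n. expectation (\<lambda>\<omega>. (norm (H i \<omega>))\<^sup>2)))"
    and euler_inner: "\<lbrakk>U \<in> borel_measurable (F s); sq_integrable M U\<rbrakk> \<Longrightarrow>
      expectation (\<lambda>\<omega>. U \<omega> \<bullet> euler s t n H \<omega>) = (t - s) / n * (\<Sum>i<n. expectation (\<lambda>\<omega>. U \<omega> \<bullet> f (H i \<omega>)))"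
proof -
  let ?p = "grid s t n" and ?\<delta> = "(t - s) / n"
  let ?D = "\<lambda>\<omega>. \<Sum>i<n. ?\<delta> *\<^sub>R f (H i \<omega>)"
  let ?I = "\<lambda>\<omega>. \<Sum>i<n. (W (?p (Suc i)) \<omega> - W (?p i) \<omega>) *\<^sub>R g (H i \<omega>)"
  let ?E = "\<Sum>i<n. expectation (\<lambda>\<omega>. (norm (H i \<omega>))\<^sup>2)"
  have mono: "?p i \<le> ?p (Suc i)" "s \<le> ?p i" "0 \<le> ?p i" for i
    using grid_mono[OF st(2), of i "Suc i" n] grid_mono[OF st(2), of 0 i n] st(1) by auto
  have gH: "(\<lambda>\<omega>. g (H i \<omega>)) \<in> borel_measurable (F (?p i))" "sq_integrable M (\<lambda>\<omega>. g (H i \<omega>))" if "i < n" for i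
    using bounded_linear_borel_measurable[OF g(1) H(1)[OF that]] sq_integrable_linear[OF g(1) H(2)[OF that]] .
  have fH: "sq_integrable M (\<lambda>\<omega>. f (H i \<omega>))" if "i < n" for i
    by (rule sq_integrable_linear[OF f(1) H(2)[OF that]])
  have E: "0 \<le> ?E" by (intro sum_nonneg) simp
  have \<delta>: "0 \<le> ?\<delta>" "n * ?\<delta> = t - s" using st n by auto
  have I: "sq_integrable M ?I" "expectation (\<lambda>\<omega>. (norm (?I \<omega>))\<^sup>2)
      = (\<Sum>i<n. (?p (Suc i) - ?p i) * expectation (\<lambda>\<omega>. (norm (g (H i \<omega>)))\<^sup>2))"
    using ito_isometry[of ?p n "\<lambda>i \<omega>. g (H i \<omega>)"] mono gH st(1) by auto
  have D: "sq_integrable M ?D"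
    by (intro sq_integrable_sum sq_integrable_scaleR fH) simp
  show "sq_integrable M (euler s t n H)"
    unfolding euler_def by (rule sq_integrable_add[OF D I(1)])
  have "expectation (\<lambda>\<omega>. (norm (?I \<omega>))\<^sup>2) \<le> (\<Sum>i<n. ?\<delta> * (K\<^sup>2 * expectation (\<lambda>\<omega>. (norm (H i \<omega>))\<^sup>2)))"
    unfolding I(2) grid_step using H(2) \<delta>(1)
    by (intro sum_mono mult_left_mono expectation_norm_linear_squared_le[OF g]) auto
  also have "\<dots> = K\<^sup>2 * (?\<delta> * ?E)"
    by (simp add: sum_distrib_left mult_ac)
  finally have I_le: "expectation (\<lambda>\<omega>. (norm (?I \<omega>))\<^sup>2) \<le> K\<^sup>2 * (?\<delta> * ?E)" .
  have sq: "(norm (?\<delta> *\<^sub>R x))\<^sup>2 = ?\<delta> * ?\<delta> * (norm x)\<^sup>2" for x :: 'e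
    by (simp only: norm_scaleR power_mult_distrib power2_abs power2_eq_square[of ?\<delta>])
  have "expectation (\<lambda>\<omega>. (norm (?D \<omega>))\<^sup>2) \<le> n * (\<Sum>i<n. expectation (\<lambda>\<omega>. (norm (?\<delta> *\<^sub>R f (H i \<omega>)))\<^sup>2))"
    by (intro expectation_norm_sum_squared_le sq_integrable_scaleR fH)
  also have "\<dots> = n * ?\<delta> * ?\<delta> * (\<Sum>i<n. expectation (\<lambda>\<omega>. (norm (f (H i \<omega>)))\<^sup>2))"
    by (simp only: sq sum_distrib_left integral_mult_right_zero mult_ac)
  also have "\<dots> \<le> n * ?\<delta> * ?\<delta> * (\<Sum>i<n. K\<^sup>2 * expectation (\<lambda>\<omega>. (norm (H i \<omega>))\<^sup>2))"
    using H(2) \<delta>(1) by (intro mult_left_mono sum_mono expectation_norm_linear_squared_le[OF f]) auto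
  also have "\<dots> = (t - s) * (K\<^sup>2 * (?\<delta> * ?E))"
    unfolding \<delta>(2) by (simp add: sum_distrib_left[symmetric] mult_ac)
  also have "\<dots> \<le> L * (K\<^sup>2 * (?\<delta> * ?E))"
    by (intro mult_right_mono st(3) mult_nonneg_nonneg \<delta>(1) E) simp
  finally have D_le: "expectation (\<lambda>\<omega>. (norm (?D \<omega>))\<^sup>2) \<le> L * (K\<^sup>2 * (?\<delta> * ?E))" .
  have ring: "2 * (L * (K\<^sup>2 * q)) + 2 * (K\<^sup>2 * q) = 2 * K\<^sup>2 * (L + 1) * q" for q
    by (simp add: algebra_simps)
  have "expectation (\<lambda>\<omega>. (norm (euler s t n H \<omega>))\<^sup>2)
      \<le> 2 * (L * (K\<^sup>2 * (?\<delta> * ?E))) + 2 * (K\<^sup>2 * (?\<delta> * ?E))"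
    using expectation_norm_add_squared_le[OF D I(1)] I_le D_le unfolding euler_def by linarith
  then show "expectation (\<lambda>\<omega>. (norm (euler s t n H \<omega>))\<^sup>2) \<le> 2 * K\<^sup>2 * (L + 1) * (?\<delta> * ?E)"
    by (simp only: ring)
  assume U: "U \<in> borel_measurable (F s)" "sq_integrable M U"
  have inc: "integrable M (\<lambda>\<omega>. U \<omega> \<bullet> ((W (?p (Suc i)) \<omega> - W (?p i) \<omega>) *\<^sub>R g (H i \<omega>)))"
    "expectation (\<lambda>\<omega>. U \<omega> \<bullet> ((W (?p (Suc i)) \<omega> - W (?p i) \<omega>) *\<^sub>R g (H i \<omega>))) = 0" if "i < n" for i
    using expectation_inner_increment[OF mono(3,1) F_mono[OF mono(2) U(1)] U(2) gH[OF that]] by auto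
  have zero: "(\<Sum>i<n. expectation (\<lambda>\<omega>. U \<omega> \<bullet> ((W (?p (Suc i)) \<omega> - W (?p i) \<omega>) *\<^sub>R g (H i \<omega>)))) = 0"
    by (intro sum.neutral ballI inc(2)) simp
  have drift: "integrable M (\<lambda>\<omega>. ?\<delta> * (U \<omega> \<bullet> f (H i \<omega>)))" if "i < n" for i
    by (intro integrable_mult_right integrable_inner_sq U(2) fH that)
  have "expectation (\<lambda>\<omega>. U \<omega> \<bullet> euler s t n H \<omega>) =
    expectation (\<lambda>\<omega>. (\<Sum>i<n. ?\<delta> * (U \<omega> \<bullet> f (H i \<omega>)))
      + (\<Sum>i<n. U \<omega> \<bullet> ((W (?p (Suc i)) \<omega> - W (?p i) \<omega>) *\<^sub>R g (H i \<omega>))))"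
    by (simp only: euler_def inner_add_right inner_sum_right inner_scaleR_right)
  also have "\<dots> = expectation (\<lambda>\<omega>. \<Sum>i<n. ?\<delta> * (U \<omega> \<bullet> f (H i \<omega>)))
      + expectation (\<lambda>\<omega>. \<Sum>i<n. U \<omega> \<bullet> ((W (?p (Suc i)) \<omega> - W (?p i) \<omega>) *\<^sub>R g (H i \<omega>)))"
    using inc(1) drift by (intro Bochner_Integration.integral_add Bochner_Integration.integrable_sum) auto
  also have "\<dots> = (\<Sum>i<n. expectation (\<lambda>\<omega>. ?\<delta> * (U \<omega> \<bullet> f (H i \<omega>))))
      + (\<Sum>i<n. expectation (\<lambda>\<omega>. U \<omega> \<bullet> ((W (?p (Suc i)) \<omega> - W (?p i) \<omega>) *\<^sub>R g (H i \<omega>))))"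
    using inc(1) drift by (intro arg_cong2[of _ _ _ _ "(+)"] Bochner_Integration.integral_sum) auto
  also have "\<dots> = (\<Sum>i<n. ?\<delta> * expectation (\<lambda>\<omega>. U \<omega> \<bullet> f (H i \<omega>)))"
    by (simp only: integral_mult_right_zero zero add_0_right)
  finally show "expectation (\<lambda>\<omega>. U \<omega> \<bullet> euler s t n H \<omega>) = ?\<delta> * (\<Sum>i<n. expectation (\<lambda>\<omega>. U \<omega> \<bullet> f (H i \<omega>)))"
    by (simp add: sum_distrib_left)
qed

text \<open>The drift sums converge almost surely, as Riemann sums along continuous paths; the noise
  sums converge in probability by \<open>ito_subinterval\<close>.\<close>

lemma euler_tendsto:
  assumes "a \<le> s" "s \<le> t" "t \<le> b"
  shows "tendsto_prob M (\<lambda>m. euler s t (Suc m) (\<lambda>i. Y (grid s t (Suc m) i))) (\<lambda>\<omega>. Y t \<omega> - Y s \<omega>)"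
proof -
  have mem0: "s \<in> {a..b}" "t \<in> {a..b}" using assms by auto
  obtain Zs where Zs: "has_ito_integral M W (\<lambda>s \<omega>. g (Y s \<omega>)) a s Zs"
    "AE \<omega> in M. Y s \<omega> = Y a \<omega> + integral {a..s} (\<lambda>s. f (Y s \<omega>)) + Zs \<omega>"
    using sde mem0(1) unfolding solves_sde_def by blast
  obtain Zt where Zt: "has_ito_integral M W (\<lambda>s \<omega>. g (Y s \<omega>)) a t Zt"
    "AE \<omega> in M. Y t \<omega> = Y a \<omega> + integral {a..t} (\<lambda>s. f (Y s \<omega>)) + Zt \<omega>"
    using sde mem0(2) unfolding solves_sde_def by blast
  have Z: "Zs \<in> borel_measurable M" "Zt \<in> borel_measurable M"
    using Zs(1) Zt(1) by (auto simp: has_ito_integral_def)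
  define D where "D m \<omega> = (\<Sum>i<Suc m. ((t - s) / Suc m) *\<^sub>R f (Y (grid s t (Suc m) i) \<omega>))" for m \<omega>
  define I where "I m \<omega> = (\<Sum>i<Suc m. (W (grid s t (Suc m) (Suc i)) \<omega> - W (grid s t (Suc m) i) \<omega>)
    *\<^sub>R g (Y (grid s t (Suc m) i) \<omega>))" for m \<omega>
  have grid_Y: "Y (grid s t (Suc m) i) \<in> borel_measurable M" if "i \<le> Suc m" for m i
    using grid_in[OF assms(2) _ that] assms by (intro Y_measurable) auto
  have grid_W: "W (grid s t (Suc m) i) \<in> borel_measurable M" for m i
    using grid_mono[OF assms(2), of 0 i "Suc m"] assms(1) interval(1) by (intro W_measurable) simp
  have D: "D m \<in> borel_measurable M" for m
    unfolding D_def
    by (intro borel_measurable_sum borel_measurable_scaleR borel_measurable_const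
        bounded_linear_borel_measurable[OF f(1)] grid_Y) simp
  have I: "I m \<in> borel_measurable M" for m
    unfolding I_def
    by (intro borel_measurable_sum borel_measurable_scaleR borel_measurable_diff grid_W
        bounded_linear_borel_measurable[OF g(1)] grid_Y) simp
  have "tendsto_prob M I (\<lambda>\<omega>. Zt \<omega> - Zs \<omega>)"
    unfolding I_def using interval(1) assms
    by (intro ito_subinterval[OF Zs(1) Zt(1) assms(1,2)] W_measurable
        bounded_linear_borel_measurable[OF g(1)] Y_measurable) auto
  \<comment> \<open>The limit is the pathwise integral of the drift. Writing it in terms of
    \<open>Y\<close>, \<open>Zs\<close> and \<open>Zt\<close> makes its measurability
    evident.\<close>
  moreover have "tendsto_prob M D (\<lambda>\<omega>. Y t \<omega> - Y s \<omega> - (Zt \<omega> - Zs \<omega>))"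
  proof (rule AE_imp_tendsto_prob[OF D])
    show "(\<lambda>\<omega>. Y t \<omega> - Y s \<omega> - (Zt \<omega> - Zs \<omega>)) \<in> borel_measurable M"
      by (intro borel_measurable_diff Y_measurable Z mem0)
    show "AE \<omega> in M. (\<lambda>m. D m \<omega>) \<longlonglongrightarrow> Y t \<omega> - Y s \<omega> - (Zt \<omega> - Zs \<omega>)"
      using Y_continuous Zs(2) Zt(2)
    proof eventually_elim
      case (elim \<omega>)
      have "continuous_on {a..b} (\<lambda>u. f (Y u \<omega>))"
        by (rule bounded_linear.continuous_on[OF f(1) elim(1)])
      then have c: "continuous_on {a..t} (\<lambda>u. f (Y u \<omega>))" "continuous_on {s..t} (\<lambda>u. f (Y u \<omega>))"
        using assms by (auto elim: continuous_on_subset)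
      have "integral {a..s} (\<lambda>u. f (Y u \<omega>)) + integral {s..t} (\<lambda>u. f (Y u \<omega>)) = integral {a..t} (\<lambda>u. f (Y u \<omega>))"
        by (rule Henstock_Kurzweil_Integration.integral_combine[OF assms(1,2) integrable_continuous_real[OF c(1)]])
      then have "integral {s..t} (\<lambda>u. f (Y u \<omega>)) = Y t \<omega> - Y s \<omega> - (Zt \<omega> - Zs \<omega>)"
        using elim(2,3) by (simp add: algebra_simps)
      then show ?case
        using tendsto_riemann_sum[OF assms(2) c(2)] by (simp only: D_def)
    qed
  qed
  ultimately have "tendsto_prob M (\<lambda>m \<omega>. D m \<omega> + I m \<omega>) (\<lambda>\<omega>. (Y t \<omega> - Y s \<omega> - (Zt \<omega> - Zs \<omega>)) + (Zt \<omega> - Zs \<omega>))"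
    by (intro tendsto_prob_add D I borel_measurable_diff Y_measurable Z mem0)
  moreover have "(\<lambda>m \<omega>. D m \<omega> + I m \<omega>) = (\<lambda>m. euler s t (Suc m) (\<lambda>i. Y (grid s t (Suc m) i)))"
    by (intro ext) (simp only: D_def I_def euler_def)
  ultimately show ?thesis by simp
qed

end

text \<open>A left Riemann sum of an increasing function lies below the integral. For the
  exponential this is \<open>1 + x \<le> exp x\<close> in each cell, followed by
  telescoping.\<close>

lemma grid_sum_exp_le:
  assumes "0 < \<beta>" "s \<le> t" "0 < n"
  shows "(t - s) / n * (\<Sum>i<n. exp (\<beta> * (grid s t n i - s))) \<le> exp (\<beta> * (t - s)) / \<beta>"
proof -
  let ?p = "grid s t n" and ?e = "\<lambda>i. exp (\<beta> * (grid s t n i - s))"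
  have "\<beta> * ((t - s) / n) * ?e i \<le> ?e (Suc i) - ?e i" for i
  proof -
    have "\<beta> * (?p (Suc i) - s) = \<beta> * ((t - s) / n) + \<beta> * (?p i - s)"
      by (simp add: grid_def distrib_left)
    then have "?e (Suc i) = exp (\<beta> * ((t - s) / n)) * ?e i"
      by (simp only: exp_add)
    moreover have "(1 + \<beta> * ((t - s) / n)) * ?e i \<le> exp (\<beta> * ((t - s) / n)) * ?e i"
      by (intro mult_right_mono exp_ge_add_one_self) simp
    ultimately show ?thesis by (simp add: algebra_simps)
  qed
  then have "(\<Sum>i<n. \<beta> * ((t - s) / n) * ?e i) \<le> (\<Sum>i<n. ?e (Suc i) - ?e i)"
    by (intro sum_mono) blast
  also have "\<dots> = exp (\<beta> * (t - s)) - 1"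
    using sum_lessThan_telescope[of ?e n] assms(3) by simp
  also have "\<dots> \<le> exp (\<beta> * (t - s))" by simp
  finally have "\<beta> * ((t - s) / n * (\<Sum>i<n. ?e i)) \<le> exp (\<beta> * (t - s))"
    by (simp only: sum_distrib_left mult.assoc)
  then show ?thesis
    using assms(1) by (simp add: pos_le_divide_eq mult.commute)
qed

section \<open>A priori second moment bound\<close>

context linear_sde
begin

lemma euler_measurable:
  assumes "0 \<le> s" "s \<le> t" "\<And>i. i < n \<Longrightarrow> H i \<in> borel_measurable M"
  shows "euler s t n H \<in> borel_measurable M"
proof -
  have "W (grid s t n i) \<in> borel_measurable M" for i
    using grid_mono[OF assms(2), of 0 i n] assms(1) by (intro W_measurable) simp
  then show ?thesis
    unfolding euler_def
    by (intro borel_measurable_add borel_measurable_sum borel_measurable_scaleR borel_measurable_const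
        borel_measurable_diff bounded_linear_borel_measurable[OF f(1)]
        bounded_linear_borel_measurable[OF g(1)] assms(3)) simp_all
qed

text \<open>Square integrability is not assumed for \<open>t > a\<close>. The a priori bound is obtained for the solution
  killed when it leaves the ball of radius \<open>R\<close>; monitoring countably many times keeps the killing
  adapted to the filtration.\<close>

definition good :: "real \<Rightarrow> real \<Rightarrow> 'a set" where
  "good R t = {\<omega> \<in> space M. \<forall>v\<in>{v \<in> \<rat>. a \<le> v \<and> v \<le> t} \<union> {a, t}. norm (Y v \<omega>) \<le> R}"

definition killed :: "real \<Rightarrow> real \<Rightarrow> 'a \<Rightarrow> 'e" where
  "killed R t \<omega> = indicator (good R t) \<omega> *\<^sub>R Y t \<omega>"

lemma good_sets:
  assumes "t \<in> {a..b}" shows "good R t \<in> sets (F t)"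
proof -
  let ?D = "{v \<in> \<rat>. a \<le> v \<and> v \<le> t} \<union> {a, t}"
  have sp: "space (F t) = space M" using subalgebra_F by (simp add: subalgebra_def)
  have D: "v \<in> {a..b} \<and> v \<le> t" if "v \<in> ?D" for v using that assms by auto
  have "countable ?D"
    using countable_rat by (auto intro: countable_subset[of _ \<rat>])
  then have "(\<Inter>v\<in>?D. {\<omega> \<in> space (F t). norm (Y v \<omega>) \<le> R}) \<in> sets (F t)"
  proof (intro sets.countable_INT' image_subsetI)
    fix v assume "v \<in> ?D"
    then have [measurable]: "Y v \<in> borel_measurable (F t)"
      using D F_mono[OF _ Y_adapted] by blast
    show "{\<omega> \<in> space (F t). norm (Y v \<omega>) \<le> R} \<in> sets (F t)" by measurable
  qed auto
  also have "(\<Inter>v\<in>?D. {\<omega> \<in> space (F t). norm (Y v \<omega>) \<le> R}) = good R t"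
    unfolding good_def sp by auto
  finally show ?thesis .
qed

lemma good_norm: "\<omega> \<in> good R t \<Longrightarrow> norm (Y t \<omega>) \<le> R"
  by (simp add: good_def)

text \<open>An irrational \<open>s\<close> is not among the times monitored up to \<open>t\<close>.
  By continuity of the path the bound on the rationals extends to all of \<open>[a, t]\<close>,
  hence to \<open>s\<close>.\<close>

lemma good_antimono:
  assumes cont: "continuous_on {a..b} (\<lambda>t. Y t \<omega>)" and "a \<le> s" "s \<le> t" "t \<le> b" "\<omega> \<in> good R t"
  shows "\<omega> \<in> good R s"
proof -
  have "norm (Y v \<omega>) \<le> R" if v: "v \<in> {a..t}" for v
  proof (cases "a = t")
    case True
    then have "v = t" using v by simp
    then show ?thesis using good_norm[OF assms(5)] by simp
  next
    case False
    then have "a < t" using v by simp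
    have "closure ({a<..<t} \<inter> \<rat>) = closure {a<..<t}"
      by (rule closure_open_Int_superset) (auto simp: Rats_closure_real)
    also have "\<dots> = {a..t}" using \<open>a < t\<close> by simp
    finally have cl: "closure ({a<..<t} \<inter> \<rat>) = {a..t}" .
    show ?thesis
    proof (rule continuous_le_on_closure[where f = "\<lambda>v. norm (Y v \<omega>)"])
      show "continuous_on (closure ({a<..<t} \<inter> \<rat>)) (\<lambda>v. norm (Y v \<omega>))"
        unfolding cl using assms(4) by (intro continuous_on_norm continuous_on_subset[OF cont]) auto
      show "v \<in> closure ({a<..<t} \<inter> \<rat>)" unfolding cl by (rule v)
      show "norm (Y u \<omega>) \<le> R" if "u \<in> {a<..<t} \<inter> \<rat>" for u
        using that assms(5) by (auto simp: good_def)
    qed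
  qed
  then show ?thesis using assms by (auto simp: good_def)
qed

lemma killed_adapted: "t \<in> {a..b} \<Longrightarrow> killed R t \<in> borel_measurable (F t)"
  unfolding killed_def by (intro borel_measurable_scaleR borel_measurable_indicator good_sets Y_adapted)

lemma killed_norm: "0 \<le> R \<Longrightarrow> norm (killed R t \<omega>) \<le> R"
  by (auto simp: killed_def indicator_def good_norm)

lemma
  assumes "0 \<le> R" "t \<in> {a..b}"
  shows killed_sq_integrable: "sq_integrable M (killed R t)"
    and killed_bounded: "expectation (\<lambda>\<omega>. (norm (killed R t \<omega>))\<^sup>2) \<le> R\<^sup>2"
proof -
  have [measurable]: "killed R t \<in> borel_measurable M"
    by (rule measurable_from_subalg[OF subalgebra_F killed_adapted[OF assms(2)]])
  have le: "(norm (killed R t \<omega>))\<^sup>2 \<le> R\<^sup>2" for \<omega>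
    using killed_norm[OF assms(1)] by (intro power_mono) auto
  have int: "integrable M (\<lambda>\<omega>. (norm (killed R t \<omega>))\<^sup>2)"
    using le by (intro integrable_const_bound[of _ "R\<^sup>2"]) auto
  then show "sq_integrable M (killed R t)" by (simp add: sq_integrable_def)
  show "expectation (\<lambda>\<omega>. (norm (killed R t \<omega>))\<^sup>2) \<le> R\<^sup>2"
    using integral_mono[OF int, of "\<lambda>_. R\<^sup>2"] le by (simp add: prob_space)
qed

text \<open>The integral inequality behind the Gronwall argument. A path that is good up to
  \<open>s\<close> was not killed earlier, so on that event the Euler sum may be formed from the
  killed values, which are bounded; off the event both sides vanish. The indicator is dropped only
  after the solution has been replaced by its killed version, and \<open>grid_sum_exp_le\<close>
  evaluates the weighted sum.\<close>

lemma killed_step: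
  assumes "0 \<le> R" "0 < \<beta>" "0 \<le> B" and s: "s \<in> {a..b}"
    and B: "\<And>u. u \<in> {a..b} \<Longrightarrow> expectation (\<lambda>\<omega>. (norm (killed R u \<omega>))\<^sup>2) \<le> B * exp (\<beta> * (u - a))"
  shows "expectation (\<lambda>\<omega>. (norm (killed R s \<omega>))\<^sup>2) \<le>
    2 * expectation (\<lambda>\<omega>. (norm (Y a \<omega>))\<^sup>2) + 4 * K\<^sup>2 * (L + 1) * (B * (exp (\<beta> * (s - a)) / \<beta>))"
proof -
  let ?\<chi> = "indicator (good R s) :: 'a \<Rightarrow> real"
  let ?p = "\<lambda>m. grid a s (Suc m)"
  define E where "E m = euler a s (Suc m) (\<lambda>i. killed R (?p m i))" for m
  have as: "a \<le> s" "s \<le> b" using s by auto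
  have mem: "?p m i \<in> {a..b}" if "i < Suc m" for m i
    using grid_in[OF as(1), of "Suc m" i] that as by auto
  have \<chi> [measurable]: "?\<chi> \<in> borel_measurable M"
    using good_sets[OF s, of R] subalgebra_F[of s]
    by (intro borel_measurable_indicator) (auto simp: subalgebra_def)
  have sL: "s - a \<le> L" using as interval by simp
  note eul = interval(1) as(1) sL zero_less_Suc killed_adapted[OF mem] killed_sq_integrable[OF assms(1) mem]
  have sqE: "sq_integrable M (E m)" for m
    unfolding E_def by (rule euler_sq_integrable[OF eul])
  have sqX: "sq_integrable M (\<lambda>\<omega>. ?\<chi> \<omega> *\<^sub>R (Y a \<omega> + E m \<omega>))" for m
  proof (rule sq_integrable_bound[OF sq_integrable_add[OF initial sqE]])
    show "(\<lambda>\<omega>. ?\<chi> \<omega> *\<^sub>R (Y a \<omega> + E m \<omega>)) \<in> borel_measurable M"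
      using \<chi> sqE[of m] initial by (intro borel_measurable_scaleR borel_measurable_add) (auto simp: sq_integrable_def)
    show "AE \<omega> in M. norm (?\<chi> \<omega> *\<^sub>R (Y a \<omega> + E m \<omega>)) \<le> 1 * norm (Y a \<omega> + E m \<omega>)"
      by (auto simp: indicator_def)
  qed
  have "tendsto_prob M (\<lambda>m \<omega>. ?\<chi> \<omega> *\<^sub>R (Y a \<omega> + E m \<omega>)) (killed R s)"
  proof (rule tendsto_prob_dominated[OF euler_tendsto[OF order_refl as]])
    show "euler a s (Suc m) (\<lambda>i. Y (?p m i)) \<in> borel_measurable M" for m
      by (intro euler_measurable interval(1) as(1) Y_measurable mem)
    show "(\<lambda>\<omega>. Y s \<omega> - Y a \<omega>) \<in> borel_measurable M"
      using as by (intro borel_measurable_diff Y_measurable) auto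
    show "(\<lambda>\<omega>. ?\<chi> \<omega> *\<^sub>R (Y a \<omega> + E m \<omega>)) \<in> borel_measurable M" for m
      using sqX by (simp add: sq_integrable_def)
    show "killed R s \<in> borel_measurable M"
      using killed_sq_integrable[OF assms(1) s] by (simp add: sq_integrable_def)
    show "AE \<omega> in M. norm (?\<chi> \<omega> *\<^sub>R (Y a \<omega> + E m \<omega>) - killed R s \<omega>)
        \<le> norm (euler a s (Suc m) (\<lambda>i. Y (?p m i)) \<omega> - (Y s \<omega> - Y a \<omega>))" for m
      using Y_continuous
    proof eventually_elim
      case (elim \<omega>)
      show ?case
      proof (cases "\<omega> \<in> good R s")
        case True
        have "killed R (?p m i) \<omega> = Y (?p m i) \<omega>" if "i < Suc m" for i
          using good_antimono[OF elim _ _ as(2) True, of "?p m i"] grid_in[OF as(1), of "Suc m" i] that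
          by (simp add: killed_def)
        then have "E m \<omega> = euler a s (Suc m) (\<lambda>i. Y (?p m i)) \<omega>"
          unfolding E_def euler_def by (intro arg_cong2[of _ _ _ _ "(+)"] sum.cong refl) auto
        then show ?thesis using True by (simp add: killed_def algebra_simps)
      qed (simp add: killed_def)
    qed
  qed
  moreover have "killed R s \<in> borel_measurable M"
    using killed_sq_integrable[OF assms(1) s] by (simp add: sq_integrable_def)
  moreover have "expectation (\<lambda>\<omega>. (norm (?\<chi> \<omega> *\<^sub>R (Y a \<omega> + E m \<omega>)))\<^sup>2) \<le>
    2 * expectation (\<lambda>\<omega>. (norm (Y a \<omega>))\<^sup>2) + 4 * K\<^sup>2 * (L + 1) * (B * (exp (\<beta> * (s - a)) / \<beta>))" for m
  proof -
    have "expectation (\<lambda>\<omega>. (norm (?\<chi> \<omega> *\<^sub>R (Y a \<omega> + E m \<omega>)))\<^sup>2) \<le> expectation (\<lambda>\<omega>. (norm (Y a \<omega> + E m \<omega>))\<^sup>2)"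
      by (intro integral_mono sq_integrable_norm sqX sq_integrable_add initial sqE) (auto simp: indicator_def)
    also have "\<dots> \<le> 2 * expectation (\<lambda>\<omega>. (norm (Y a \<omega>))\<^sup>2) + 2 * expectation (\<lambda>\<omega>. (norm (E m \<omega>))\<^sup>2)"
      by (intro expectation_norm_add_squared_le initial sqE)
    also have "expectation (\<lambda>\<omega>. (norm (E m \<omega>))\<^sup>2) \<le> 2 * K\<^sup>2 * (L + 1) *
        ((s - a) / Suc m * (\<Sum>i<Suc m. expectation (\<lambda>\<omega>. (norm (killed R (?p m i) \<omega>))\<^sup>2)))"
      unfolding E_def by (rule euler_bound[OF eul])
    also have "\<dots> \<le> 2 * K\<^sup>2 * (L + 1) * ((s - a) / Suc m * (\<Sum>i<Suc m. B * exp (\<beta> * (?p m i - a))))"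
      using L_nonneg as(1) B mem by (intro mult_left_mono sum_mono) (auto simp del: of_nat_Suc)
    also have "\<dots> = 2 * K\<^sup>2 * (L + 1) * (B * ((s - a) / Suc m * (\<Sum>i<Suc m. exp (\<beta> * (?p m i - a)))))"
      by (simp only: sum_distrib_left[symmetric] mult.left_commute[of B])
    also have "\<dots> \<le> 2 * K\<^sup>2 * (L + 1) * (B * (exp (\<beta> * (s - a)) / \<beta>))"
      using L_nonneg assms(3) by (intro mult_left_mono grid_sum_exp_le assms(2) as(1)) auto
    finally show ?thesis by simp
  qed
  ultimately show ?thesis
    by (rule tendsto_prob_Fatou(2)[OF _ _ sqX])
qed

text \<open>With rate \<open>\<beta> = 8 * K\<^sup>2 * (L + 1) + 1\<close> the factor
  \<open>4 * K\<^sup>2 * (L + 1) / \<beta>\<close> from \<open>killed_step\<close> is at most 1/2,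
  and the summand 1 keeps \<open>\<beta>\<close> positive. The leading 4 is the solution of
  \<open>c = 2 + c / 2\<close>.\<close>

definition moment_bound :: real where
  "moment_bound = 4 * exp ((8 * K\<^sup>2 * (L + 1) + 1) * L)"

text \<open>Gronwall's argument without measurability in time: \<open>killed_step\<close> halves the excess of any bound with weight
  \<open>exp (\<beta> (u - a))\<close> over its fixed point.\<close>

lemma killed_moment_bound:
  assumes "0 \<le> R" "s \<in> {a..b}"
  shows "expectation (\<lambda>\<omega>. (norm (killed R s \<omega>))\<^sup>2) \<le> moment_bound * expectation (\<lambda>\<omega>. (norm (Y a \<omega>))\<^sup>2)"
proof -
  define \<beta> where "\<beta> = 8 * K\<^sup>2 * (L + 1) + 1"
  define E0 where "E0 = expectation (\<lambda>\<omega>. (norm (Y a \<omega>))\<^sup>2)"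
  have E0: "0 \<le> E0" by (simp add: E0_def)
  have \<beta>: "0 < \<beta>" "1 \<le> \<beta>" using L_nonneg by (auto simp: \<beta>_def intro: add_nonneg_pos)
  \<comment> \<open>The trivial bound \<open>R\<^sup>2\<close> starts the iteration. Its
    contribution is halved each time, so the limiting bound no longer depends on \<open>R\<close>,
    as is needed to let \<open>R\<close> tend to infinity.\<close>
  have B: "\<forall>u\<in>{a..b}. expectation (\<lambda>\<omega>. (norm (killed R u \<omega>))\<^sup>2) \<le> (4 * E0 + R\<^sup>2 / 2 ^ k) * exp (\<beta> * (u - a))" for k
  proof (induction k)
    case 0
    have "expectation (\<lambda>\<omega>. (norm (killed R u \<omega>))\<^sup>2) \<le> (4 * E0 + R\<^sup>2) * exp (\<beta> * (u - a))"
      if "u \<in> {a..b}" for u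
    proof -
      have "expectation (\<lambda>\<omega>. (norm (killed R u \<omega>))\<^sup>2) \<le> 4 * E0 + R\<^sup>2"
        using killed_bounded[OF assms(1) that] E0 by simp
      also have "\<dots> * 1 \<le> (4 * E0 + R\<^sup>2) * exp (\<beta> * (u - a))"
        using that \<beta> E0 by (intro mult_left_mono) auto
      finally show ?thesis by simp
    qed
    then show ?case by simp
  next
    case (Suc k)
    define C where "C = 4 * E0 + R\<^sup>2 / 2 ^ k"
    have C: "0 \<le> C" using E0 by (simp add: C_def)
    show ?case
    proof
      fix u assume u: "u \<in> {a..b}"
      let ?e = "exp (\<beta> * (u - a))"
      have e: "1 \<le> ?e" using u \<beta> by simp
      have "expectation (\<lambda>\<omega>. (norm (killed R u \<omega>))\<^sup>2) \<le> 2 * E0 + 4 * K\<^sup>2 * (L + 1) * (C * (?e / \<beta>))"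
        unfolding E0_def using Suc.IH by (intro killed_step assms(1) \<beta>(1) C u) (auto simp: C_def E0_def)
      also have "\<dots> = 2 * E0 + (4 * K\<^sup>2 * (L + 1) / \<beta>) * (C * ?e)"
        by simp
      also have "\<dots> \<le> 2 * E0 * ?e + 1 / 2 * (C * ?e)"
      proof (intro add_mono mult_right_mono)
        show "2 * E0 \<le> 2 * E0 * ?e" using e E0 mult_left_mono[OF e, of "2 * E0"] by simp
        show "4 * K\<^sup>2 * (L + 1) / \<beta> \<le> 1 / 2"
          using \<beta> by (simp add: divide_le_eq) (simp add: \<beta>_def)
        show "0 \<le> C * ?e" using C by simp
      qed
      also have "\<dots> = (4 * E0 + R\<^sup>2 / 2 ^ Suc k) * ?e"
        by (simp add: C_def algebra_simps)
      finally show "expectation (\<lambda>\<omega>. (norm (killed R u \<omega>))\<^sup>2) \<le> (4 * E0 + R\<^sup>2 / 2 ^ Suc k) * ?e" .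
    qed
  qed
  have "(\<lambda>k. (4 * E0 + R\<^sup>2 / 2 ^ k) * exp (\<beta> * (s - a))) \<longlonglongrightarrow> (4 * E0 + 0) * exp (\<beta> * (s - a))"
    by (intro tendsto_intros LIMSEQ_divide_realpow_zero) simp
  from tendsto_lowerbound[OF this, of "expectation (\<lambda>\<omega>. (norm (killed R s \<omega>))\<^sup>2)"] B assms(2)
  have "expectation (\<lambda>\<omega>. (norm (killed R s \<omega>))\<^sup>2) \<le> 4 * E0 * exp (\<beta> * (s - a))"
    by simp
  also have "\<dots> \<le> 4 * E0 * exp (\<beta> * L)"
    using assms(2) interval \<beta> E0 by (intro mult_left_mono) auto
  finally show ?thesis by (simp add: moment_bound_def E0_def \<beta>_def mult_ac)
qed

text \<open>A continuous path is bounded on \<open>[a, b]\<close>, so it is not killed once the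
  radius is large enough. The bound for killed solutions is uniform in the radius and survives the
  limit.\<close>

lemma
  assumes "s \<in> {a..b}"
  shows Y_sq_integrable: "sq_integrable M (Y s)"
    and Y_moment_bound: "expectation (\<lambda>\<omega>. (norm (Y s \<omega>))\<^sup>2) \<le> moment_bound * expectation (\<lambda>\<omega>. (norm (Y a \<omega>))\<^sup>2)"
proof -
  have "tendsto_prob M (\<lambda>n. killed (real n) s) (Y s)"
  proof (rule AE_imp_tendsto_prob)
    show "killed (real n) s \<in> borel_measurable M" for n
      using killed_sq_integrable[OF _ assms] by (simp add: sq_integrable_def)
    show "Y s \<in> borel_measurable M" by (rule Y_measurable[OF assms])
    show "AE \<omega> in M. (\<lambda>n. killed (real n) s \<omega>) \<longlonglongrightarrow> Y s \<omega>"
      using Y_continuous AE_space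
    proof eventually_elim
      case (elim \<omega>)
      have "bounded ((\<lambda>t. Y t \<omega>) ` {a..b})"
        by (intro compact_imp_bounded compact_continuous_image elim(1)) simp
      then obtain r where r: "\<forall>t\<in>{a..b}. norm (Y t \<omega>) \<le> r"
        unfolding bounded_iff by auto
      obtain N :: nat where "r \<le> N" using real_arch_simple by blast
      then have N: "norm (Y t \<omega>) \<le> N" if "t \<in> {a..b}" for t
        using bspec[OF r that] by linarith
      have "\<forall>\<^sub>F n in sequentially. Y s \<omega> = killed (real n) s \<omega>"
        using eventually_ge_at_top[of N]
      proof eventually_elim
        case n: (elim n)
        have "norm (Y v \<omega>) \<le> n" if "v \<in> {v \<in> \<rat>. a \<le> v \<and> v \<le> s} \<union> {a, s}" for v
          using that assms n by (intro order_trans[OF N]) auto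
        then show ?case using elim(2) by (simp add: killed_def good_def)
      qed
      from Lim_transform_eventually[OF tendsto_const this] show ?case .
    qed
  qed
  from tendsto_prob_Fatou[OF this Y_measurable[OF assms] killed_sq_integrable[OF _ assms] killed_moment_bound[OF _ assms]]
  show "sq_integrable M (Y s)"
    "expectation (\<lambda>\<omega>. (norm (Y s \<omega>))\<^sup>2) \<le> moment_bound * expectation (\<lambda>\<omega>. (norm (Y a \<omega>))\<^sup>2)"
    by simp_all
qed

end

section \<open>Short-time expansion and derivative of second moments\<close>

lemma bounded_bilinear_plus:
  assumes "bounded_bilinear \<beta>" "bounded_bilinear \<gamma>"
  shows "bounded_bilinear (\<lambda>x y. \<beta> x y + \<gamma> x y)"
proof -
  obtain K1 K2 where K: "\<And>x y. norm (\<beta> x y) \<le> norm x * norm y * K1" "\<And>x y. norm (\<gamma> x y) \<le> norm x * norm y * K2"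
    using bounded_bilinear.bounded[OF assms(1)] bounded_bilinear.bounded[OF assms(2)] by metis
  show ?thesis
  proof
    show "\<exists>K. \<forall>x y. norm (\<beta> x y + \<gamma> x y) \<le> norm x * norm y * K"
    proof (intro exI allI)
      fix x y
      show "norm (\<beta> x y + \<gamma> x y) \<le> norm x * norm y * (K1 + K2)"
        unfolding distrib_left by (rule order_trans[OF norm_triangle_ineq add_mono[OF K]])
    qed
  qed (simp_all add: bounded_bilinear.add_left[OF assms(1)] bounded_bilinear.add_left[OF assms(2)]
      bounded_bilinear.add_right[OF assms(1)] bounded_bilinear.add_right[OF assms(2)]
      bounded_bilinear.scaleR_left[OF assms(1)] bounded_bilinear.scaleR_left[OF assms(2)]
      bounded_bilinear.scaleR_right[OF assms(1)] bounded_bilinear.scaleR_right[OF assms(2)] scaleR_add_right)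
qed

text \<open>Turns the pairing of \<open>Y s\<close> with a remainder under \<open>\<beta>\<close>
  into an inner product of the remainder with a vector known at time \<open>s\<close>, the only form
  in which orthogonality to the past can be used.\<close>

lemma bounded_bilinear_Riesz:
  fixes \<beta> :: "'a::euclidean_space \<Rightarrow> 'b::euclidean_space \<Rightarrow> real"
  assumes "bounded_bilinear \<beta>"
  obtains T where "bounded_linear T" "\<And>x y. \<beta> x y = T x \<bullet> y"
proof
  let ?T = "\<lambda>x. \<Sum>b\<in>Basis. \<beta> x b *\<^sub>R b"
  show "bounded_linear ?T"
    by (intro bounded_linear_sum bounded_linear_scaleR_left[THEN bounded_linear_compose]
        bounded_bilinear.bounded_linear_left[OF assms])
  show "\<beta> x y = ?T x \<bullet> y" for x y
  proof -
    have "\<beta> x y = \<beta> x (\<Sum>b\<in>Basis. (y \<bullet> b) *\<^sub>R b)" by (simp add: euclidean_representation)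
    also have "\<dots> = ?T x \<bullet> y"
      by (simp add: bounded_bilinear.sum_right[OF assms] bounded_bilinear.scaleR_right[OF assms]
          inner_sum_left inner_commute[of y] mult.commute)
    finally show ?thesis .
  qed
qed

context linear_sde
begin

definition moment_cap :: real where
  "moment_cap = moment_bound * expectation (\<lambda>\<omega>. (norm (Y a \<omega>))\<^sup>2)"

definition euler_const :: real where
  "euler_const = 2 * K\<^sup>2 * (L + 1)"

lemma moment_cap_nonneg: "0 \<le> moment_cap"
  by (simp add: moment_cap_def moment_bound_def)

lemma euler_const_nonneg: "0 \<le> euler_const"
  using L_nonneg by (simp add: euler_const_def)

lemma Y_moment_cap: "s \<in> {a..b} \<Longrightarrow> expectation (\<lambda>\<omega>. (norm (Y s \<omega>))\<^sup>2) \<le> moment_cap"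
  unfolding moment_cap_def by (rule Y_moment_bound)

lemma euler_bound_uniform:
  assumes st: "a \<le> s" "s \<le> t" "t \<le> b" and n: "0 < n"
    and H: "\<And>i. i < n \<Longrightarrow> H i \<in> borel_measurable (F (grid s t n i))" "\<And>i. i < n \<Longrightarrow> sq_integrable M (H i)"
    and C: "\<And>i. i < n \<Longrightarrow> expectation (\<lambda>\<omega>. (norm (H i \<omega>))\<^sup>2) \<le> C"
  shows "expectation (\<lambda>\<omega>. (norm (euler s t n H \<omega>))\<^sup>2) \<le> euler_const * ((t - s) * C)"
proof -
  have h: "0 \<le> s" "t - s \<le> L" using st interval by auto
  have "expectation (\<lambda>\<omega>. (norm (euler s t n H \<omega>))\<^sup>2) \<le>
      euler_const * ((t - s) / n * (\<Sum>i<n. expectation (\<lambda>\<omega>. (norm (H i \<omega>))\<^sup>2)))"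
    unfolding euler_const_def by (rule euler_bound[OF h(1) st(2) h(2) n H])
  also have "\<dots> \<le> euler_const * ((t - s) / n * (\<Sum>i<n. C))"
    using euler_const_nonneg st(2) C by (intro mult_left_mono sum_mono) auto
  also have "\<dots> = euler_const * ((t - s) * C)" using n by simp
  finally show ?thesis .
qed

text \<open>Mean-square continuity of order 1/2, the exponent imposed by the noise. The bounds for
  Euler sums are uniform in the mesh and pass to the limit.\<close>

lemma
  assumes "a \<le> s" "s \<le> t" "t \<le> b"
  shows increment_Y_sq_integrable: "sq_integrable M (\<lambda>\<omega>. Y t \<omega> - Y s \<omega>)"
    and increment_Y_bound: "expectation (\<lambda>\<omega>. (norm (Y t \<omega> - Y s \<omega>))\<^sup>2) \<le> euler_const * ((t - s) * moment_cap)"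
proof -
  have mem: "grid s t (Suc m) i \<in> {a..b}" if "i < Suc m" for m i
    using grid_in[OF assms(2), of "Suc m" i] that assms by auto
  have h: "0 \<le> s" "t - s \<le> L" using assms interval by auto
  have "(\<lambda>\<omega>. Y t \<omega> - Y s \<omega>) \<in> borel_measurable M"
    using assms by (intro borel_measurable_diff Y_measurable) auto
  from tendsto_prob_Fatou[OF euler_tendsto[OF assms] this
      euler_sq_integrable[OF h(1) assms(2) h(2) _ Y_adapted[OF mem] Y_sq_integrable[OF mem]]
      euler_bound_uniform[OF assms _ Y_adapted[OF mem] Y_sq_integrable[OF mem] Y_moment_cap[OF mem]]]
  show "sq_integrable M (\<lambda>\<omega>. Y t \<omega> - Y s \<omega>)"
    "expectation (\<lambda>\<omega>. (norm (Y t \<omega> - Y s \<omega>))\<^sup>2) \<le> euler_const * ((t - s) * moment_cap)"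
    by simp_all
qed

definition one_step :: "real \<Rightarrow> real \<Rightarrow> 'a \<Rightarrow> 'e" where
  "one_step s t \<omega> = (t - s) *\<^sub>R f (Y s \<omega>) + (W t \<omega> - W s \<omega>) *\<^sub>R g (Y s \<omega>)"

definition remainder :: "real \<Rightarrow> real \<Rightarrow> 'a \<Rightarrow> 'e" where
  "remainder s t \<omega> = Y t \<omega> - Y s \<omega> - one_step s t \<omega>"

lemma one_step_euler: "one_step s t = euler s t (Suc 0) (\<lambda>_. Y s)"
  by (intro ext) (simp add: one_step_def euler_def grid_def)

lemma euler_diff_start:
  assumes "0 < n"
  shows "euler s t n (\<lambda>i \<omega>. H i \<omega> - Y s \<omega>) \<omega> = euler s t n H \<omega> - one_step s t \<omega>"
proof -
  have "(\<Sum>i<n. W (grid s t n (Suc i)) \<omega> - W (grid s t n i) \<omega>) = W t \<omega> - W s \<omega>"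
    using sum_lessThan_telescope[of "\<lambda>i. W (grid s t n i) \<omega>" n] assms by simp
  moreover have "(\<Sum>i<n. ((t - s) / n) *\<^sub>R f (Y s \<omega>)) = (t - s) *\<^sub>R f (Y s \<omega>)"
    using assms by (simp add: sum_constant_scaleR)
  ultimately show ?thesis
    by (simp add: euler_def one_step_def linear_diff[OF bounded_linear.linear[OF f(1)]]
        linear_diff[OF bounded_linear.linear[OF g(1)]]
        scaleR_diff_right sum_subtractf scaleR_sum_left[symmetric])
qed

text \<open>The norm of the remainder in \<open>L\<^sup>2\<close> is only of order \<open>t - s\<close>, but its martingale part is orthogonal to the past,
  so that its products with \<open>F s\<close>-measurable vectors are of order \<open>(t - s)\<^sup>3\<^sup>/\<^sup>2\<close>.\<close>

lemma
  assumes st: "a \<le> s" "s \<le> t" "t \<le> b"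
  shows one_step_sq_integrable: "sq_integrable M (one_step s t)"
    and one_step_bound: "expectation (\<lambda>\<omega>. (norm (one_step s t \<omega>))\<^sup>2) \<le> euler_const * ((t - s) * moment_cap)"
    and remainder_sq_integrable: "sq_integrable M (remainder s t)"
    and remainder_bound: "expectation (\<lambda>\<omega>. (norm (remainder s t \<omega>))\<^sup>2) \<le> euler_const * ((t - s) * (euler_const * ((t - s) * moment_cap)))"
    and remainder_inner: "\<lbrakk>U \<in> borel_measurable (F s); sq_integrable M U\<rbrakk> \<Longrightarrow>
      \<bar>expectation (\<lambda>\<omega>. U \<omega> \<bullet> remainder s t \<omega>)\<bar> \<le>
        (t - s) * sqrt (t - s) * ((expectation (\<lambda>\<omega>. (norm (U \<omega>))\<^sup>2) + K\<^sup>2 * (euler_const * moment_cap)) / 2)"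
proof -
  have s: "s \<in> {a..b}" "t \<in> {a..b}" using st by auto
  have h: "0 \<le> s" "t - s \<le> L" using st interval by auto
  show one: "sq_integrable M (one_step s t)"
    unfolding one_step_euler
    by (intro euler_sq_integrable h st(2) Y_sq_integrable s) (use Y_adapted[OF s(1)] in auto)
  show "expectation (\<lambda>\<omega>. (norm (one_step s t \<omega>))\<^sup>2) \<le> euler_const * ((t - s) * moment_cap)"
    unfolding one_step_euler
    by (intro euler_bound_uniform st Y_sq_integrable Y_moment_cap s) (use Y_adapted[OF s(1)] in auto)
  let ?p = "\<lambda>m. grid s t (Suc m)"
  let ?H = "\<lambda>m i \<omega>. Y (?p m i) \<omega> - Y s \<omega>"
  have p: "s \<le> ?p m i" "?p m i \<le> t" "?p m i \<in> {a..b}" if "i < Suc m" for m i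
    using grid_in[OF st(2), of "Suc m" i] that st by auto
  have H: "?H m i \<in> borel_measurable (F (?p m i))" "sq_integrable M (?H m i)"
    "expectation (\<lambda>\<omega>. (norm (?H m i \<omega>))\<^sup>2) \<le> euler_const * ((t - s) * moment_cap)" if "i < Suc m" for m i
  proof -
    note pm = p[OF that]
    show "?H m i \<in> borel_measurable (F (?p m i))"
      by (intro borel_measurable_diff Y_adapted pm F_mono[OF pm(1) Y_adapted[OF s(1)]])
    show "sq_integrable M (?H m i)"
      using pm by (intro increment_Y_sq_integrable st) auto
    have "expectation (\<lambda>\<omega>. (norm (?H m i \<omega>))\<^sup>2) \<le> euler_const * ((?p m i - s) * moment_cap)"
      using pm by (intro increment_Y_bound st) auto
    also have "\<dots> \<le> euler_const * ((t - s) * moment_cap)"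
      using euler_const_nonneg moment_cap_nonneg pm by (intro mult_left_mono mult_right_mono) auto
    finally show "expectation (\<lambda>\<omega>. (norm (?H m i \<omega>))\<^sup>2) \<le> euler_const * ((t - s) * moment_cap)" .
  qed
  have sq: "sq_integrable M (euler s t (Suc m) (?H m))" for m
    by (rule euler_sq_integrable[OF h(1) st(2) h(2) zero_less_Suc H(1,2)])
  have bd: "expectation (\<lambda>\<omega>. (norm (euler s t (Suc m) (?H m) \<omega>))\<^sup>2) \<le> euler_const * ((t - s) * (euler_const * ((t - s) * moment_cap)))" for m
    by (rule euler_bound_uniform[OF st zero_less_Suc H])
  have meas: "remainder s t \<in> borel_measurable M"
    unfolding remainder_def using one
    by (intro borel_measurable_diff Y_measurable s) (simp add: sq_integrable_def)
  have lim: "tendsto_prob M (\<lambda>m. euler s t (Suc m) (?H m)) (remainder s t)"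
  proof (rule tendsto_prob_dominated[OF euler_tendsto[OF st]])
    show "euler s t (Suc m) (\<lambda>i. Y (?p m i)) \<in> borel_measurable M" for m
      by (intro euler_measurable h(1) st(2) Y_measurable p)
    show "(\<lambda>\<omega>. Y t \<omega> - Y s \<omega>) \<in> borel_measurable M"
      by (intro borel_measurable_diff Y_measurable s)
    show "euler s t (Suc m) (?H m) \<in> borel_measurable M" for m
      using sq by (simp add: sq_integrable_def)
    show "AE \<omega> in M. norm (euler s t (Suc m) (?H m) \<omega> - remainder s t \<omega>)
        \<le> norm (euler s t (Suc m) (\<lambda>i. Y (?p m i)) \<omega> - (Y t \<omega> - Y s \<omega>))" for m
      by (simp add: euler_diff_start remainder_def)
  qed (rule meas)
  show "sq_integrable M (remainder s t)"
    "expectation (\<lambda>\<omega>. (norm (remainder s t \<omega>))\<^sup>2) \<le> euler_const * ((t - s) * (euler_const * ((t - s) * moment_cap)))"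
    using tendsto_prob_Fatou[OF lim meas sq bd] by auto
  assume U: "U \<in> borel_measurable (F s)" "sq_integrable M U"
  let ?q = "sqrt (t - s)" and ?EU = "expectation (\<lambda>\<omega>. (norm (U \<omega>))\<^sup>2)"
  have eq: "expectation (\<lambda>\<omega>. U \<omega> \<bullet> euler s t (Suc m) (?H m) \<omega>) =
      (t - s) / Suc m * (\<Sum>i<Suc m. expectation (\<lambda>\<omega>. U \<omega> \<bullet> f (?H m i \<omega>)))" for m
    by (rule euler_inner[OF h(1) st(2) h(2) zero_less_Suc H(1,2) U])
  have "\<bar>expectation (\<lambda>\<omega>. U \<omega> \<bullet> euler s t (Suc m) (?H m) \<omega>)\<bar> \<le> (t - s) * ?q * ((?EU + K\<^sup>2 * (euler_const * moment_cap)) / 2)" for m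
  \<comment> \<open>The weight \<open>sqrt (t - s)\<close> has to be positive. It balances
    \<open>U\<close>, of order one, with the drift of the increments, whose second moment is of
    order \<open>t - s\<close>.\<close>
  proof (cases "s = t")
    case True
    then show ?thesis
      using eq[of m] by simp
  next
    case False
    then have q: "0 < ?q" using st by simp
    have sq_q: "(t - s) / ?q = ?q"
      using q st by (simp add: real_div_sqrt)
    have "\<bar>expectation (\<lambda>\<omega>. U \<omega> \<bullet> f (?H m i \<omega>))\<bar> \<le> ?q * ((?EU + K\<^sup>2 * (euler_const * moment_cap)) / 2)" if "i < Suc m" for i
    proof -
      have "expectation (\<lambda>\<omega>. (norm (f (?H m i \<omega>)))\<^sup>2) \<le> K\<^sup>2 * (euler_const * ((t - s) * moment_cap))"
        by (rule order_trans[OF expectation_norm_linear_squared_le[OF f H(2)[OF that]]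
              mult_left_mono[OF H(3)[OF that]]]) simp
      then have "expectation (\<lambda>\<omega>. (norm (f (?H m i \<omega>)))\<^sup>2) / ?q \<le> K\<^sup>2 * (euler_const * ((t - s) * moment_cap)) / ?q"
        using q by (intro divide_right_mono) auto
      also have "\<dots> = K\<^sup>2 * (euler_const * moment_cap) * ((t - s) / ?q)" by simp
      also have "\<dots> = ?q * (K\<^sup>2 * (euler_const * moment_cap))" unfolding sq_q by simp
      finally have "?q * ?EU + expectation (\<lambda>\<omega>. (norm (f (?H m i \<omega>)))\<^sup>2) / ?q \<le> ?q * (?EU + K\<^sup>2 * (euler_const * moment_cap))"
        by (simp add: distrib_left)
      moreover have "\<bar>expectation (\<lambda>\<omega>. U \<omega> \<bullet> f (?H m i \<omega>))\<bar> \<le>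
          1 / 2 * (?q * ?EU + expectation (\<lambda>\<omega>. (norm (f (?H m i \<omega>)))\<^sup>2) / ?q)"
        using Cauchy_Schwarz_ineq2
        by (intro expectation_bilinear_bound[OF bounded_bilinear_inner U(2)
              sq_integrable_linear[OF f(1) H(2)[OF that]] _ _ q]) auto
      ultimately show ?thesis by simp
    qed
    then have "\<bar>\<Sum>i<Suc m. expectation (\<lambda>\<omega>. U \<omega> \<bullet> f (?H m i \<omega>))\<bar> \<le> (\<Sum>i<Suc m. ?q * ((?EU + K\<^sup>2 * (euler_const * moment_cap)) / 2))"
      by (intro order_trans[OF sum_abs] sum_mono) auto
    then have "(t - s) / Suc m * \<bar>\<Sum>i<Suc m. expectation (\<lambda>\<omega>. U \<omega> \<bullet> f (?H m i \<omega>))\<bar>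
        \<le> (t - s) / Suc m * (Suc m * (?q * ((?EU + K\<^sup>2 * (euler_const * moment_cap)) / 2)))"
      using st by (intro mult_left_mono) (auto simp del: of_nat_Suc)
    also have "\<dots> = (t - s) * ?q * ((?EU + K\<^sup>2 * (euler_const * moment_cap)) / 2)"
      by (simp del: of_nat_Suc)
    finally show ?thesis
      unfolding eq abs_mult using st by (simp del: of_nat_Suc sum.lessThan_Suc)
  qed
  from tendsto_prob_inner_bound[OF lim meas sq bd U(2) this]
  show "\<bar>expectation (\<lambda>\<omega>. U \<omega> \<bullet> remainder s t \<omega>)\<bar> \<le> (t - s) * ?q * ((?EU + K\<^sup>2 * (euler_const * moment_cap)) / 2)" .
qed

text \<open>The infinitesimal generator acting on the quadratic function \<open>\<beta> x x\<close>.
  It is kept as a bilinear form so that it can be applied repeatedly.\<close>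

definition generator :: "('e \<Rightarrow> 'e \<Rightarrow> real) \<Rightarrow> 'e \<Rightarrow> 'e \<Rightarrow> real" where
  "generator \<beta> x y = \<beta> (f x) y + \<beta> x (f y) + \<beta> (g x) (g y)"

definition moment :: "('e \<Rightarrow> 'e \<Rightarrow> real) \<Rightarrow> real \<Rightarrow> real" where
  "moment \<beta> t = expectation (\<lambda>\<omega>. \<beta> (Y t \<omega>) (Y t \<omega>))"

lemma bounded_bilinear_generator:
  assumes "bounded_bilinear \<beta>" shows "bounded_bilinear (generator \<beta>)"
  using bounded_bilinear_plus[OF bounded_bilinear_plus[OF
        bounded_bilinear.comp[OF assms f(1) bounded_linear_ident]
        bounded_bilinear.comp[OF assms bounded_linear_ident f(1)]]
      bounded_bilinear.comp[OF assms g(1) g(1)]]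
  unfolding generator_def[abs_def] by simp

text \<open>Split \<open>Y t\<close> into \<open>Y s\<close>, one Euler step \<open>V\<close> and
  the remainder \<open>R\<close>. The form at \<open>Y s + V\<close> can be computed exactly and
  gives the first-order term plus a drift term in \<open>h\<^sup>2\<close>; all products with
  \<open>R\<close> are of order \<open>h * sqrt h\<close> or smaller.\<close>

lemma moment_expansion:
  assumes \<beta>: "bounded_bilinear \<beta>"
  obtains C where "0 \<le> C" "\<And>s t. \<lbrakk>a \<le> s; s \<le> t; t \<le> b\<rbrakk> \<Longrightarrow>
    \<bar>moment \<beta> t - moment \<beta> s - (t - s) * moment (generator \<beta>) s\<bar> \<le> (t - s) * sqrt (t - s) * C"
proof -
  note \<beta>' = bounded_bilinear.flip[OF \<beta>]
  note [simp] = bounded_bilinear.add_left[OF \<beta>] bounded_bilinear.add_right[OF \<beta>]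
    bounded_bilinear.scaleR_left[OF \<beta>] bounded_bilinear.scaleR_right[OF \<beta>]
  obtain k where k: "0 \<le> k" "\<And>x y. \<bar>\<beta> x y\<bar> \<le> norm x * norm y * k"
    using bounded_bilinear.nonneg_bounded[OF \<beta>] by (auto simp: real_norm_def)
  obtain T where T: "bounded_linear T" "\<And>x y. \<beta> x y = T x \<bullet> y"
    using bounded_bilinear_Riesz[OF \<beta>] by metis
  obtain T' where T': "bounded_linear T'" "\<And>x y. \<beta> y x = T' x \<bullet> y"
    using bounded_bilinear_Riesz[OF \<beta>'] by metis
  obtain kT where kT: "\<And>x. norm (T x) \<le> kT * norm x"
    using bounded_linear.bounded[OF T(1)] by (auto simp: mult.commute)
  obtain kT' where kT': "\<And>x. norm (T' x) \<le> kT' * norm x"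
    using bounded_linear.bounded[OF T'(1)] by (auto simp: mult.commute)
  \<comment> \<open>One constant for each error: \<open>c1\<close> for the square of the drift,
    \<open>c2\<close> and \<open>c3\<close> for \<open>Y s\<close> paired with \<open>R\<close> in
    either order, \<open>c4\<close> for \<open>V\<close> with \<open>R\<close> (used twice),
    \<open>c5\<close> for \<open>R\<close> with itself. The factor \<open>sqrt L\<close> converts
    \<open>h\<^sup>2\<close> into \<open>h * sqrt h\<close>.\<close>
  define c1 where "c1 = k * (K\<^sup>2 * moment_cap)"
  define c2 where "c2 = (kT\<^sup>2 * moment_cap + K\<^sup>2 * (euler_const * moment_cap)) / 2"
  define c3 where "c3 = (kT'\<^sup>2 * moment_cap + K\<^sup>2 * (euler_const * moment_cap)) / 2"
  define c4 where "c4 = k / 2 * (euler_const * moment_cap + euler_const * (euler_const * moment_cap))"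
  define c5 where "c5 = k * (euler_const * (euler_const * moment_cap))"
  define C where "C = sqrt L * c1 + c2 + c3 + c4 + c4 + sqrt L * c5"
  have nn: "0 \<le> c1" "0 \<le> c2" "0 \<le> c3" "0 \<le> c4" "0 \<le> c5"
    using k(1) moment_cap_nonneg euler_const_nonneg by (auto simp: c1_def c2_def c3_def c4_def c5_def)
  have "0 \<le> C" using nn L_nonneg by (simp add: C_def)
  moreover have "\<bar>moment \<beta> t - moment \<beta> s - (t - s) * moment (generator \<beta>) s\<bar> \<le> (t - s) * sqrt (t - s) * C"
    if st: "a \<le> s" "s \<le> t" "t \<le> b" for s t
  proof (cases "s = t")
    case True
    then show ?thesis by simp
  next
    case False
    define h where "h = t - s"
    define q where "q = sqrt h"
    have h: "0 < h" "h \<le> L" using False st interval by (auto simp: h_def)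
    have q: "0 < q" "q * q = h" "h / q = q" "q \<le> sqrt L" using h by (auto simp: q_def real_div_sqrt)
    have s: "s \<in> {a..b}" "t \<in> {a..b}" "0 \<le> s" using st interval by auto
    define V where "V = one_step s t"
    define R where "R = remainder s t"
    have V: "sq_integrable M V" "expectation (\<lambda>\<omega>. (norm (V \<omega>))\<^sup>2) \<le> euler_const * (h * moment_cap)"
      unfolding V_def h_def by (rule one_step_sq_integrable[OF st] one_step_bound[OF st])+
    have R: "sq_integrable M R" "expectation (\<lambda>\<omega>. (norm (R \<omega>))\<^sup>2) \<le> euler_const * (h * (euler_const * (h * moment_cap)))"
      "\<And>U. \<lbrakk>U \<in> borel_measurable (F s); sq_integrable M U\<rbrakk> \<Longrightarrow>
        \<bar>expectation (\<lambda>\<omega>. U \<omega> \<bullet> R \<omega>)\<bar> \<le> h * q * ((expectation (\<lambda>\<omega>. (norm (U \<omega>))\<^sup>2) + K\<^sup>2 * (euler_const * moment_cap)) / 2)"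
      unfolding R_def h_def q_def by (rule remainder_sq_integrable[OF st] remainder_bound[OF st] remainder_inner[OF st]; assumption)+
    have Ys: "Y s \<in> borel_measurable (F s)" "sq_integrable M (Y s)" "expectation (\<lambda>\<omega>. (norm (Y s \<omega>))\<^sup>2) \<le> moment_cap"
      using Y_adapted Y_sq_integrable Y_moment_cap s by auto
    have fY: "(\<lambda>\<omega>. f (Y s \<omega>)) \<in> borel_measurable (F s)" "sq_integrable M (\<lambda>\<omega>. f (Y s \<omega>))"
      using bounded_linear_borel_measurable[OF f(1) Ys(1)] sq_integrable_linear[OF f(1) Ys(2)] .
    have gY: "(\<lambda>\<omega>. g (Y s \<omega>)) \<in> borel_measurable (F s)" "sq_integrable M (\<lambda>\<omega>. g (Y s \<omega>))"
      using bounded_linear_borel_measurable[OF g(1) Ys(1)] sq_integrable_linear[OF g(1) Ys(2)] .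
    \<comment> \<open>\<open>?X\<close> collects everything in \<open>?U\<close> that is known at
      time \<open>s\<close>; the rest is the increment of \<open>W\<close> times a vector known at
      time \<open>s\<close>.\<close>
    let ?X = "\<lambda>\<omega>. Y s \<omega> + h *\<^sub>R f (Y s \<omega>)" and ?U = "\<lambda>\<omega>. Y s \<omega> + V \<omega>"
    have X: "?X \<in> borel_measurable (F s)" "sq_integrable M ?X"
      using Ys fY by (auto intro!: borel_measurable_add borel_measurable_scaleR sq_integrable_add sq_integrable_scaleR)
    have U: "sq_integrable M ?U" by (rule sq_integrable_add[OF Ys(2) V(1)])
    note ib = integrable_bilinear[OF \<beta>]
    have U_eq: "?U \<omega> = ?X \<omega> + (W t \<omega> - W s \<omega>) *\<^sub>R g (Y s \<omega>)" for \<omega>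
      by (simp add: V_def one_step_def h_def add.assoc)
    have "expectation (\<lambda>\<omega>. \<beta> (?U \<omega>) (?U \<omega>)) =
      expectation (\<lambda>\<omega>. \<beta> (?X \<omega>) (?X \<omega>)) + h * expectation (\<lambda>\<omega>. \<beta> (g (Y s \<omega>)) (g (Y s \<omega>)))"
      unfolding U_eq
      using expectation_bilinear_noise[OF subalgebra_F increment_indep X gY increment_measurable
          increment_sq_integrable increment_expectation \<beta>, OF s(3) st(2) s(3) st(2) s(3) st(2) s(3) st(2)]
      by (simp only: increment_variance[OF s(3) st(2)] h_def)
    also have "expectation (\<lambda>\<omega>. \<beta> (?X \<omega>) (?X \<omega>)) = expectation (\<lambda>\<omega>. \<beta> (Y s \<omega>) (Y s \<omega>)
        + h * (\<beta> (f (Y s \<omega>)) (Y s \<omega>) + \<beta> (Y s \<omega>) (f (Y s \<omega>))) + h\<^sup>2 * \<beta> (f (Y s \<omega>)) (f (Y s \<omega>)))"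
      by (intro Bochner_Integration.integral_cong refl) (simp add: algebra_simps power2_eq_square)
    also have "\<dots> = moment \<beta> s + h * (expectation (\<lambda>\<omega>. \<beta> (f (Y s \<omega>)) (Y s \<omega>)) + expectation (\<lambda>\<omega>. \<beta> (Y s \<omega>) (f (Y s \<omega>))))
        + h\<^sup>2 * expectation (\<lambda>\<omega>. \<beta> (f (Y s \<omega>)) (f (Y s \<omega>)))"
      using ib[OF Ys(2) Ys(2)] ib[OF fY(2) Ys(2)] ib[OF Ys(2) fY(2)] ib[OF fY(2) fY(2)]
      by (simp add: moment_def)
    finally have EU: "expectation (\<lambda>\<omega>. \<beta> (?U \<omega>) (?U \<omega>)) =
        moment \<beta> s + h * moment (generator \<beta>) s + h\<^sup>2 * expectation (\<lambda>\<omega>. \<beta> (f (Y s \<omega>)) (f (Y s \<omega>)))"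
      using ib[OF fY(2) Ys(2)] ib[OF Ys(2) fY(2)] ib[OF gY(2) gY(2)]
      by (simp add: moment_def generator_def distrib_left)
    have "moment \<beta> t = expectation (\<lambda>\<omega>. \<beta> (?U \<omega>) (?U \<omega>) + (\<beta> (Y s \<omega>) (R \<omega>) + \<beta> (R \<omega>) (Y s \<omega>)
      + \<beta> (V \<omega>) (R \<omega>) + \<beta> (R \<omega>) (V \<omega>) + \<beta> (R \<omega>) (R \<omega>)))"
      unfolding moment_def
    proof (intro Bochner_Integration.integral_cong refl)
      fix \<omega>
      have "Y t \<omega> = (Y s \<omega> + V \<omega>) + R \<omega>" by (simp add: V_def R_def remainder_def)
      then show "\<beta> (Y t \<omega>) (Y t \<omega>) = \<beta> (?U \<omega>) (?U \<omega>) + (\<beta> (Y s \<omega>) (R \<omega>) + \<beta> (R \<omega>) (Y s \<omega>)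
        + \<beta> (V \<omega>) (R \<omega>) + \<beta> (R \<omega>) (V \<omega>) + \<beta> (R \<omega>) (R \<omega>))"
        by (simp add: algebra_simps)
    qed
    also have "\<dots> = expectation (\<lambda>\<omega>. \<beta> (?U \<omega>) (?U \<omega>)) + (expectation (\<lambda>\<omega>. \<beta> (Y s \<omega>) (R \<omega>))
      + expectation (\<lambda>\<omega>. \<beta> (R \<omega>) (Y s \<omega>)) + expectation (\<lambda>\<omega>. \<beta> (V \<omega>) (R \<omega>))
      + expectation (\<lambda>\<omega>. \<beta> (R \<omega>) (V \<omega>)) + expectation (\<lambda>\<omega>. \<beta> (R \<omega>) (R \<omega>)))"
      using ib[OF U U] ib[OF Ys(2) R(1)] ib[OF R(1) Ys(2)] ib[OF V(1) R(1)] ib[OF R(1) V(1)] ib[OF R(1) R(1)]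
      by (simp del: bounded_bilinear.add_left[OF \<beta>] bounded_bilinear.add_right[OF \<beta>])
    finally have diff: "moment \<beta> t - moment \<beta> s - h * moment (generator \<beta>) s =
      h\<^sup>2 * expectation (\<lambda>\<omega>. \<beta> (f (Y s \<omega>)) (f (Y s \<omega>))) + (expectation (\<lambda>\<omega>. \<beta> (Y s \<omega>) (R \<omega>))
      + expectation (\<lambda>\<omega>. \<beta> (R \<omega>) (Y s \<omega>)) + expectation (\<lambda>\<omega>. \<beta> (V \<omega>) (R \<omega>))
      + expectation (\<lambda>\<omega>. \<beta> (R \<omega>) (V \<omega>)) + expectation (\<lambda>\<omega>. \<beta> (R \<omega>) (R \<omega>)))"
      unfolding EU by simp
    note bb = expectation_bilinear_bound[OF \<beta> _ _ k(2,1)]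
    have h2: "h\<^sup>2 * x \<le> h * q * (sqrt L * x)" if "0 \<le> x" for x
    proof -
      have "h\<^sup>2 * x = h * q * (q * x)" using q(2) by (simp add: power2_eq_square)
      also have "\<dots> \<le> h * q * (sqrt L * x)"
        using h q that by (intro mult_left_mono mult_right_mono) auto
      finally show ?thesis .
    qed
    have hq: "h\<^sup>2 / q = h * q" using q(3) by (simp add: power2_eq_square flip: times_divide_eq_right)
    have b1: "\<bar>h\<^sup>2 * expectation (\<lambda>\<omega>. \<beta> (f (Y s \<omega>)) (f (Y s \<omega>)))\<bar> \<le> h * q * (sqrt L * c1)"
    proof -
      have "expectation (\<lambda>\<omega>. (norm (f (Y s \<omega>)))\<^sup>2) \<le> K\<^sup>2 * moment_cap"
        by (rule order_trans[OF expectation_norm_linear_squared_le[OF f Ys(2)] mult_left_mono[OF Ys(3)]]) simp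
      then have "k * expectation (\<lambda>\<omega>. (norm (f (Y s \<omega>)))\<^sup>2) \<le> c1"
        unfolding c1_def by (rule mult_left_mono) (rule k(1))
      then have "\<bar>expectation (\<lambda>\<omega>. \<beta> (f (Y s \<omega>)) (f (Y s \<omega>)))\<bar> \<le> c1"
        using bb[OF fY(2) fY(2), of 1] by simp
      then have "h\<^sup>2 * \<bar>expectation (\<lambda>\<omega>. \<beta> (f (Y s \<omega>)) (f (Y s \<omega>)))\<bar> \<le> h\<^sup>2 * c1"
        by (intro mult_left_mono) auto
      then show ?thesis using h2[OF nn(1)] by (simp add: abs_mult)
    qed
    \<comment> \<open>By size alone the pairing of \<open>Y s\<close> with \<open>R\<close> would
      only be of order \<open>h\<close>; the gain of \<open>sqrt h\<close> comes from
      \<open>remainder_inner\<close>. For \<open>V\<close>, which is itself of order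
      \<open>sqrt h\<close> in mean square, the weighted square bound is enough.\<close>
    have bR: "\<bar>expectation (\<lambda>\<omega>. S (Y s \<omega>) \<bullet> R \<omega>)\<bar> \<le> h * q * ((kS\<^sup>2 * moment_cap + K\<^sup>2 * (euler_const * moment_cap)) / 2)"
      if S: "bounded_linear S" "\<And>x. norm (S x) \<le> kS * norm x" for S :: "'e \<Rightarrow> 'e" and kS
    proof -
      have "expectation (\<lambda>\<omega>. (norm (S (Y s \<omega>)))\<^sup>2) \<le> kS\<^sup>2 * moment_cap"
        by (rule order_trans[OF expectation_norm_linear_squared_le[OF S Ys(2)] mult_left_mono[OF Ys(3)]]) simp
      then have "h * q * ((expectation (\<lambda>\<omega>. (norm (S (Y s \<omega>)))\<^sup>2) + K\<^sup>2 * (euler_const * moment_cap)) / 2) \<le>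
          h * q * ((kS\<^sup>2 * moment_cap + K\<^sup>2 * (euler_const * moment_cap)) / 2)"
        using h q by (intro mult_left_mono divide_right_mono add_mono order_refl) auto
      with R(3)[OF bounded_linear_borel_measurable[OF S(1) Ys(1)] sq_integrable_linear[OF S(1) Ys(2)]]
      show ?thesis by (rule order_trans)
    qed
    have b2: "\<bar>expectation (\<lambda>\<omega>. \<beta> (Y s \<omega>) (R \<omega>))\<bar> \<le> h * q * c2"
      unfolding T(2) c2_def by (rule bR[OF T(1) kT])
    have b3: "\<bar>expectation (\<lambda>\<omega>. \<beta> (R \<omega>) (Y s \<omega>))\<bar> \<le> h * q * c3"
      unfolding T'(2) c3_def by (rule bR[OF T'(1) kT'])
    have "q * expectation (\<lambda>\<omega>. (norm (V \<omega>))\<^sup>2) + expectation (\<lambda>\<omega>. (norm (R \<omega>))\<^sup>2) / q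
        \<le> q * (euler_const * (h * moment_cap)) + euler_const * (h * (euler_const * (h * moment_cap))) / q"
      using q V(2) R(2) by (intro add_mono mult_left_mono divide_right_mono) auto
    also have "\<dots> = h * q * (euler_const * moment_cap) + (h\<^sup>2 / q) * (euler_const * (euler_const * moment_cap))"
      by (simp add: power2_eq_square)
    also have "\<dots> = h * q * (euler_const * moment_cap + euler_const * (euler_const * moment_cap))"
      unfolding hq by (simp only: distrib_left)
    finally have "k / 2 * (q * expectation (\<lambda>\<omega>. (norm (V \<omega>))\<^sup>2) + expectation (\<lambda>\<omega>. (norm (R \<omega>))\<^sup>2) / q)
        \<le> k / 2 * (h * q * (euler_const * moment_cap + euler_const * (euler_const * moment_cap)))"
      using k(1) by (intro mult_left_mono) auto
    also have "\<dots> = h * q * c4" by (simp add: c4_def)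
    finally have c4: "k / 2 * (q * expectation (\<lambda>\<omega>. (norm (V \<omega>))\<^sup>2) + expectation (\<lambda>\<omega>. (norm (R \<omega>))\<^sup>2) / q) \<le> h * q * c4" .
    have b4: "\<bar>expectation (\<lambda>\<omega>. \<beta> (V \<omega>) (R \<omega>))\<bar> \<le> h * q * c4"
      using bb[OF V(1) R(1) q(1)] c4 by (rule order_trans)
    have "\<bar>\<beta> y x\<bar> \<le> norm x * norm y * k" for x y
      using k(2)[of y x] by (simp add: mult_ac)
    from expectation_bilinear_bound[OF \<beta>' V(1) R(1) this k(1) q(1)]
    have b5: "\<bar>expectation (\<lambda>\<omega>. \<beta> (R \<omega>) (V \<omega>))\<bar> \<le> h * q * c4"
      using c4 by (rule order_trans)
    have b6: "\<bar>expectation (\<lambda>\<omega>. \<beta> (R \<omega>) (R \<omega>))\<bar> \<le> h * q * (sqrt L * c5)"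
    proof -
      have "\<bar>expectation (\<lambda>\<omega>. \<beta> (R \<omega>) (R \<omega>))\<bar> \<le> k * expectation (\<lambda>\<omega>. (norm (R \<omega>))\<^sup>2)"
        using bb[OF R(1) R(1), of 1] by simp
      also have "\<dots> \<le> k * (euler_const * (h * (euler_const * (h * moment_cap))))"
        by (rule mult_left_mono[OF R(2) k(1)])
      also have "\<dots> = h\<^sup>2 * c5" by (simp add: c5_def power2_eq_square)
      also have "\<dots> \<le> h * q * (sqrt L * c5)" by (rule h2[OF nn(5)])
      finally show ?thesis .
    qed
    have "\<bar>moment \<beta> t - moment \<beta> s - h * moment (generator \<beta>) s\<bar> \<le>
      h * q * (sqrt L * c1) + h * q * c2 + h * q * c3 + h * q * c4 + h * q * c4 + h * q * (sqrt L * c5)"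
      unfolding diff using b1 b2 b3 b4 b5 b6 by linarith
    also have "\<dots> = h * q * C" by (simp only: C_def distrib_left)
    finally show ?thesis by (simp only: h_def q_def)
  qed
  ultimately show thesis by (rule that)
qed

lemma moment_bounded:
  assumes "bounded_bilinear \<beta>"
  shows "\<exists>B. \<forall>t\<in>{a..b}. \<bar>moment \<beta> t\<bar> \<le> B"
proof -
  obtain k where k: "0 \<le> k" "\<And>x y. \<bar>\<beta> x y\<bar> \<le> norm x * norm y * k"
    using bounded_bilinear.nonneg_bounded[OF assms] by (auto simp: real_norm_def)
  have "\<bar>moment \<beta> t\<bar> \<le> k * moment_cap" if "t \<in> {a..b}" for t
  proof -
    have "\<bar>moment \<beta> t\<bar> \<le> k * expectation (\<lambda>\<omega>. (norm (Y t \<omega>))\<^sup>2)"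
      using expectation_bilinear_bound[OF assms Y_sq_integrable[OF that] Y_sq_integrable[OF that] k(2,1), of 1]
      by (simp add: moment_def)
    also have "\<dots> \<le> k * moment_cap" by (rule mult_left_mono[OF Y_moment_cap[OF that] k(1)])
    finally show ?thesis .
  qed
  then show ?thesis by blast
qed

text \<open>For a point \<open>y\<close> to the left of \<open>x\<close> the expansion compares the
  difference quotient with the generator moment at \<open>y\<close> instead of \<open>x\<close>. The
  two moments differ by order \<open>h\<close>, by the expansion for
  \<open>generator \<beta>\<close> and boundedness of the iterated generator moment.\<close>

lemma moment_has_derivative:
  assumes \<beta>: "bounded_bilinear \<beta>" and x: "x \<in> {a..b}"
  shows "(moment \<beta> has_real_derivative moment (generator \<beta>) x) (at x within {a..b})"
proof -
  let ?D = "moment (generator \<beta>)"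
  obtain C where C: "0 \<le> C" "\<And>s t. \<lbrakk>a \<le> s; s \<le> t; t \<le> b\<rbrakk> \<Longrightarrow>
      \<bar>moment \<beta> t - moment \<beta> s - (t - s) * ?D s\<bar> \<le> (t - s) * sqrt (t - s) * C"
    using moment_expansion[OF \<beta>] by metis
  note \<beta>' = bounded_bilinear_generator[OF \<beta>]
  obtain C' where C': "0 \<le> C'" "\<And>s t. \<lbrakk>a \<le> s; s \<le> t; t \<le> b\<rbrakk> \<Longrightarrow>
      \<bar>?D t - ?D s - (t - s) * moment (generator (generator \<beta>)) s\<bar> \<le> (t - s) * sqrt (t - s) * C'"
    using moment_expansion[OF \<beta>'] by metis
  obtain B where B: "\<forall>t\<in>{a..b}. \<bar>moment (generator (generator \<beta>)) t\<bar> \<le> B"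
    using moment_bounded[OF bounded_bilinear_generator[OF \<beta>']] by blast
  let ?r = "\<lambda>u. sqrt u * C + u * (B + sqrt u * C')"
  have bound: "\<bar>(moment \<beta> y - moment \<beta> x) / (y - x) - ?D x\<bar> \<le> ?r \<bar>y - x\<bar>"
    if y: "y \<in> {a..b}" "y \<noteq> x" for y
  proof -
    define s t where "s = min x y" and "t = max x y"
    define h where "h = \<bar>y - x\<bar>"
    have st: "a \<le> s" "s \<le> t" "t \<le> b" "t - s = h" "s \<in> {a..b}"
      using x y by (auto simp: s_def t_def h_def)
    have h: "0 < h" using y by (simp add: h_def)
    have slope: "(moment \<beta> y - moment \<beta> x) / (y - x) = (moment \<beta> t - moment \<beta> s) / h"
      using y(2) by (auto simp: s_def t_def h_def min_def max_def abs_if field_simps)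
    have "(moment \<beta> t - moment \<beta> s) / h - ?D s = (moment \<beta> t - moment \<beta> s - h * ?D s) / h"
      using h by (simp add: diff_divide_distrib)
    then have "\<bar>(moment \<beta> t - moment \<beta> s) / h - ?D s\<bar> = \<bar>moment \<beta> t - moment \<beta> s - h * ?D s\<bar> / h"
      by (simp only: abs_divide abs_of_pos[OF h])
    also have "\<dots> \<le> h * sqrt h * C / h"
      using C(2)[OF st(1-3)] h unfolding st(4) by (intro divide_right_mono) auto
    also have "\<dots> = sqrt h * C" using h by simp
    finally have 1: "\<bar>(moment \<beta> t - moment \<beta> s) / h - ?D s\<bar> \<le> sqrt h * C" .
    have "\<bar>?D t - ?D s\<bar> \<le> \<bar>h * moment (generator (generator \<beta>)) s\<bar> + h * sqrt h * C'"
      using C'(2)[OF st(1-3)] unfolding st(4) by linarith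
    also have "\<bar>h * moment (generator (generator \<beta>)) s\<bar> \<le> h * B"
      using bspec[OF B st(5)] h by (simp add: abs_mult)
    finally have 2: "\<bar>?D t - ?D s\<bar> \<le> h * (B + sqrt h * C')"
      by (simp add: distrib_left mult.assoc)
    have "\<bar>?D x - ?D s\<bar> \<le> h * (B + sqrt h * C')"
    proof (cases "x = s")
      case True
      have "0 \<le> B" using bspec[OF B st(5)] by linarith
      then show ?thesis using True h C'(1) by simp
    next
      case False
      then have "x = t" by (auto simp: s_def t_def)
      with 2 show ?thesis by simp
    qed
    with 1 show ?thesis unfolding slope h_def[symmetric] by linarith
  qed
  have "((\<lambda>y. (moment \<beta> y - moment \<beta> x) / (y - x) - ?D x) \<longlongrightarrow> 0) (at x within {a..b})"
  proof (rule Lim_null_comparison)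
    show "\<forall>\<^sub>F y in at x within {a..b}. norm ((moment \<beta> y - moment \<beta> x) / (y - x) - ?D x) \<le> ?r \<bar>y - x\<bar>"
      using bound by (auto simp: eventually_at_filter)
    have "((\<lambda>y. ?r \<bar>y - x\<bar>) \<longlongrightarrow> ?r \<bar>x - x\<bar>) (at x within {a..b})"
      by (intro tendsto_intros)
    then show "((\<lambda>y. ?r \<bar>y - x\<bar>) \<longlongrightarrow> 0) (at x within {a..b})" by simp
  qed
  then show ?thesis
    unfolding has_field_derivative_iff by (rule LIM_zero_cancel)
qed

end

section \<open>Quadratic forms and the Lyapunov operator\<close>

definition lyap :: "real^'n^'n \<Rightarrow> real^'n^'n \<Rightarrow> real^'n^'n \<Rightarrow> real^'n^'n" where
  "lyap A E X = transpose A ** X + X ** A + transpose E ** X ** E"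

lemma inner_transpose_mult: "x \<bullet> (transpose A *v y) = (A *v x) \<bullet> (y :: real^'n)"
  by (simp only: transpose_matrix_vector inner_commute[of x] dot_lmul_matrix inner_commute[of y])

lemma quadratic_congruence: "v \<bullet> ((transpose B ** X ** B) *v v) = (B *v v) \<bullet> (X *v (B *v v))"
  for v :: "real^'n"
  by (simp only: matrix_vector_mul_assoc[symmetric] inner_transpose_mult)

text \<open>The right-hand side is the generator of the quadratic form of \<open>X\<close> for drift
  \<open>A\<close> and noise \<open>E\<close>; this is where the Lyapunov operator meets the
  derivative of moments.\<close>

lemma quadratic_lyap:
  "y \<bullet> (lyap A E X *v y) = (A *v y) \<bullet> (X *v y) + y \<bullet> (X *v (A *v y)) + (E *v y) \<bullet> (X *v (E *v y))"
  unfolding lyap_def matrix_vector_mult_add_rdistrib inner_add_right quadratic_congruence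
  by (simp only: matrix_vector_mul_assoc[symmetric] inner_transpose_mult)

text \<open>Separates the entries of a time-dependent matrix from coordinate products whose moments
  have a known derivative, so that the ordinary product rule applies.\<close>

lemma matrix_form_sum: "x \<bullet> (M *v y) = (\<Sum>i\<in>UNIV. \<Sum>j\<in>UNIV. M $ i $ j * (x $ i * y $ j))"
  for x y :: "real^'n"
  by (simp add: inner_vec_def matrix_vector_mult_def sum_distrib_left mult_ac)

lemma transpose_add: "transpose (X + Y) = transpose X + transpose (Y :: real^'n^'n)"
  by (simp add: transpose_def vec_eq_iff)

lemma transpose_diff: "transpose (X - Y) = transpose X - transpose (Y :: real^'n^'n)"
  by (simp add: transpose_def vec_eq_iff)

lemma transpose_scaleR: "transpose (c *\<^sub>R X) = c *\<^sub>R transpose (X :: real^'n^'n)"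
  by (simp add: transpose_def vec_eq_iff)

lemma bounded_linear_transpose: "bounded_linear (transpose :: real^'n^'n \<Rightarrow> real^'n^'n)"
  by (intro linear_conv_bounded_linear[THEN iffD1] linearI transpose_add transpose_scaleR)

lemma matrix_add_rdistrib: "(X + Y) ** Z = X ** Z + Y ** (Z :: real^'n^'n)"
  by (simp add: matrix_matrix_mult_def vec_eq_iff sum.distrib algebra_simps)

lemma bounded_bilinear_matrix_mult:
  "bounded_bilinear ((**) :: real^'n^'n \<Rightarrow> real^'n^'n \<Rightarrow> real^'n^'n)"
  unfolding bilinear_conv_bounded_bilinear[symmetric] bilinear_def
  by (auto intro!: linearI simp: matrix_add_ldistrib matrix_add_rdistrib)
     (simp_all add: matrix_matrix_mult_def vec_eq_iff sum_distrib_left mult_ac)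

lemma bounded_bilinear_matrix_vector_mult:
  "bounded_bilinear ((*v) :: real^'n^'n \<Rightarrow> real^'n \<Rightarrow> real^'n)"
  unfolding bilinear_conv_bounded_bilinear[symmetric] bilinear_def
  by (auto intro!: linearI simp: matrix_vector_right_distrib matrix_vector_mult_add_rdistrib
      scaleR_matrix_vector_assoc matrix_vector_mult_scaleR)

lemma bounded_linear_lyap: "bounded_linear (lyap A E)"
  unfolding lyap_def[abs_def]
  by (intro bounded_linear_add bounded_linear_compose[OF bounded_bilinear.bounded_linear_left[OF bounded_bilinear_matrix_mult]]
      bounded_bilinear.bounded_linear_right[OF bounded_bilinear_matrix_mult] bounded_linear_ident)

lemma symmetric_lyap: "symmetric_mat X \<Longrightarrow> symmetric_mat (lyap A E X)"
  by (simp add: symmetric_mat_def lyap_def transpose_add matrix_transpose_mul matrix_mul_assoc add.commute)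

lemma symmetric_congruence: "symmetric_mat X \<Longrightarrow> symmetric_mat (transpose B ** X ** B)"
  by (simp add: symmetric_mat_def matrix_transpose_mul matrix_mul_assoc)

lemma symmetric_add: "symmetric_mat X \<Longrightarrow> symmetric_mat Y \<Longrightarrow> symmetric_mat (X + Y)"
  by (simp add: symmetric_mat_def transpose_add)

lemma symmetric_diff: "symmetric_mat X \<Longrightarrow> symmetric_mat Y \<Longrightarrow> symmetric_mat (X - Y)"
  by (simp add: symmetric_mat_def transpose_diff)

lemma symmetric_scaleR: "symmetric_mat X \<Longrightarrow> symmetric_mat (c *\<^sub>R X)"
  by (simp add: symmetric_mat_def transpose_scaleR)

lemma symmetric_zero: "symmetric_mat 0"
  by (simp add: symmetric_mat_def transpose_def vec_eq_iff)

lemma symmetric_mat_1: "symmetric_mat (mat 1)"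
  by (simp add: symmetric_mat_def)

lemma continuous_quadratic:
  fixes S :: "'a::topological_space \<Rightarrow> real^'n^'n"
  assumes "continuous_on U S" "continuous_on U v"
  shows "continuous_on U (\<lambda>x. v x \<bullet> (S x *v v x))"
  by (intro continuous_on_inner assms bounded_bilinear.continuous_on[OF bounded_bilinear_matrix_vector_mult])

lemma quadratic_scaleR: "(c *\<^sub>R v) \<bullet> (X *v (c *\<^sub>R v)) = c\<^sup>2 * (v \<bullet> (X *v v))" for v :: "real^'n"
  by (simp add: matrix_vector_mult_scaleR power2_eq_square)

text \<open>Compactness of \<open>T\<close> times the unit sphere turns strict definiteness into a uniform margin.\<close>

lemma uniformly_pos_def:
  fixes S :: "real \<Rightarrow> real^'n^'n"
  assumes "compact T" "continuous_on T S" "\<And>t. t \<in> T \<Longrightarrow> pos_def (S t)"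
  shows "\<exists>e>0. \<forall>t\<in>T. \<forall>v. e * (norm v)\<^sup>2 \<le> v \<bullet> (S t *v v)"
proof (cases "T = {}")
  case True
  then show ?thesis by (auto intro: exI[of _ 1])
next
  case False
  let ?B = "T \<times> sphere (0 :: real^'n) 1" and ?q = "\<lambda>p. snd p \<bullet> (S (fst p) *v snd p)"
  have "compact ?B" using assms(1) by (intro compact_Times) auto
  moreover have "?B \<noteq> {}" using False by simp
  moreover have "continuous_on ?B ?q"
    by (intro continuous_quadratic continuous_on_snd continuous_on_id
        continuous_on_compose2[OF assms(2)] continuous_on_fst) auto
  ultimately have "\<exists>p\<in>?B. \<forall>r\<in>?B. ?q p \<le> ?q r"
    by (rule continuous_attains_inf)
  then obtain p where p: "p \<in> ?B" "\<And>r. r \<in> ?B \<Longrightarrow> ?q p \<le> ?q r"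
    by blast
  have "snd p \<noteq> 0" using p(1) by auto
  then have "0 < ?q p" using p(1) assms(3) by (auto simp: pos_def_def)
  moreover have "?q p * (norm v)\<^sup>2 \<le> v \<bullet> (S t *v v)" if "t \<in> T" for t v
  proof (cases "v = 0")
    case False
    let ?w = "(1 / norm v) *\<^sub>R v"
    have "?q p \<le> ?w \<bullet> (S t *v ?w)"
      using p(2)[of "(t, ?w)"] that False by simp
    also have "\<dots> = (v \<bullet> (S t *v v)) / (norm v)\<^sup>2"
      unfolding quadratic_scaleR by (simp add: power_divide)
    finally show ?thesis using False by (simp add: pos_le_divide_eq)
  qed simp
  ultimately show ?thesis by blast
qed

text \<open>The exponential series of \<open>t \<Lambda>\<close> applied to \<open>P\<close>.
  Differentiation reduces to real power series by pairing with basis vectors. Summability is stated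
  as well, so that other continuous linear maps can be moved inside the sum.\<close>

lemma linear_ode_solution:
  fixes \<Lambda> :: "'e::euclidean_space \<Rightarrow> 'e" and P :: 'e
  assumes \<Lambda>: "bounded_linear \<Lambda>"
  defines "S \<equiv> \<lambda>t. \<Sum>k. (t ^ k / fact k) *\<^sub>R (\<Lambda> ^^ k) P"
  shows "S 0 = P" "(S has_vector_derivative \<Lambda> (S t)) (at t)"
    and "summable (\<lambda>k. (t ^ k / fact k) *\<^sub>R (\<Lambda> ^^ k) P)"
proof -
  obtain K where K: "0 \<le> K" "\<And>x. norm (\<Lambda> x) \<le> norm x * K"
    using bounded_linear.nonneg_bounded[OF \<Lambda>] by blast
  have pow: "norm ((\<Lambda> ^^ k) P) \<le> K ^ k * norm P" for k
  proof (induction k)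
    case (Suc k)
    have "norm ((\<Lambda> ^^ Suc k) P) \<le> norm ((\<Lambda> ^^ k) P) * K" using K(2) by simp
    also have "\<dots> \<le> K ^ k * norm P * K" by (rule mult_right_mono[OF Suc K(1)])
    finally show ?case by (simp add: mult_ac)
  qed simp
  have sum: "summable (\<lambda>k. (t ^ k / fact k) *\<^sub>R (\<Lambda> ^^ k) P)" for t
  proof (rule summable_comparison_test)
    show "summable (\<lambda>k. norm P * ((\<bar>t\<bar> * K) ^ k / fact k))"
      using summable_exp[of "\<bar>t\<bar> * K"] by (intro summable_mult) (simp add: divide_inverse mult.commute)
    have "norm ((t ^ k / fact k) *\<^sub>R (\<Lambda> ^^ k) P) \<le> norm P * ((\<bar>t\<bar> * K) ^ k / fact k)" for k
      using mult_left_mono[OF pow[of k], of "\<bar>t\<bar> ^ k / fact k"]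
      by (simp add: power_abs power_mult_distrib mult_ac)
    then show "\<exists>N. \<forall>n\<ge>N. norm ((t ^ n / fact n) *\<^sub>R (\<Lambda> ^^ n) P) \<le> norm P * ((\<bar>t\<bar> * K) ^ n / fact n)"
      by blast
  qed
  then show "summable (\<lambda>k. (t ^ k / fact k) *\<^sub>R (\<Lambda> ^^ k) P)" .
  have "S 0 = (\<Sum>k. if k = 0 then P else 0)"
    unfolding S_def by (intro suminf_cong) simp
  also have "\<dots> = P" by (rule sums_unique[OF sums_single, symmetric])
  finally show "S 0 = P" .
  have comp: "((\<lambda>t. S t \<bullet> b) has_real_derivative \<Lambda> (S t) \<bullet> b) (at t)" for b t
  proof -
    let ?c = "\<lambda>k. ((\<Lambda> ^^ k) P \<bullet> b) / fact k"
    have sums: "(\<lambda>k. ?c k * t ^ k) sums (S t \<bullet> b)" for t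
    proof -
      have "(\<lambda>k. ((t ^ k / fact k) *\<^sub>R (\<Lambda> ^^ k) P) \<bullet> b) sums (S t \<bullet> b)"
        unfolding S_def by (rule bounded_linear.sums[OF bounded_linear_inner_left summable_sums[OF sum]])
      then show ?thesis by (simp add: mult.commute)
    qed
    have "((\<lambda>t. \<Sum>k. ?c k * t ^ k) has_real_derivative (\<Sum>k. diffs ?c k * t ^ k)) (at t)"
      using sums by (intro termdiffs_strong_converges_everywhere) (rule sums_summable)
    also have "(\<lambda>t. \<Sum>k. ?c k * t ^ k) = (\<lambda>t. S t \<bullet> b)"
      using sums by (intro ext sums_unique[symmetric])
    also have "(\<Sum>k. diffs ?c k * t ^ k) = \<Lambda> (S t) \<bullet> b"
    proof (rule sums_unique[symmetric])
      have "(\<lambda>k. \<Lambda> ((t ^ k / fact k) *\<^sub>R (\<Lambda> ^^ k) P) \<bullet> b) sums (\<Lambda> (S t) \<bullet> b)"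
        unfolding S_def
        by (rule bounded_linear.sums[OF bounded_linear_inner_left bounded_linear.sums[OF \<Lambda> summable_sums[OF sum]]])
      moreover have "\<Lambda> ((t ^ k / fact k) *\<^sub>R (\<Lambda> ^^ k) P) \<bullet> b = diffs ?c k * t ^ k" for k
      proof -
        have "diffs ?c k = ((\<Lambda> ^^ Suc k) P \<bullet> b) / fact k"
          unfolding diffs_def fact_Suc by (simp del: of_nat_Suc)
        then show ?thesis
          by (simp add: linear_cmul[OF bounded_linear.linear[OF \<Lambda>]])
      qed
      ultimately show "(\<lambda>k. diffs ?c k * t ^ k) sums (\<Lambda> (S t) \<bullet> b)" by simp
    qed
    finally show ?thesis .
  qed
  have "(S has_derivative (\<lambda>h. h *\<^sub>R \<Lambda> (S t))) (at t)"
    using comp unfolding has_derivative_componentwise_within[of S]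
    by (simp add: has_field_derivative_def mult.commute[of _ "_ \<bullet> _"] mult_commute_abs)
  then show "(S has_vector_derivative \<Lambda> (S t)) (at t)"
    by (simp add: has_vector_derivative_def)
qed

text \<open>Each term of the series is symmetric because \<open>lyap\<close> preserves symmetry, and
  transposition commutes with the sum.\<close>

lemma lyapunov_ode:
  assumes "symmetric_mat P"
  shows "\<exists>S. S 0 = P \<and> (\<forall>t. (S has_vector_derivative lyap A E (S t)) (at t)) \<and> (\<forall>t. symmetric_mat (S t))"
proof -
  let ?S = "\<lambda>t. \<Sum>k. (t ^ k / fact k) *\<^sub>R (lyap A E ^^ k) P"
  note sol = linear_ode_solution[OF bounded_linear_lyap[of A E], where P = P]
  have "symmetric_mat ((lyap A E ^^ k) P)" for k
    using assms by (induction k) (auto intro: symmetric_lyap)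
  then have "transpose (?S t) = ?S t" for t
    unfolding bounded_linear.suminf[OF bounded_linear_transpose sol(3)]
    by (simp add: transpose_scaleR symmetric_mat_def)
  then show ?thesis
    using sol(1,2) by (intro exI[of _ ?S]) (simp add: symmetric_mat_def)
qed

section \<open>Lyapunov functions along solutions\<close>

context linear_sde
begin

text \<open>\<open>\<psi>\<close> lets one statement cover two cases: the identity for the state,
  and multiplication by a fixed vector for the matrix-valued fundamental solution. Since
  \<open>S\<close> is evaluated at \<open>b - s\<close>, its derivative enters with a minus sign,
  which produces exactly the left-hand side of the differential inequality.\<close>

lemma
  fixes A E :: "real^'n^'n" and \<psi> :: "'e \<Rightarrow> real^'n"
  assumes \<psi>: "bounded_linear \<psi>" "\<And>x. \<psi> (f x) = A *v \<psi> x" "\<And>x. \<psi> (g x) = E *v \<psi> x"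
    and S: "\<And>u. u \<in> {0..b - a} \<Longrightarrow> (S has_vector_derivative S' u) (at u within {0..b - a})"
    and S': "\<And>u. u \<in> {0..b - a} \<Longrightarrow> - S' u + lyap A E (S u) \<preceq>\<^sub>S 0"
  shows lyapunov_decreasing: "expectation (\<lambda>\<omega>. \<psi> (Y b \<omega>) \<bullet> (S 0 *v \<psi> (Y b \<omega>)))
      \<le> expectation (\<lambda>\<omega>. \<psi> (Y a \<omega>) \<bullet> (S (b - a) *v \<psi> (Y a \<omega>)))"
proof (cases "a = b")
  case True
  then show ?thesis by simp
next
  case False
  then have ab: "a < b" using interval by simp
  let ?\<beta> = "\<lambda>i j x y. \<psi> x $ i * \<psi> y $ j"
  have \<beta>: "bounded_bilinear (?\<beta> i j)" for i j
    by (intro bounded_bilinear.comp[OF bounded_bilinear_mult] bounded_linear_compose[OF bounded_linear_vec_nth \<psi>(1)])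
  have form: "expectation (\<lambda>\<omega>. \<psi> (p (Y s \<omega>)) \<bullet> (Q *v \<psi> (q (Y s \<omega>)))) =
      (\<Sum>i\<in>UNIV. \<Sum>j\<in>UNIV. Q $ i $ j * expectation (\<lambda>\<omega>. ?\<beta> i j (p (Y s \<omega>)) (q (Y s \<omega>))))"
    if "s \<in> {a..b}" "bounded_linear p" "bounded_linear q" for p q Q s
  proof -
    have "integrable M (\<lambda>\<omega>. ?\<beta> i j (p (Y s \<omega>)) (q (Y s \<omega>)))" for i j
      by (rule integrable_bilinear[OF \<beta> sq_integrable_linear[OF that(2) Y_sq_integrable[OF that(1)]]
            sq_integrable_linear[OF that(3) Y_sq_integrable[OF that(1)]]])
    then show ?thesis
      unfolding matrix_form_sum by (simp add: Bochner_Integration.integral_sum)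
  qed
  have int: "integrable M (\<lambda>\<omega>. \<psi> (p (Y s \<omega>)) \<bullet> (Q *v \<psi> (q (Y s \<omega>))))"
    if "s \<in> {a..b}" "bounded_linear p" "bounded_linear q" for p q Q s
    by (rule integrable_inner_sq[OF sq_integrable_linear[OF \<psi>(1) sq_integrable_linear[OF that(2) Y_sq_integrable[OF that(1)]]]
          sq_integrable_linear[OF matrix_vector_mul_bounded_linear
            sq_integrable_linear[OF \<psi>(1) sq_integrable_linear[OF that(3) Y_sq_integrable[OF that(1)]]]]])
  \<comment> \<open>Only moments of the fixed forms \<open>?\<beta> i j\<close> are differentiated;
    all further time dependence sits in scalar coefficients.\<close>
  define \<phi> where "\<phi> s = (\<Sum>i\<in>UNIV. \<Sum>j\<in>UNIV. S (b - s) $ i $ j * moment (?\<beta> i j) s)" for s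
  define \<phi>' where "\<phi>' s = (\<Sum>i\<in>UNIV. \<Sum>j\<in>UNIV. - (S' (b - s) $ i $ j) * moment (?\<beta> i j) s
    + S (b - s) $ i $ j * moment (generator (?\<beta> i j)) s)" for s
  have "\<phi> s = expectation (\<lambda>\<omega>. \<psi> (Y s \<omega>) \<bullet> (S (b - s) *v \<psi> (Y s \<omega>)))" if "s \<in> {a..b}" for s
    using form[OF that, of "\<lambda>x. x" "\<lambda>x. x"] by (simp add: \<phi>_def moment_def)
  moreover have "\<phi> b \<le> \<phi> a"
  proof -
    have deriv: "(\<phi> has_real_derivative \<phi>' s) (at s within {a..b})" if s: "s \<in> {a..b}" for s
    proof -
      have img: "(\<lambda>s. b - s) ` {a..b} = {0..b - a}" by simp
      have "((S \<circ> (\<lambda>s. b - s)) has_vector_derivative (- 1) *\<^sub>R S' (b - s)) (at s within {a..b})"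
      proof (rule vector_diff_chain_within)
        show "((\<lambda>s. b - s) has_vector_derivative - 1) (at s within {a..b})"
          by (auto intro!: derivative_eq_intros)
        show "(S has_vector_derivative S' (b - s)) (at (b - s) within (\<lambda>s. b - s) ` {a..b})"
          unfolding img using s by (intro S) auto
      qed
      from bounded_linear.has_vector_derivative[OF bounded_linear_vec_nth bounded_linear.has_vector_derivative[OF bounded_linear_vec_nth this]]
      have dS: "((\<lambda>s. S (b - s) $ i $ j) has_real_derivative - (S' (b - s) $ i $ j)) (at s within {a..b})" for i j
        by (simp add: o_def has_real_derivative_iff_has_vector_derivative)
      have "((\<lambda>s. S (b - s) $ i $ j * moment (?\<beta> i j) s) has_real_derivative
          - (S' (b - s) $ i $ j) * moment (?\<beta> i j) s + S (b - s) $ i $ j * moment (generator (?\<beta> i j)) s)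
          (at s within {a..b})" for i j
        using DERIV_mult[OF dS[of i j] moment_has_derivative[OF \<beta>[of i j] s]]
        by (simp only: mult.commute[of "moment (generator (?\<beta> i j)) s"])
      then show ?thesis
        unfolding \<phi>_def \<phi>'_def by (intro DERIV_sum)
    qed
    have neg: "\<phi>' s \<le> 0" if s: "s \<in> {a..b}" for s
    proof -
      let ?S = "S (b - s)" and ?S' = "S' (b - s)"
      have gen: "moment (generator (?\<beta> i j)) s = expectation (\<lambda>\<omega>. ?\<beta> i j (f (Y s \<omega>)) (Y s \<omega>))
          + expectation (\<lambda>\<omega>. ?\<beta> i j (Y s \<omega>) (f (Y s \<omega>))) + expectation (\<lambda>\<omega>. ?\<beta> i j (g (Y s \<omega>)) (g (Y s \<omega>)))" for i j
        unfolding moment_def generator_def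
        using integrable_bilinear[OF \<beta> sq_integrable_linear[OF f(1) Y_sq_integrable[OF s]] Y_sq_integrable[OF s], of i j]
          integrable_bilinear[OF \<beta> Y_sq_integrable[OF s] sq_integrable_linear[OF f(1) Y_sq_integrable[OF s]], of i j]
          integrable_bilinear[OF \<beta> sq_integrable_linear[OF g(1) Y_sq_integrable[OF s]]
            sq_integrable_linear[OF g(1) Y_sq_integrable[OF s]], of i j]
        by simp
      have "\<phi>' s = expectation (\<lambda>\<omega>. \<psi> (Y s \<omega>) \<bullet> ((- ?S') *v \<psi> (Y s \<omega>)))
          + (expectation (\<lambda>\<omega>. \<psi> (f (Y s \<omega>)) \<bullet> (?S *v \<psi> (Y s \<omega>)))
          + expectation (\<lambda>\<omega>. \<psi> (Y s \<omega>) \<bullet> (?S *v \<psi> (f (Y s \<omega>))))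
          + expectation (\<lambda>\<omega>. \<psi> (g (Y s \<omega>)) \<bullet> (?S *v \<psi> (g (Y s \<omega>)))))"
        using form[OF s bounded_linear_ident bounded_linear_ident] form[OF s f(1) bounded_linear_ident]
          form[OF s bounded_linear_ident f(1)] form[OF s g(1) g(1)]
        unfolding \<phi>'_def gen by (simp add: moment_def sum.distrib distrib_left sum_negf sum_subtractf)
      also have "\<dots> = expectation (\<lambda>\<omega>. \<psi> (Y s \<omega>) \<bullet> ((- ?S') *v \<psi> (Y s \<omega>))
          + (\<psi> (f (Y s \<omega>)) \<bullet> (?S *v \<psi> (Y s \<omega>)) + \<psi> (Y s \<omega>) \<bullet> (?S *v \<psi> (f (Y s \<omega>)))
          + \<psi> (g (Y s \<omega>)) \<bullet> (?S *v \<psi> (g (Y s \<omega>)))))"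
        using int[OF s bounded_linear_ident bounded_linear_ident, of "- ?S'"] int[OF s f(1) bounded_linear_ident]
          int[OF s bounded_linear_ident f(1)] int[OF s g(1) g(1)] by simp
      also have "\<dots> = expectation (\<lambda>\<omega>. \<psi> (Y s \<omega>) \<bullet> ((- ?S' + lyap A E ?S) *v \<psi> (Y s \<omega>)))"
        by (simp only: \<psi>(2,3) matrix_vector_mult_add_rdistrib inner_add_right quadratic_lyap)
      also have "\<dots> \<le> 0"
      proof -
        have "\<psi> (Y s \<omega>) \<bullet> ((- ?S' + lyap A E ?S) *v \<psi> (Y s \<omega>)) \<le> 0" for \<omega>
        proof -
          have "0 \<le> \<psi> (Y s \<omega>) \<bullet> ((0 - (- ?S' + lyap A E ?S)) *v \<psi> (Y s \<omega>))"
            using S'[of "b - s"] s unfolding loewner_le_def pos_semidef_def by auto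
          then show ?thesis by (simp only: matrix_vector_mult_diff_rdistrib inner_diff_right) simp
        qed
        then have "0 \<le> expectation (\<lambda>\<omega>. - (\<psi> (Y s \<omega>) \<bullet> ((- ?S' + lyap A E ?S) *v \<psi> (Y s \<omega>))))"
          by (intro integral_nonneg_AE AE_I2) simp
        then show ?thesis by simp
      qed
      finally show ?thesis .
    qed
    show "\<phi> b \<le> \<phi> a"
    proof (rule DERIV_nonpos_imp_decreasing_open[of a b \<phi>])
      show "\<exists>y. DERIV \<phi> s :> y \<and> y \<le> 0" if "a < s" "s < b" for s
        using deriv[of s] neg[of s] that by (auto simp: at_within_Icc_at)
      show "continuous_on {a..b} \<phi>"
        using deriv by (rule DERIV_continuous_on)
    qed (use ab in simp)
  qed
  ultimately show ?thesis using interval(2) by simp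
qed

end

section \<open>The fundamental solution and the equivalence of the two conditions\<close>

lemma bounded_linear_common_bound:
  fixes f g :: "'a::real_normed_vector \<Rightarrow> 'b::real_normed_vector"
  assumes "bounded_linear f" "bounded_linear g"
  shows "\<exists>K. (\<forall>x. norm (f x) \<le> K * norm x) \<and> (\<forall>x. norm (g x) \<le> K * norm x)"
proof -
  obtain K1 K2 where K: "\<And>x. norm (f x) \<le> norm x * K1" "\<And>x. norm (g x) \<le> norm x * K2"
    using bounded_linear.bounded[OF assms(1)] bounded_linear.bounded[OF assms(2)] by metis
  have "norm (f x) \<le> max K1 K2 * norm x" "norm (g x) \<le> max K1 K2 * norm x" for x
    using order_trans[OF K(1)[of x] mult_left_mono[of K1 "max K1 K2" "norm x"]]
      order_trans[OF K(2)[of x] mult_left_mono[of K2 "max K1 K2" "norm x"]]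
    by (simp_all add: mult.commute)
  then show ?thesis by blast
qed

lemma (in prob_space) sq_integrable_AE_const:
  assumes "X \<in> borel_measurable M" "AE \<omega> in M. X \<omega> = c"
  shows "sq_integrable M X"
proof (rule sq_integrable_bound[of M "\<lambda>_. c" X 1])
  show "sq_integrable M (\<lambda>_. c)" by (simp add: sq_integrable_def)
  show "AE \<omega> in M. norm (X \<omega>) \<le> 1 * norm c" using assms(2) by eventually_elim simp
qed (rule assms)

text \<open>For fixed \<open>v\<close> the process \<open>\<Phi> s \<omega> *v v\<close> obeys the
  vector equation started from \<open>v\<close>, so \<open>\<psi>\<close> is evaluation at
  \<open>v\<close>. The initial matrix is almost surely constant, hence square integrable.\<close>

lemma
  fixes \<Phi> :: "real \<Rightarrow> 'w \<Rightarrow> real^'n^'n"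
  assumes "prob_space M" "wiener_process M W" "fundamental_solution M W A Ec \<Phi>" "0 \<le> \<theta>"
  shows fundamental_sq_integrable: "sq_integrable M (\<Phi> \<theta>)"
    and fundamental_lyapunov:
      "\<lbrakk>\<And>u. u \<in> {0..\<theta>} \<Longrightarrow> (S has_vector_derivative S' u) (at u within {0..\<theta>});
        \<And>u. u \<in> {0..\<theta>} \<Longrightarrow> - S' u + lyap A Ec (S u) \<preceq>\<^sub>S 0\<rbrakk> \<Longrightarrow>
      (\<integral>\<omega>. (\<Phi> \<theta> \<omega> *v v) \<bullet> (S 0 *v (\<Phi> \<theta> \<omega> *v v)) \<partial>M) \<le> v \<bullet> (S \<theta> *v v)"
proof -
  interpret prob_space M by fact
  obtain F where sol: "wiener_filtration M W F" "AE \<omega> in M. \<Phi> 0 \<omega> = mat 1"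
    "solves_sde M W F (\<lambda>X. A ** X) (\<lambda>X. Ec ** X) 0 \<theta> \<Phi>"
    using assms(3,4) unfolding fundamental_solution_def by blast
  note left = bounded_bilinear.bounded_linear_right[OF bounded_bilinear_matrix_mult]
  obtain K where K: "\<And>X :: real^'n^'n. norm (A ** X) \<le> K * norm X"
    "\<And>X :: real^'n^'n. norm (Ec ** X) \<le> K * norm X"
    using bounded_linear_common_bound[OF left[of A] left[of Ec]] by blast
  have "wiener_noise M W F" by unfold_locales (fact assms(2) sol(1))+
  then interpret wiener_noise M W F .
  have "\<Phi> 0 \<in> borel_measurable (F 0)" using sol(3) assms(4) by (simp add: solves_sde_def)
  then have "\<Phi> 0 \<in> borel_measurable M" by (rule measurable_from_subalg[OF subalgebra_F])
  then have init: "sq_integrable M (\<Phi> 0)" by (rule sq_integrable_AE_const) (rule sol(2))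
  interpret linear_sde M W F "\<lambda>X. A ** X" "\<lambda>X. Ec ** X" K \<theta> 0 \<theta> \<Phi>
    by (rule linear_sde.intro[OF wiener_noise_axioms
          linear_sde_axioms.intro[OF sol(3) left K(1) left K(2) order_refl assms(4) _ init]]) simp
  show "sq_integrable M (\<Phi> \<theta>)" using assms(4) by (intro Y_sq_integrable) simp
  assume S: "\<And>u. u \<in> {0..\<theta>} \<Longrightarrow> (S has_vector_derivative S' u) (at u within {0..\<theta>})"
    "\<And>u. u \<in> {0..\<theta>} \<Longrightarrow> - S' u + lyap A Ec (S u) \<preceq>\<^sub>S 0"
  have "expectation (\<lambda>\<omega>. (\<Phi> \<theta> \<omega> *v v) \<bullet> (S 0 *v (\<Phi> \<theta> \<omega> *v v)))
      \<le> expectation (\<lambda>\<omega>. (\<Phi> 0 \<omega> *v v) \<bullet> (S (\<theta> - 0) *v (\<Phi> 0 \<omega> *v v)))"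
    using S by (intro lyapunov_decreasing[where A = A and E = Ec and S' = S']
        bounded_bilinear.bounded_linear_left[OF bounded_bilinear_matrix_vector_mult])
      (simp_all add: matrix_vector_mul_assoc)
  also have "\<dots> = expectation (\<lambda>\<omega>. v \<bullet> (S \<theta> *v v))"
    using sol(2) init
    by (intro integral_cong_AE) (auto elim!: eventually_mono intro!: borel_measurable_inner
        bounded_linear_borel_measurable[OF matrix_vector_mul_bounded_linear]
        bounded_linear_borel_measurable[OF bounded_bilinear.bounded_linear_left[OF bounded_bilinear_matrix_vector_mult]]
        simp: sq_integrable_def)
  also have "\<dots> = v \<bullet> (S \<theta> *v v)" by (simp add: prob_space)
  finally show "expectation (\<lambda>\<omega>. (\<Phi> \<theta> \<omega> *v v) \<bullet> (S 0 *v (\<Phi> \<theta> \<omega> *v v))) \<le> v \<bullet> (S \<theta> *v v)" .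
qed

text \<open>A Bochner integral is 0 by default when the integrand is not integrable, so the matrix
  expectation is meaningful only once \<open>Xi\<close> is known to be integrable; this follows from
  square integrability of \<open>\<Phi> \<theta>\<close>. Evaluating the quadratic form and
  transposing are then bounded linear maps that pass through the integral.\<close>

lemma
  fixes \<Phi> :: "real \<Rightarrow> 'w \<Rightarrow> real^'n^'n" and J Ed P :: "real^'n^'n"
  assumes "sq_integrable M (\<Phi> \<theta>)"
  defines "Q \<equiv> \<integral>\<omega>. transpose J ** Xi \<Phi> P \<theta> \<omega> ** J + transpose Ed ** Xi \<Phi> P \<theta> \<omega> ** Ed \<partial>M"
  shows expected_jump_quadratic: "v \<bullet> (Q *v v) =
      (\<integral>\<omega>. (\<Phi> \<theta> \<omega> *v (J *v v)) \<bullet> (P *v (\<Phi> \<theta> \<omega> *v (J *v v))) \<partial>M) +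
      (\<integral>\<omega>. (\<Phi> \<theta> \<omega> *v (Ed *v v)) \<bullet> (P *v (\<Phi> \<theta> \<omega> *v (Ed *v v))) \<partial>M)"
    and expected_jump_symmetric: "symmetric_mat P \<Longrightarrow> symmetric_mat Q"
proof -
  note left = bounded_bilinear.bounded_linear_right[OF bounded_bilinear_matrix_mult]
  note right = bounded_bilinear.bounded_linear_left[OF bounded_bilinear_matrix_mult]
  from integrable_bilinear[OF bounded_bilinear.comp[OF bounded_bilinear_matrix_mult
        bounded_linear_compose[OF right bounded_linear_transpose] bounded_linear_ident] assms(1,1), of P]
  have Xi: "integrable M (\<lambda>\<omega>. Xi \<Phi> P \<theta> \<omega>)" by (simp add: Xi_def)
  have cong: "integrable M (\<lambda>\<omega>. transpose B ** Xi \<Phi> P \<theta> \<omega> ** B)" for B :: "real^'n^'n"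
    using integrable_bounded_linear[OF bounded_linear_compose[OF right[of B] left[of "transpose B"]] Xi] .
  note int = Bochner_Integration.integrable_add[OF cong[of J] cong[of Ed]]
  have quad: "bounded_linear (\<lambda>X. v \<bullet> (X *v v))" for v :: "real^'n"
    by (rule bounded_linear_compose[OF bounded_linear_inner_right
          bounded_bilinear.bounded_linear_left[OF bounded_bilinear_matrix_vector_mult]])
  have Xi_quad: "v \<bullet> ((transpose B ** Xi \<Phi> P \<theta> \<omega> ** B) *v v) =
      (\<Phi> \<theta> \<omega> *v (B *v v)) \<bullet> (P *v (\<Phi> \<theta> \<omega> *v (B *v v)))" for v \<omega> and B :: "real^'n^'n"
    unfolding quadratic_congruence Xi_def ..
  have int_quad: "integrable M (\<lambda>\<omega>. (\<Phi> \<theta> \<omega> *v (B *v v)) \<bullet> (P *v (\<Phi> \<theta> \<omega> *v (B *v v))))" for B :: "real^'n^'n"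
    using integrable_bounded_linear[OF quad cong, of v B] by (simp only: Xi_quad)
  have "v \<bullet> (Q *v v) = (\<integral>\<omega>. v \<bullet> ((transpose J ** Xi \<Phi> P \<theta> \<omega> ** J + transpose Ed ** Xi \<Phi> P \<theta> \<omega> ** Ed) *v v) \<partial>M)"
    unfolding Q_def by (rule integral_bounded_linear[OF quad int, symmetric])
  also have "\<dots> = (\<integral>\<omega>. (\<Phi> \<theta> \<omega> *v (J *v v)) \<bullet> (P *v (\<Phi> \<theta> \<omega> *v (J *v v)))
      + (\<Phi> \<theta> \<omega> *v (Ed *v v)) \<bullet> (P *v (\<Phi> \<theta> \<omega> *v (Ed *v v))) \<partial>M)"
    by (simp only: matrix_vector_mult_add_rdistrib inner_add_right Xi_quad)
  also have "\<dots> = (\<integral>\<omega>. (\<Phi> \<theta> \<omega> *v (J *v v)) \<bullet> (P *v (\<Phi> \<theta> \<omega> *v (J *v v))) \<partial>M) +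
      (\<integral>\<omega>. (\<Phi> \<theta> \<omega> *v (Ed *v v)) \<bullet> (P *v (\<Phi> \<theta> \<omega> *v (Ed *v v))) \<partial>M)"
    by (rule Bochner_Integration.integral_add[OF int_quad int_quad])
  finally show "v \<bullet> (Q *v v) = (\<integral>\<omega>. (\<Phi> \<theta> \<omega> *v (J *v v)) \<bullet> (P *v (\<Phi> \<theta> \<omega> *v (J *v v))) \<partial>M) +
      (\<integral>\<omega>. (\<Phi> \<theta> \<omega> *v (Ed *v v)) \<bullet> (P *v (\<Phi> \<theta> \<omega> *v (Ed *v v))) \<partial>M)" .
  assume P: "symmetric_mat P"
  have "symmetric_mat (transpose J ** Xi \<Phi> P \<theta> \<omega> ** J + transpose Ed ** Xi \<Phi> P \<theta> \<omega> ** Ed)" for \<omega>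
    unfolding Xi_def by (intro symmetric_add symmetric_congruence P)
  then show "symmetric_mat Q"
    using integral_bounded_linear[OF bounded_linear_transpose int] by (simp add: symmetric_mat_def Q_def)
qed

lemma moment_imp_clock:
  fixes \<Phi> :: "real \<Rightarrow> 'w \<Rightarrow> real^'n^'n"
  assumes T: "0 < Tmin" "Tmin \<le> Tmax"
    and M: "prob_space M" "wiener_process M W" "fundamental_solution M W A Ec \<Phi>"
    and "moment_condition M \<Phi> J Ed Tmin Tmax"
  shows "clock_condition A Ec J Ed Tmin Tmax"
proof -
  define Q where "Q P \<theta> = (\<integral>\<omega>. transpose J ** Xi \<Phi> P \<theta> \<omega> ** J + transpose Ed ** Xi \<Phi> P \<theta> \<omega> ** Ed \<partial>M)" for P \<theta>
  obtain P where P: "pos_def P" "\<And>\<theta>. \<theta> \<in> {Tmin..Tmax} \<Longrightarrow> pos_def (0 - (Q P \<theta> - P))"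
    using assms(6) unfolding moment_condition_def loewner_less_def Q_def by blast
  then have symP: "symmetric_mat P" by (simp add: pos_def_def)
  from lyapunov_ode[OF symP, of A Ec] obtain S where
    "S 0 = P \<and> (\<forall>t. (S has_vector_derivative lyap A Ec (S t)) (at t)) \<and> (\<forall>t. symmetric_mat (S t))" ..
  then have S: "S 0 = P" "(S has_vector_derivative lyap A Ec (S t)) (at t)" "symmetric_mat (S t)" for t
    by simp_all
  \<comment> \<open>With equality in the Lyapunov equation, \<open>- S\<close> satisfies the
    differential inequality too, and the comparison for \<open>- S\<close> is the reverse of the one
    for \<open>S\<close>.\<close>
  have lower: "v \<bullet> (S \<theta> *v v) \<le> (\<integral>\<omega>. (\<Phi> \<theta> \<omega> *v v) \<bullet> (P *v (\<Phi> \<theta> \<omega> *v v)) \<partial>M)" if "0 \<le> \<theta>" for \<theta> v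
  proof -
    have "(\<integral>\<omega>. (\<Phi> \<theta> \<omega> *v v) \<bullet> (- S 0 *v (\<Phi> \<theta> \<omega> *v v)) \<partial>M) \<le> v \<bullet> (- S \<theta> *v v)"
    proof (rule fundamental_lyapunov[OF M that, where S = "\<lambda>u. - S u" and S' = "\<lambda>u. - lyap A Ec (S u)"])
      show "((\<lambda>u. - S u) has_vector_derivative - lyap A Ec (S u)) (at u within {0..\<theta>})" for u
        by (rule has_vector_derivative_minus[OF has_vector_derivative_at_within[OF S(2)]])
      have "lyap A Ec (- S u) = - lyap A Ec (S u)" for u
        by (rule linear_neg[OF bounded_linear.linear[OF bounded_linear_lyap]])
      then show "- (- lyap A Ec (S u)) + lyap A Ec (- S u) \<preceq>\<^sub>S 0" for u
        by (simp add: loewner_le_def pos_semidef_def symmetric_zero)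
    qed
    moreover have "- X *v y = - (X *v y)" for X :: "real^'n^'n" and y
      using linear_neg[OF bounded_linear.linear[OF bounded_bilinear.bounded_linear_left[OF bounded_bilinear_matrix_vector_mult]]] .
    ultimately show ?thesis by (simp add: S(1))
  qed
  let ?D = "\<lambda>\<theta>. S 0 - (transpose J ** S \<theta> ** J + transpose Ed ** S \<theta> ** Ed)"
  have D: "pos_def (?D \<theta>)" if \<theta>: "\<theta> \<in> {Tmin..Tmax}" for \<theta>
    unfolding pos_def_def
  proof (intro conjI allI impI)
    show "symmetric_mat (?D \<theta>)"
      by (intro symmetric_diff symmetric_add symmetric_congruence S)
    fix v :: "real^'n" assume "v \<noteq> 0"
    have \<theta>0: "0 \<le> \<theta>" using \<theta> T by simp
    have "(J *v v) \<bullet> (S \<theta> *v (J *v v)) + (Ed *v v) \<bullet> (S \<theta> *v (Ed *v v)) \<le> v \<bullet> (Q P \<theta> *v v)"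
      unfolding Q_def expected_jump_quadratic[where \<Phi> = \<Phi> and \<theta> = \<theta>, OF fundamental_sq_integrable[OF M \<theta>0]]
      by (intro add_mono lower \<theta>0)
    also have "\<dots> < v \<bullet> (P *v v)"
      using P(2)[OF \<theta>] \<open>v \<noteq> 0\<close> by (auto simp: pos_def_def matrix_vector_mult_diff_rdistrib inner_diff_right)
    finally show "0 < v \<bullet> (?D \<theta> *v v)"
      by (simp only: matrix_vector_mult_diff_rdistrib matrix_vector_mult_add_rdistrib inner_diff_right inner_add_right
          quadratic_congruence S(1))
  qed
  have contS: "continuous_on U S" for U
    by (intro continuous_at_imp_continuous_on ballI has_vector_derivative_continuous[OF S(2)])
  have "continuous_on {Tmin..Tmax} ?D"
    by (intro continuous_on_diff continuous_on_add continuous_on_const contS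
        bounded_linear.continuous_on[OF bounded_bilinear.bounded_linear_left[OF bounded_bilinear_matrix_mult]]
        bounded_linear.continuous_on[OF bounded_bilinear.bounded_linear_right[OF bounded_bilinear_matrix_mult]])
  from uniformly_pos_def[OF compact_Icc this D]
  obtain e where e: "0 < e \<and> (\<forall>\<theta>\<in>{Tmin..Tmax}. \<forall>v. e * (norm v)\<^sup>2 \<le> v \<bullet> (?D \<theta> *v v))" ..
  have der: "vector_derivative S (at \<tau> within {0..Tmax}) = lyap A Ec (S \<tau>)" if "\<tau> \<in> {0..Tmax}" for \<tau>
    using that T by (intro vector_derivative_within_closed_interval has_vector_derivative_at_within[OF S(2)]) auto
  have "- vector_derivative S (at \<tau> within {0..Tmax}) + transpose A ** S \<tau> + S \<tau> ** A
      + transpose Ec ** S \<tau> ** Ec \<preceq>\<^sub>S 0" if "\<tau> \<in> {0..Tmax}" for \<tau>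
    unfolding der[OF that] by (simp add: lyap_def loewner_le_def pos_semidef_def symmetric_zero)
  moreover have "transpose J ** S \<theta> ** J - S 0 + transpose Ed ** S \<theta> ** Ed + e *\<^sub>R mat 1 \<preceq>\<^sub>S 0"
    if \<theta>: "\<theta> \<in> {Tmin..Tmax}" for \<theta>
    unfolding loewner_le_def pos_semidef_def
  proof (intro conjI allI)
    show "symmetric_mat (0 - (transpose J ** S \<theta> ** J - S 0 + transpose Ed ** S \<theta> ** Ed + e *\<^sub>R mat 1))"
      by (intro symmetric_diff symmetric_add symmetric_congruence symmetric_scaleR S symmetric_zero symmetric_mat_1)
    show "0 \<le> v \<bullet> ((0 - (transpose J ** S \<theta> ** J - S 0 + transpose Ed ** S \<theta> ** Ed + e *\<^sub>R mat 1)) *v v)" for v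
      using conjunct2[OF e, rule_format, OF \<theta>, of v]
      by (simp add: matrix_vector_mult_diff_rdistrib matrix_vector_mult_add_rdistrib inner_diff_right inner_add_right
          scaleR_matrix_vector_assoc[symmetric] power2_norm_eq_inner)
  qed
  moreover have "S differentiable_on {0..Tmax}"
    unfolding differentiable_on_def
    by (intro ballI differentiableI_vector[OF has_vector_derivative_at_within[OF S(2)]])
  ultimately show ?thesis
    unfolding clock_condition_def using S(1,3) P(1) conjunct1[OF e] by blast
qed

text \<open>Restates the matrix inequalities as inequalities of quadratic forms, with
  \<open>S'\<close> as an explicit derivative: the shape required both for the moment condition and
  for stability.\<close>

lemma clock_condition_lyapunov:
  assumes "clock_condition A Ec J Ed Tmin Tmax"
  shows "\<exists>S S' \<epsilon>. (\<forall>\<tau>\<in>{0..Tmax}. symmetric_mat (S \<tau>)) \<and> pos_def (S 0) \<and> 0 < \<epsilon> \<and>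
    (\<forall>\<tau>\<in>{0..Tmax}. (S has_vector_derivative S' \<tau>) (at \<tau> within {0..Tmax})) \<and>
    (\<forall>\<tau>\<in>{0..Tmax}. - S' \<tau> + lyap A Ec (S \<tau>) \<preceq>\<^sub>S 0) \<and>
    (\<forall>\<theta>\<in>{Tmin..Tmax}. \<forall>v. (J *v v) \<bullet> (S \<theta> *v (J *v v)) + (Ed *v v) \<bullet> (S \<theta> *v (Ed *v v))
      + \<epsilon> * (norm v)\<^sup>2 \<le> v \<bullet> (S 0 *v v))"
proof -
  from assms obtain S \<epsilon> where S: "\<forall>\<tau>\<in>{0..Tmax}. symmetric_mat (S \<tau>)" "S differentiable_on {0..Tmax}"
      "pos_def (S 0)" "\<epsilon> > 0"
      "\<forall>\<tau>\<in>{0..Tmax}. - vector_derivative S (at \<tau> within {0..Tmax})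
             + transpose A ** S \<tau> + S \<tau> ** A + transpose Ec ** S \<tau> ** Ec \<preceq>\<^sub>S 0"
      "\<forall>\<theta>\<in>{Tmin..Tmax}. transpose J ** S \<theta> ** J - S 0 + transpose Ed ** S \<theta> ** Ed + \<epsilon> *\<^sub>R mat 1 \<preceq>\<^sub>S 0"
    unfolding clock_condition_def by blast
  let ?S' = "\<lambda>\<tau>. vector_derivative S (at \<tau> within {0..Tmax})"
  show ?thesis
  proof (rule exI[of _ S], rule exI[of _ ?S'], rule exI[of _ \<epsilon>], intro conjI ballI allI)
    show "(S has_vector_derivative ?S' \<tau>) (at \<tau> within {0..Tmax})" if "\<tau> \<in> {0..Tmax}" for \<tau>
      using S(2) that by (simp add: differentiable_on_def vector_derivative_works)
    show "- ?S' \<tau> + lyap A Ec (S \<tau>) \<preceq>\<^sub>S 0" if "\<tau> \<in> {0..Tmax}" for \<tau>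
      using bspec[OF S(5) that] by (simp only: lyap_def add.assoc)
    show "(J *v v) \<bullet> (S \<theta> *v (J *v v)) + (Ed *v v) \<bullet> (S \<theta> *v (Ed *v v)) + \<epsilon> * (norm v)\<^sup>2 \<le> v \<bullet> (S 0 *v v)"
      if "\<theta> \<in> {Tmin..Tmax}" for \<theta> v
    proof -
      have "0 \<le> v \<bullet> ((0 - (transpose J ** S \<theta> ** J - S 0 + transpose Ed ** S \<theta> ** Ed + \<epsilon> *\<^sub>R mat 1)) *v v)"
        using bspec[OF S(6) that] by (simp only: loewner_le_def pos_semidef_def)
      then show ?thesis
        by (simp only: matrix_vector_mult_diff_rdistrib matrix_vector_mult_add_rdistrib inner_diff_right
            inner_add_right quadratic_congruence)
          (simp add: scaleR_matrix_vector_assoc[symmetric] power2_norm_eq_inner)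
    qed
  qed (use S in auto)
qed

text \<open>The witness is \<open>P = S 0\<close>. The differential inequality gives only a weak
  comparison; strictness comes from the margin \<open>\<epsilon>\<close>.\<close>

lemma clock_imp_moment:
  fixes \<Phi> :: "real \<Rightarrow> 'w \<Rightarrow> real^'n^'n"
  assumes T: "0 < Tmin" "Tmin \<le> Tmax"
    and M: "prob_space M" "wiener_process M W" "fundamental_solution M W A Ec \<Phi>"
    and clock: "clock_condition A Ec J Ed Tmin Tmax"
  shows "moment_condition M \<Phi> J Ed Tmin Tmax"
proof -
  from clock_condition_lyapunov[OF clock] obtain S S' \<epsilon> where
    S: "\<forall>\<tau>\<in>{0..Tmax}. symmetric_mat (S \<tau>)" "pos_def (S 0)" "0 < \<epsilon>"
    "\<forall>\<tau>\<in>{0..Tmax}. (S has_vector_derivative S' \<tau>) (at \<tau> within {0..Tmax})"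
    "\<forall>\<tau>\<in>{0..Tmax}. - S' \<tau> + lyap A Ec (S \<tau>) \<preceq>\<^sub>S 0"
    "\<forall>\<theta>\<in>{Tmin..Tmax}. \<forall>v. (J *v v) \<bullet> (S \<theta> *v (J *v v)) + (Ed *v v) \<bullet> (S \<theta> *v (Ed *v v))
      + \<epsilon> * (norm v)\<^sup>2 \<le> v \<bullet> (S 0 *v v)"
    by blast
  have symS: "symmetric_mat (S 0)" using S(2) by (simp add: pos_def_def)
  have "(\<integral>\<omega>. transpose J ** Xi \<Phi> (S 0) \<theta> \<omega> ** J + transpose Ed ** Xi \<Phi> (S 0) \<theta> \<omega> ** Ed \<partial>M) - S 0 \<prec>\<^sub>S 0"
    if \<theta>: "\<theta> \<in> {Tmin..Tmax}" for \<theta>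
    unfolding loewner_less_def pos_def_def
  proof (intro conjI allI impI)
    let ?Q = "\<integral>\<omega>. transpose J ** Xi \<Phi> (S 0) \<theta> \<omega> ** J + transpose Ed ** Xi \<Phi> (S 0) \<theta> \<omega> ** Ed \<partial>M"
    have \<theta>0: "0 \<le> \<theta>" using \<theta> T by simp
    note sq = fundamental_sq_integrable[OF M \<theta>0]
    show "symmetric_mat (0 - (?Q - S 0))"
      by (intro symmetric_diff symmetric_zero expected_jump_symmetric sq symS)
    fix v :: "real^'n" assume "v \<noteq> 0"
    have sub: "u \<in> {0..Tmax}" if "u \<in> {0..\<theta>}" for u using that \<theta> by auto
    have upper: "(\<integral>\<omega>. (\<Phi> \<theta> \<omega> *v w) \<bullet> (S 0 *v (\<Phi> \<theta> \<omega> *v w)) \<partial>M) \<le> w \<bullet> (S \<theta> *v w)" for w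
      using \<theta> by (intro fundamental_lyapunov[OF M \<theta>0, where S = S and S' = S'] bspec[OF S(5)]
          has_vector_derivative_within_subset[OF bspec[OF S(4)]] sub) auto
    have "v \<bullet> (?Q *v v) \<le> (J *v v) \<bullet> (S \<theta> *v (J *v v)) + (Ed *v v) \<bullet> (S \<theta> *v (Ed *v v))"
      unfolding expected_jump_quadratic[where \<Phi> = \<Phi> and \<theta> = \<theta>, OF sq] by (intro add_mono upper)
    moreover have "0 < \<epsilon> * (norm v)\<^sup>2" using S(3) \<open>v \<noteq> 0\<close> by simp
    ultimately have "v \<bullet> (?Q *v v) < v \<bullet> (S 0 *v v)" using S(6)[rule_format, OF \<theta>, of v] by linarith
    then show "0 < v \<bullet> ((0 - (?Q - S 0)) *v v)"
      by (simp add: matrix_vector_mult_diff_rdistrib inner_diff_right)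
  qed
  then show ?thesis unfolding moment_condition_def using S(2) by blast
qed

section \<open>Mean-square stability\<close>

lemma (in prob_space) jump_noise_moments:
  assumes "jump_noise M \<nu>" "1 \<le> k"
  shows "\<nu> k \<in> borel_measurable M" "integrable M (\<lambda>\<omega>. (\<nu> k \<omega>)\<^sup>2)"
    "expectation (\<nu> k) = 0" "expectation (\<lambda>\<omega>. (\<nu> k \<omega>)\<^sup>2) = 1"
proof -
  have \<nu>: "indep_vars (\<lambda>_. borel) \<nu> {1..}" "integrable M (\<lambda>\<omega>. (\<nu> k \<omega>)\<^sup>2)" "expectation (\<nu> k) = 0" "variance (\<nu> k) = 1"
    using assms by (auto simp: jump_noise_def)
  show "\<nu> k \<in> borel_measurable M" using \<nu>(1) assms(2) by (auto simp: indep_vars_def)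
  show "integrable M (\<lambda>\<omega>. (\<nu> k \<omega>)\<^sup>2)" "expectation (\<nu> k) = 0" by fact+
  show "expectation (\<lambda>\<omega>. (\<nu> k \<omega>)\<^sup>2) = 1" using \<nu>(3,4) by simp
qed

lemma (in prob_space) indep_set_commute: "indep_set A B \<Longrightarrow> indep_set B A"
  unfolding indep_sets2_eq by (metis Int_commute mult.commute)

text \<open>The noise lemma is applied to the sigma-algebra generated by \<open>X\<close> itself,
  since independence of the jump noise is available only relative to the state at the
  impulse.\<close>

lemma (in prob_space)
  fixes X :: "'a \<Rightarrow> real^'n" and J E :: "real^'n^'n"
  assumes X: "sq_integrable M X" and N: "N \<in> borel_measurable M" "integrable M (\<lambda>\<omega>. (N \<omega>)\<^sup>2)"
      "expectation N = 0" "expectation (\<lambda>\<omega>. (N \<omega>)\<^sup>2) = 1"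
    and ind: "indep_set (generated_events M N borel) (generated_events M X borel)"
  shows jump_sq_integrable: "sq_integrable M (\<lambda>\<omega>. J *v X \<omega> + N \<omega> *\<^sub>R (E *v X \<omega>))"
    and jump_expectation: "bounded_bilinear \<beta> \<Longrightarrow>
      expectation (\<lambda>\<omega>. \<beta> (J *v X \<omega> + N \<omega> *\<^sub>R (E *v X \<omega>)) (J *v X \<omega> + N \<omega> *\<^sub>R (E *v X \<omega>)) :: real) =
      expectation (\<lambda>\<omega>. \<beta> (J *v X \<omega>) (J *v X \<omega>)) + expectation (\<lambda>\<omega>. \<beta> (E *v X \<omega>) (E *v X \<omega>))"
proof -
  let ?G = "vimage_algebra (space M) X borel"
  have XM: "X \<in> borel_measurable M" using X by (simp add: sq_integrable_def)
  have G: "subalgebra M ?G"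
    by (auto simp: subalgebra_def sets_vimage_algebra2 intro: measurable_sets[OF XM])
  have XG: "X \<in> borel_measurable ?G" by (rule measurable_vimage_algebra1) simp
  have indG: "indep_set (sets ?G) (generated_events M N borel)"
    using indep_set_commute[OF ind] by (simp add: generated_events_def)
  have lin: "(\<lambda>\<omega>. B *v X \<omega>) \<in> borel_measurable ?G" "sq_integrable M (\<lambda>\<omega>. B *v X \<omega>)" for B :: "real^'n^'n"
    using bounded_linear_borel_measurable[OF matrix_vector_mul_bounded_linear XG]
      sq_integrable_linear[OF matrix_vector_mul_bounded_linear X] by auto
  show "sq_integrable M (\<lambda>\<omega>. J *v X \<omega> + N \<omega> *\<^sub>R (E *v X \<omega>))"
    by (rule sq_integrable_noise[OF G indG lin lin N(1,2,3)])
  assume "bounded_bilinear \<beta>"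
  from expectation_bilinear_noise[OF G indG lin lin N(1,2,3) this, of J E] N(4)
  show "expectation (\<lambda>\<omega>. \<beta> (J *v X \<omega> + N \<omega> *\<^sub>R (E *v X \<omega>)) (J *v X \<omega> + N \<omega> *\<^sub>R (E *v X \<omega>))) =
      expectation (\<lambda>\<omega>. \<beta> (J *v X \<omega>) (J *v X \<omega>)) + expectation (\<lambda>\<omega>. \<beta> (E *v X \<omega>) (E *v X \<omega>))"
    by simp
qed

text \<open>The linear lower bound excludes accumulation of impulses: every time is eventually
  passed by some \<open>t k\<close>.\<close>

lemma dwell_times_mono:
  assumes "0 < Tmin" "dwell_times_in Tmin Tmax t"
  shows "t k < t (Suc k)" "k * Tmin \<le> t k"
proof -
  have step: "Tmin \<le> t (Suc k) - t k" for k
    using assms(2) by (auto simp: dwell_times_in_def)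
  then show "t k < t (Suc k)" using assms(1) by (smt (verit))
  show "k * Tmin \<le> t k"
  proof (induction k)
    case 0
    then show ?case using assms(2) by (simp add: dwell_times_in_def)
  next
    case (Suc k)
    then show ?case using step[of k] by (simp add: algebra_simps)
  qed
qed

lemma quadratic_le_norm:
  fixes X :: "real^'n^'n"
  obtains c where "\<And>v. v \<bullet> (X *v v) \<le> c * (norm v)\<^sup>2"
proof -
  obtain K where K: "\<And>v. norm (X *v v) \<le> norm v * K"
    using bounded_linear.bounded[OF matrix_vector_mul_bounded_linear] by blast
  have "v \<bullet> (X *v v) \<le> K * (norm v)\<^sup>2" for v
  proof -
    have "v \<bullet> (X *v v) \<le> norm v * norm (X *v v)" by (rule norm_cauchy_schwarz)
    also have "\<dots> \<le> norm v * (norm v * K)" by (rule mult_left_mono[OF K]) simp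
    finally show ?thesis by (simp add: power2_eq_square mult_ac)
  qed
  then show thesis by (rule that)
qed

text \<open>After a jump the clock starts at \<open>S\<close> of the coming dwell time and reaches
  \<open>S 0\<close> just before the next impulse. There the jump inequality bounds the next
  starting value by the present form \<open>S 0\<close>, with a loss of
  \<open>\<epsilon> * m k\<close>. Comparing this loss with \<open>V k\<close> gives the geometric
  decay, and \<open>moment_bound\<close> controls the times in between.\<close>

lemma clock_imp_stable:
  fixes A J Ec Ed :: "real^'n^'n"
  assumes T: "0 < Tmin" "Tmin \<le> Tmax"
    and M: "prob_space M" "wiener_process M W" "jump_noise M \<nu>"
    and clock: "clock_condition A Ec J Ed Tmin Tmax" and dwell: "dwell_times_in Tmin Tmax t"
  shows "mean_square_stable M W \<nu> A Ec J Ed t"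
  unfolding mean_square_stable_def
proof (intro allI impI)
  fix x0 x assume sol: "impulsive_solution M W \<nu> A Ec J Ed t x0 x"
  interpret prob_space M by fact
  obtain F where F: "wiener_filtration M W F" "AE \<omega> in M. x 0 \<omega> = x0"
    "\<And>k. 1 \<le> k \<Longrightarrow> indep_set (generated_events M (\<nu> k) borel) (generated_events M (x (t k)) borel)"
    "\<And>k. solves_sde M W F (\<lambda>v. A *v v) (\<lambda>v. Ec *v v) (t k) (t (Suc k))
      (\<lambda>s \<omega>. if s = t k then post_jump J Ed \<nu> t x k \<omega> else x s \<omega>)"
    using sol unfolding impulsive_solution_def by blast
  have "wiener_noise M W F" by unfold_locales (fact M(2) F(1))+
  then interpret noise: wiener_noise M W F .
  obtain S S' \<epsilon> where
    S: "\<forall>\<tau>\<in>{0..Tmax}. symmetric_mat (S \<tau>)" "pos_def (S 0)" "0 < \<epsilon>"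
    "\<forall>\<tau>\<in>{0..Tmax}. (S has_vector_derivative S' \<tau>) (at \<tau> within {0..Tmax})"
    "\<forall>\<tau>\<in>{0..Tmax}. - S' \<tau> + lyap A Ec (S \<tau>) \<preceq>\<^sub>S 0"
    "\<forall>\<theta>\<in>{Tmin..Tmax}. \<forall>v. (J *v v) \<bullet> (S \<theta> *v (J *v v)) + (Ed *v v) \<bullet> (S \<theta> *v (Ed *v v))
      + \<epsilon> * (norm v)\<^sup>2 \<le> v \<bullet> (S 0 *v v)"
    using clock_condition_lyapunov[OF clock] by blast
  obtain K where K: "\<And>v. norm (A *v v) \<le> K * norm v" "\<And>v. norm (Ec *v v) \<le> K * norm v"
    using bounded_linear_common_bound[OF matrix_vector_mul_bounded_linear[of A] matrix_vector_mul_bounded_linear[of Ec]]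
    by blast
  note mv = matrix_vector_mul_bounded_linear
  have t: "t k < t (Suc k)" "0 \<le> t k" "t (Suc k) - t k \<in> {Tmin..Tmax}" "t (Suc k) - t k \<le> Tmax" for k
    using dwell_times_mono[OF T(1) dwell, of k] dwell T(1) order_trans[of 0 "k * Tmin" "t k"]
    by (auto simp: dwell_times_in_def)
  define y where "y = post_jump J Ed \<nu> t x"
  define Y where "Y k s \<omega> = (if s = t k then y k \<omega> else x s \<omega>)" for k s \<omega>
  have Y_eq: "Y k (t k) = y k" "s \<noteq> t k \<Longrightarrow> Y k s = x s" for k s
    by (auto simp: Y_def)
  have solves_Y: "solves_sde M W F (\<lambda>v. A *v v) (\<lambda>v. Ec *v v) (t k) (t (Suc k)) (Y k)" for k
    using F(4)[of k] unfolding Y_def[abs_def] y_def .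
  have sde: "linear_sde M W F (\<lambda>v. A *v v) (\<lambda>v. Ec *v v) K Tmax (t k) (t (Suc k)) (Y k)"
    if "sq_integrable M (y k)" for k
    using t[of k] that
    by (intro linear_sde.intro noise.wiener_noise_axioms linear_sde_axioms.intro mv K solves_Y) (simp_all add: Y_eq(1))
  have k1: "1 \<le> Suc k" for k by simp
  have jump: "sq_integrable M (y (Suc k))"
    "bounded_bilinear \<beta> \<Longrightarrow> expectation (\<lambda>\<omega>. \<beta> (y (Suc k) \<omega>) (y (Suc k) \<omega>) :: real) =
      expectation (\<lambda>\<omega>. \<beta> (J *v x (t (Suc k)) \<omega>) (J *v x (t (Suc k)) \<omega>))
      + expectation (\<lambda>\<omega>. \<beta> (Ed *v x (t (Suc k)) \<omega>) (Ed *v x (t (Suc k)) \<omega>))"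
    if "sq_integrable M (x (t (Suc k)))" for k \<beta>
    using jump_sq_integrable[OF that jump_noise_moments[OF M(3) k1] F(3)[OF k1], of J Ed]
      jump_expectation[OF that jump_noise_moments[OF M(3) k1] F(3)[OF k1], of \<beta> J Ed]
    by (simp_all add: y_def post_jump_def[abs_def])
  \<comment> \<open>Only the initial state is known to be square integrable. The moment bound
    carries this along an interval and the noise lemma across the impulse, so
    \<open>linear_sde\<close> can be instantiated one interval after another.\<close>
  have sq: "sq_integrable M (y k)" for k
  proof (induction k)
    case 0
    have y0: "y 0 = x 0"
      using dwell by (simp add: y_def post_jump_def[abs_def] dwell_times_in_def)
    have "Y 0 (t 0) \<in> borel_measurable (F (t 0))"
      using solves_Y[of 0] t(1)[of 0] unfolding solves_sde_def by auto
    then have "x 0 \<in> borel_measurable M"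
      unfolding Y_eq(1) y0 by (rule measurable_from_subalg[OF noise.subalgebra_F])
    then show ?case unfolding y0 by (rule sq_integrable_AE_const) (rule F(2))
  next
    case (Suc k)
    interpret linear_sde M W F "\<lambda>v. A *v v" "\<lambda>v. Ec *v v" K Tmax "t k" "t (Suc k)" "Y k"
      by (rule sde[OF Suc])
    have "sq_integrable M (Y k (t (Suc k)))" using t(1)[of k] by (intro Y_sq_integrable) simp
    then show ?case using t(1)[of k] by (intro jump(1)) (simp add: Y_eq(2))
  qed
  \<comment> \<open>The value of \<open>moment_bound\<close> for \<open>L = Tmax\<close>, common to
    all intervals.\<close>
  define mb where "mb = 4 * exp ((8 * K\<^sup>2 * (Tmax + 1) + 1) * Tmax)"
  have flow: "sq_integrable M (x s)"
    "expectation (\<lambda>\<omega>. (norm (x s \<omega>))\<^sup>2) \<le> mb * expectation (\<lambda>\<omega>. (norm (y k \<omega>))\<^sup>2)"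
    if "t k < s" "s \<le> t (Suc k)" for k s
  proof -
    interpret linear_sde M W F "\<lambda>v. A *v v" "\<lambda>v. Ec *v v" K Tmax "t k" "t (Suc k)" "Y k"
      by (rule sde[OF sq])
    have s: "s \<in> {t k..t (Suc k)}" "Y k s = x s" using that by (auto simp: Y_eq(2))
    show "sq_integrable M (x s)" using Y_sq_integrable[OF s(1)] unfolding s(2) .
    show "expectation (\<lambda>\<omega>. (norm (x s \<omega>))\<^sup>2) \<le> mb * expectation (\<lambda>\<omega>. (norm (y k \<omega>))\<^sup>2)"
      using Y_moment_bound[OF s(1)] unfolding s(2) Y_eq(1) moment_bound_def mb_def .
  qed
  \<comment> \<open>States just before the impulses. The index is shifted because there is no jump
    at \<open>t 0\<close>.\<close>
  define z where "z k = x (t (Suc k))" for k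
  define V where "V k = expectation (\<lambda>\<omega>. z k \<omega> \<bullet> (S 0 *v z k \<omega>))" for k
  define m where "m k = expectation (\<lambda>\<omega>. (norm (z k \<omega>))\<^sup>2)" for k
  have z: "sq_integrable M (z k)" for k
    unfolding z_def using t(1)[of k] by (intro flow(1)) auto
  have form: "bounded_bilinear (\<lambda>u w. u \<bullet> (Q *v w))" for Q :: "real^'n^'n"
    using bounded_bilinear.comp[OF bounded_bilinear_inner bounded_linear_ident mv[of Q]] .
  have int: "integrable M (\<lambda>\<omega>. z k \<omega> \<bullet> (S 0 *v z k \<omega>))" "integrable M (\<lambda>\<omega>. (norm (z k \<omega>))\<^sup>2)"
    "integrable M (\<lambda>\<omega>. (B *v z k \<omega>) \<bullet> (Q *v (B *v z k \<omega>)))" for k and B Q :: "real^'n^'n"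
    using integrable_bilinear[OF form z z] sq_integrable_norm[OF z]
      integrable_bilinear[OF form sq_integrable_linear[OF mv z] sq_integrable_linear[OF mv z]] by auto
  have decrease: "V (Suc k) + \<epsilon> * m k \<le> V k" for k
  proof -
    let ?\<theta> = "t (Suc (Suc k)) - t (Suc k)"
    interpret linear_sde M W F "\<lambda>v. A *v v" "\<lambda>v. Ec *v v" K Tmax "t (Suc k)" "t (Suc (Suc k))" "Y (Suc k)"
      by (rule sde[OF sq])
    have \<theta>: "?\<theta> \<in> {Tmin..Tmax}" by (rule t(3))
    have sub: "u \<in> {0..Tmax}" "{0..?\<theta>} \<subseteq> {0..Tmax}" if "u \<in> {0..?\<theta>}" for u
      using that \<theta> by auto
    have "expectation (\<lambda>\<omega>. Y (Suc k) (t (Suc (Suc k))) \<omega> \<bullet> (S 0 *v Y (Suc k) (t (Suc (Suc k))) \<omega>))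
        \<le> expectation (\<lambda>\<omega>. Y (Suc k) (t (Suc k)) \<omega> \<bullet> (S ?\<theta> *v Y (Suc k) (t (Suc k)) \<omega>))"
      by (rule lyapunov_decreasing[where \<psi> = "\<lambda>v. v" and A = A and E = Ec and S' = S' and S = S,
            OF bounded_linear_ident refl refl has_vector_derivative_within_subset[OF bspec[OF S(4) sub(1)] sub(2)]
              bspec[OF S(5) sub(1)]])
    then have "V (Suc k) \<le> expectation (\<lambda>\<omega>. y (Suc k) \<omega> \<bullet> (S ?\<theta> *v y (Suc k) \<omega>))"
      using t(1)[of "Suc k"] by (simp add: V_def z_def Y_eq)
    also have "\<dots> = expectation (\<lambda>\<omega>. (J *v z k \<omega>) \<bullet> (S ?\<theta> *v (J *v z k \<omega>)))
        + expectation (\<lambda>\<omega>. (Ed *v z k \<omega>) \<bullet> (S ?\<theta> *v (Ed *v z k \<omega>)))"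
      using jump(2)[OF z[unfolded z_def] form] by (simp only: z_def)
    finally have "V (Suc k) + \<epsilon> * m k \<le> expectation (\<lambda>\<omega>. (J *v z k \<omega>) \<bullet> (S ?\<theta> *v (J *v z k \<omega>))
        + (Ed *v z k \<omega>) \<bullet> (S ?\<theta> *v (Ed *v z k \<omega>)) + \<epsilon> * (norm (z k \<omega>))\<^sup>2)"
      using int by (simp add: m_def)
    also have "\<dots> \<le> V k"
      unfolding V_def using S(6) \<theta>
      by (intro integral_mono Bochner_Integration.integrable_add integrable_mult_right int) blast
    finally show ?thesis .
  qed
  obtain c0 where c0: "\<And>v. v \<bullet> (S 0 *v v) \<le> c0 * (norm v)\<^sup>2"
    using quadratic_le_norm by blast
  \<comment> \<open>Taking the maximum with \<open>\<epsilon>\<close> ensures that \<open>c\<close>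
    is positive and that \<open>1 - \<epsilon> / c\<close> is nonnegative.\<close>
  define c where "c = max c0 \<epsilon>"
  have c: "0 < c" "\<epsilon> \<le> c" using S(3) by (auto simp: c_def)
  have m0: "0 \<le> m k" for k by (simp add: m_def)
  have V_le: "V k \<le> c * m k" for k
  proof -
    have "z k \<omega> \<bullet> (S 0 *v z k \<omega>) \<le> c * (norm (z k \<omega>))\<^sup>2" for \<omega>
      by (rule order_trans[OF c0 mult_right_mono]) (auto simp: c_def)
    then have "V k \<le> expectation (\<lambda>\<omega>. c * (norm (z k \<omega>))\<^sup>2)"
      unfolding V_def by (intro integral_mono integrable_mult_right int)
    then show ?thesis by (simp add: m_def)
  qed
  define r where "r = 1 - \<epsilon> / c"
  have r: "0 \<le> r" "r < 1" using c S(3) by (auto simp: r_def)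
  have V_step: "V (Suc k) \<le> r * V k" for k
  proof -
    have "(\<epsilon> / c) * V k \<le> (\<epsilon> / c) * (c * m k)"
      using c S(3) by (intro mult_left_mono V_le) auto
    also have "\<dots> = \<epsilon> * m k" using c by simp
    finally show ?thesis using decrease[of k] by (simp add: r_def algebra_simps)
  qed
  have V_pow: "V k \<le> r ^ k * V 0" for k
  proof (induction k)
    case (Suc k)
    have "V (Suc k) \<le> r * V k" by (rule V_step)
    also have "\<dots> \<le> r * (r ^ k * V 0)" by (rule mult_left_mono[OF Suc r(1)])
    finally show ?case by (simp add: mult.assoc)
  qed simp
  have "\<exists>l>0. \<forall>t\<in>{0::real}. \<forall>v. l * (norm v)\<^sup>2 \<le> v \<bullet> (S 0 *v v)"
    using S(2) by (intro uniformly_pos_def) auto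
  then obtain l where l: "0 < l" "\<And>v. l * (norm v)\<^sup>2 \<le> v \<bullet> (S 0 *v v)" by auto
  have m_le: "m k \<le> r ^ k * V 0 / l" for k
  proof -
    have "l * m k = expectation (\<lambda>\<omega>. l * (norm (z k \<omega>))\<^sup>2)" by (simp add: m_def)
    also have "\<dots> \<le> V k" unfolding V_def by (intro integral_mono integrable_mult_right int l(2))
    finally show ?thesis using V_pow[of k] l(1) by (simp add: pos_le_divide_eq mult.commute)
  qed
  obtain kJ where kJ: "\<And>v. norm (J *v v) \<le> kJ * norm v" "\<And>v. norm (Ed *v v) \<le> kJ * norm v"
    using bounded_linear_common_bound[OF mv[of J] mv[of Ed]] by blast
  have y_le: "expectation (\<lambda>\<omega>. (norm (y (Suc k) \<omega>))\<^sup>2) \<le> 2 * kJ\<^sup>2 * m k" for k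
    using expectation_norm_linear_squared_le[OF mv kJ(1) z[of k]]
      expectation_norm_linear_squared_le[OF mv kJ(2) z[of k]]
      jump(2)[OF z[unfolded z_def] bounded_bilinear_inner, of k]
    unfolding m_def power2_norm_eq_inner z_def by linarith
  \<comment> \<open>Three factors: \<open>V 0 / l\<close> from the decay just before impulses,
    \<open>2 * kJ\<^sup>2\<close> from the jump (one \<open>kJ\<^sup>2\<close> each for
    \<open>J\<close> and \<open>Ed\<close>), and \<open>mb\<close> from the flow afterwards.\<close>
  define C where "C = mb * (2 * kJ\<^sup>2 * (V 0 / l))"
  have bound: "expectation (\<lambda>\<omega>. (norm (x s \<omega>))\<^sup>2) \<le> C * r ^ k" if "t (Suc k) < s" "s \<le> t (Suc (Suc k))" for k s
  proof -
    have "mb * expectation (\<lambda>\<omega>. (norm (y (Suc k) \<omega>))\<^sup>2) \<le> mb * (2 * kJ\<^sup>2 * m k)"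
      by (intro mult_left_mono y_le) (simp add: mb_def)
    also have "\<dots> \<le> mb * (2 * kJ\<^sup>2 * (r ^ k * V 0 / l))"
      by (intro mult_left_mono m_le) (auto simp: mb_def)
    also have "\<dots> = C * r ^ k" by (simp add: C_def)
    finally show ?thesis using flow(2)[OF that] by linarith
  qed
  \<comment> \<open>Take the least index whose impulse time is not before \<open>s\<close>. It
    exceeds \<open>Suc N\<close>, so subtracting 2 in the naturals loses nothing.\<close>
  have locate: "\<exists>k\<ge>N. t (Suc k) < s \<and> s \<le> t (Suc (Suc k))" if s: "t (Suc N) < s" for N s
  proof -
    obtain n :: nat where "s / Tmin < n" using reals_Archimedean2 by blast
    then have "s \<le> t n"
      using dwell_times_mono(2)[OF T(1) dwell, of n] T(1) by (simp add: pos_divide_less_eq)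
    have "\<exists>k. s \<le> t k \<and> (\<forall>j<k. \<not> s \<le> t j)"
      using exists_least_iff[of "\<lambda>k. s \<le> t k"] \<open>s \<le> t n\<close> by blast
    then obtain k where k: "s \<le> t k" "\<And>j. j < k \<Longrightarrow> t j < s" by (auto simp: not_le)
    have "strict_mono t" by (rule strict_monoI_Suc) (rule t(1))
    moreover have "t (Suc N) < t k" using s k(1) by simp
    ultimately have "Suc N < k" by (simp add: strict_mono_less)
    then have "k = Suc (Suc (k - 2))" "N \<le> k - 2" by auto
    then show ?thesis using k by (metis lessI)
  qed
  have "((\<lambda>s. expectation (\<lambda>\<omega>. (norm (x s \<omega>))\<^sup>2)) \<longlongrightarrow> 0) at_top"
  proof (rule order_tendstoI)
    fix e :: real assume "e < 0"
    then show "\<forall>\<^sub>F s in at_top. e < expectation (\<lambda>\<omega>. (norm (x s \<omega>))\<^sup>2)"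
      by (intro always_eventually allI) (rule order.strict_trans2[of e 0], simp_all)
  next
    fix e :: real assume "0 < e"
    have "(\<lambda>k. C * r ^ k) \<longlonglongrightarrow> C * 0"
      using r by (intro tendsto_intros LIMSEQ_realpow_zero) auto
    then have "\<forall>\<^sub>F k in sequentially. C * r ^ k < e"
      using \<open>0 < e\<close> by (intro order_tendstoD(2)) auto
    then obtain N where N: "\<And>k. N \<le> k \<Longrightarrow> C * r ^ k < e"
      unfolding eventually_sequentially by blast
    show "\<forall>\<^sub>F s in at_top. expectation (\<lambda>\<omega>. (norm (x s \<omega>))\<^sup>2) < e"
      using eventually_gt_at_top[of "t (Suc N)"]
    proof eventually_elim
      case (elim s)
      then obtain k where "N \<le> k" "t (Suc k) < s" "s \<le> t (Suc (Suc k))" using locate by blast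
      then show ?case using bound[of k s] N[of k] by linarith
    qed
  qed
  then have "((\<lambda>s. ennreal (expectation (\<lambda>\<omega>. (norm (x s \<omega>))\<^sup>2))) \<longlongrightarrow> ennreal 0) at_top"
    by (rule tendsto_ennrealI)
  \<comment> \<open>Square integrability from \<open>flow\<close> makes the nonnegative integral
    finite and equal to the expectation.\<close>
  moreover have "\<forall>\<^sub>F s in at_top. ennreal (expectation (\<lambda>\<omega>. (norm (x s \<omega>))\<^sup>2)) = (\<integral>\<^sup>+ \<omega>. ennreal ((norm (x s \<omega>))\<^sup>2) \<partial>M)"
    using eventually_gt_at_top[of "t (Suc 0)"]
  proof eventually_elim
    case (elim s)
    then obtain k where "t (Suc k) < s" "s \<le> t (Suc (Suc k))" using locate by blast
    from sq_integrable_norm[OF flow(1)[OF this]] show ?case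
      by (intro nn_integral_eq_integral[symmetric]) auto
  qed
  ultimately show "((\<lambda>s. \<integral>\<^sup>+ \<omega>. ennreal ((norm (x s \<omega>))\<^sup>2) \<partial>M) \<longlongrightarrow> 0) at_top"
    by (simp add: Lim_transform_eventually)
qed

theorem theorem6:
  fixes A J Ec Ed :: "real ^ 'n ^ 'n"
    and Tmin Tmax :: real
    and M :: "'w measure"
    and W :: "real \<Rightarrow> 'w \<Rightarrow> real"
    and \<nu> :: "nat \<Rightarrow> 'w \<Rightarrow> real"
    and \<Phi> :: "real \<Rightarrow> 'w \<Rightarrow> real ^ 'n ^ 'n"
  assumes "0 < Tmin" and "Tmin \<le> Tmax"
    and "prob_space M"
    and "wiener_process M W"
    and "jump_noise M \<nu>"
    and "independent_noises M W \<nu>"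
    and "fundamental_solution M W A Ec \<Phi>"
  shows "(moment_condition M \<Phi> J Ed Tmin Tmax \<longleftrightarrow> clock_condition A Ec J Ed Tmin Tmax) \<and>
    (moment_condition M \<Phi> J Ed Tmin Tmax \<or> clock_condition A Ec J Ed Tmin Tmax \<longrightarrow>
      (\<forall>t. dwell_times_in Tmin Tmax t \<longrightarrow> mean_square_stable M W \<nu> A Ec J Ed t))"
proof -
  note T = assms(1,2) and M = assms(3,4) and \<Phi> = assms(7)
  have "moment_condition M \<Phi> J Ed Tmin Tmax \<longleftrightarrow> clock_condition A Ec J Ed Tmin Tmax"
    using moment_imp_clock[OF T M \<Phi>] clock_imp_moment[OF T M \<Phi>] by blast
  then show ?thesis
    using clock_imp_stable[OF T M assms(5)] by blast
qed

end
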